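(* Let $n>25$, let $\mathcal{K}\subset\mathbb{R}^n$ be a bounded convex set with nonempty interior, and let $b>0$ satisfy $0\leq b\leq\frac{n}{2\log_2 n}$ and $\rho_{\mathcal{K}}(\mathbb{Z}^n)<n^b$. Let $\delta,\varepsilon\in(0,1)$ and assume $\mathrm{vol}(\mathcal{K})\geq c_3\left(\frac{1}{\varepsilon\delta}\right)^6 n^{3(1+2b)}$, where $c_3=e\cdot 2^{33}$. Let $p$ be a prime with $$\frac{1024}{(\varepsilon\delta)^2}n^{1+2b}\leq p\leq\frac{2048}{(\varepsilon\delta)^2}n^{1+2b},$$ and let $r=3+\left\lceil\frac{n}{\log p}\left(b\log n+\log 3\right)\right\rceil$. If $L$ is drawn from the random $(p,r)$ construction A ensemble (so that $\mathrm{covol}(p^{r/n}L)=1$), then $$\Pr\big(\eta(\mathcal{K},p^{r/n}L)\geq\varepsilon\big)<\delta.$$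
   Context: For a lattice $L\subset\mathbb{R}^n$, a bounded convex set $\mathcal{K}$ with nonempty interior and $x\in\mathbb{R}^n$, let $N(L,\mathcal{K},x)=|L\cap(\mathcal{K}+x)|$ and $\eta(\mathcal{K},L)=\sup_{x\in\mathbb{R}^n}\left|\frac{N(L,\mathcal{K},x)}{\mathrm{vol}(\mathcal{K})/\mathrm{covol}(L)}-1\right|$. $(L,\mathcal{K})$ is a covering if $L+\mathcal{K}=\mathbb{R}^n$, and a packing if the translates $\ell+\mathcal{K}$, $\ell\in L$, are pairwise disjoint. $\mathrm{r}_{\mathrm{cov},\mathcal{K}}(L)$ is the infimum of $\alpha>0$ such that $(L,\alpha\mathcal{K})$ is a covering, $\mathrm{r}_{\mathrm{pack},\mathcal{K}}(L)$ the supremum of $\alpha>0$ such that $(L,\alpha\mathcal{K})$ is a packing, and $\rho_{\mathcal{K}}(L)=\mathrm{r}_{\mathrm{cov},\mathcal{K}}(L)/\mathrm{r}_{\mathrm{pack},\mathcal{K}}(L)$. Random $(p,r)$ construction A ensemble: for a prime $p$ let $\pi_p:\mathbb{Z}^n\to\mathbb{F}_p^n$ be coordinatewise reduction mod $p$; draw $S$ uniformly from the set $\mathrm{Gr}_{n,r}(\mathbb{F}_p)$ of $r$-dimensional subspaces of $\mathbb{F}_p^n$ and set $L=\frac1p\pi_p^{-1}(S)$. Logarithms are natural. *)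

theory Defs
  imports
    "HOL-Probability.Probability"
    "Berlekamp_Zassenhaus.Finite_Field"
begin

text \<open>
  The dimension \<open>n\<close> is \<open>CARD('n)\<close>, and \<open>F\<^sub>p\<close> is the type \<open>'p mod_ring\<close> of integers modulo
  \<open>p = CARD('p)\<close>; the class \<open>prime_card\<close> says that \<open>p\<close> is prime.
\<close>

definition real_vec :: "int ^ 'n \<Rightarrow> real ^ 'n" where
  "real_vec v = (\<chi> i. of_int (v $ i))"

definition int_lattice :: "(real ^ 'n) set" where
  "int_lattice = range real_vec"

definition dilate :: "real \<Rightarrow> 'a::real_vector set \<Rightarrow> 'a set" where
  "dilate \<alpha> A = (\<lambda>x. \<alpha> *\<^sub>R x) ` A"

text \<open>
  A (full-rank) lattice is the image of the integer lattice under an invertible matrix;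
  two such matrices for the same lattice have the same determinant up to sign.
\<close>

definition covol :: "(real ^ 'n) set \<Rightarrow> real" where
  "covol L = (THE d. \<exists>A :: real ^ 'n ^ 'n.
     invertible A \<and> L = (\<lambda>x. A *v x) ` int_lattice \<and> d = \<bar>det A\<bar>)"

definition num_points :: "(real ^ 'n) set \<Rightarrow> (real ^ 'n) set \<Rightarrow> real ^ 'n \<Rightarrow> nat" where
  "num_points L K x = card (L \<inter> (\<lambda>y. y + x) ` K)"

text \<open>
  The volume is taken in \<open>lebesgue\<close>, since a convex set need not be Borel. For a lattice \<open>L\<close> and
  a bounded \<open>K\<close> the intersections counted by \<open>num_points\<close> are finite, of size bounded
  uniformly in \<open>x\<close>, so the supremum below is a genuine real supremum.
\<close>

definition eta :: "(real ^ 'n) set \<Rightarrow> (real ^ 'n) set \<Rightarrow> real" where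
  "eta K L = (SUP x. \<bar>real (num_points L K x) / (measure lebesgue K / covol L) - 1\<bar>)"

definition is_covering :: "(real ^ 'n) set \<Rightarrow> (real ^ 'n) set \<Rightarrow> bool" where
  "is_covering L K \<longleftrightarrow> (\<Union>l\<in>L. (\<lambda>y. l + y) ` K) = UNIV"

definition is_packing :: "(real ^ 'n) set \<Rightarrow> (real ^ 'n) set \<Rightarrow> bool" where
  "is_packing L K \<longleftrightarrow> disjoint_family_on (\<lambda>l. (\<lambda>y. l + y) ` K) L"

definition r_cov :: "(real ^ 'n) set \<Rightarrow> (real ^ 'n) set \<Rightarrow> real" where
  "r_cov K L = Inf {\<alpha>. \<alpha> > 0 \<and> is_covering L (dilate \<alpha> K)}"

definition r_pack :: "(real ^ 'n) set \<Rightarrow> (real ^ 'n) set \<Rightarrow> real" where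
  "r_pack K L = Sup {\<alpha>. \<alpha> > 0 \<and> is_packing L (dilate \<alpha> K)}"

definition rho :: "(real ^ 'n) set \<Rightarrow> (real ^ 'n) set \<Rightarrow> real" where
  "rho K L = r_cov K L / r_pack K L"

definition reduce_mod :: "int ^ 'n \<Rightarrow> ('p::prime_card mod_ring) ^ 'n" where
  "reduce_mod v = (\<chi> i. of_int (v $ i))"

definition Gr :: "nat \<Rightarrow> (('p::prime_card mod_ring) ^ 'n) set set" where
  "Gr r = {S. vec.subspace S \<and> vec.dim S = r}"

definition construction_A :: "(('p::prime_card mod_ring) ^ 'n) set \<Rightarrow> (real ^ 'n) set" where
  "construction_A S = dilate (1 / real CARD('p)) (real_vec ` (reduce_mod -` S))"

text \<open>
  \<open>Gr r\<close> is finite, and nonempty when \<open>r \<le> CARD('n)\<close>; only then is \<open>pmf_of_set\<close> meaningful.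
\<close>

definition construction_A_ensemble ::
  "'p::prime_card itself \<Rightarrow> nat \<Rightarrow> (real ^ 'n) set pmf" where
  "construction_A_ensemble _ r =
     map_pmf construction_A (pmf_of_set (Gr r :: (('p mod_ring) ^ 'n) set set))"

end

theory Submission
  imports Defs
begin

text \<open>
  A covering dilate \<open>\<alpha> K\<close> and a packing dilate \<open>\<beta> K\<close> of the integer lattice with
  \<open>\<alpha> / \<beta> < n\<^sup>b\<close> reduce the counts in all real translates of \<open>K\<close> to weighted counts over
  the cosets of the random subspace \<open>S\<close> of \<open>F\<^sub>p\<^sup>n\<close>: the weight of a residue class is the number of
  its integer points in a slightly dilated or shrunken \<open>K\<close>. The \<open>ln 3\<close> in \<open>r\<close> keeps every weight
  below \<open>p\<^sup>-\<^sup>3\<close> times the expected weight of a coset.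

  Suppose many \<open>S\<close> had an unbalanced coset. Let \<open>T\<close> be a random subspace of codimension two in \<open>S\<close>.
  By a second moment bound, inside \<open>F\<^sub>p\<^sup>n\<close> only very few cosets of \<open>T\<close> have an exceptional weight, but
  inside the unbalanced coset of \<open>S\<close> nearly all of them do. So the exceptional cosets form a set of
  small density in \<open>F\<^sub>p\<^sup>n / T\<close> which contains most of a plane in many directions. The polynomial
  method with multiplicities excludes this. For lines a density of \<open>2\<close> to the power \<open>- n\<close> would be
  possible; planes are what makes the bound only slightly smaller than one when \<open>p\<close> is large
  compared to \<open>n\<close>.
\<close>

text \<open>A union bound over cosets is out of reach: a second moment controls one coset of
  \<open>S\<close> up to a failure probability of order p^-3, while there are p^(n-r) cosets. The
  estimate on planes replaces it because one bad coset is enough to trigger it: shearing the hash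
  functions turns that coset into planes in many directions.

  The polynomial method runs over the ring F_p[s] instead of F_p. This ring is infinite, so
  polynomial functions determine their coefficients and generic directions exist. It also merges the
  two direction vectors a, b of a plane into the single point a + s b. A family of planes thus
  becomes a set of points in a grid with p^2 values per coordinate, at which the leading form of the
  vanishing polynomial has high multiplicity.

  The proportions follow one budget. A share \<delta>/2 of bad subspaces forces \<delta>/4 of bad
  row tuples and \<delta>/8 of rich hash functions; \<delta>/16 survive when the hash functions with
  too many exceptional buckets are discarded. The estimate on planes permits only 2 n / p.\<close>

hide_const (open) up_ring.coeff up_ring.monom Coset.order module.smult

section \<open>Polynomial functions and multiplicities along lines\<close>

text \<open>Polynomials enter as functions with an upper bound on the degree, not as syntactic
  objects. Substituting linear forms, splitting off a variable and restricting to a line are then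
  inductions over this predicate.\<close>

inductive polyfun :: "nat set \<Rightarrow> nat \<Rightarrow> ((nat \<Rightarrow> 'r::comm_ring_1) \<Rightarrow> 'r) \<Rightarrow> bool" for V where
  const: "polyfun V d (\<lambda>x. c)"
| var: "i \<in> V \<Longrightarrow> polyfun V (Suc d) (\<lambda>x. x i)"
| add: "polyfun V d f \<Longrightarrow> polyfun V d g \<Longrightarrow> polyfun V d (\<lambda>x. f x + g x)"
| mult: "polyfun V d f \<Longrightarrow> polyfun V e g \<Longrightarrow> polyfun V (d + e) (\<lambda>x. f x * g x)"

lemma polyfun_mono:
  assumes "polyfun V d f" "d \<le> e"
  shows "polyfun V e f"
  using polyfun.mult[OF polyfun.const[of V "e - d" 1] assms(1)] assms(2) by simp

lemma polyfun_cmult: "polyfun V d f \<Longrightarrow> polyfun V d (\<lambda>x. c * f x)"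
  using polyfun.mult[OF polyfun.const[of V 0 c]] by simp

lemma polyfun_sum: "(\<And>i. i \<in> I \<Longrightarrow> polyfun V d (f i)) \<Longrightarrow> polyfun V d (\<lambda>x. \<Sum>i\<in>I. f i x)"
proof (induction I rule: infinite_finite_induct)
  case (insert i I)
  then show ?case using polyfun.add[of V d "f i" "\<lambda>x. \<Sum>i\<in>I. f i x"] by simp
qed (auto intro: polyfun.const)

lemma polyfun_power: "polyfun V d f \<Longrightarrow> polyfun V (k * d) (\<lambda>x. f x ^ k)"
proof (induction k)
  case (Suc k)
  then show ?case using polyfun.mult[of V d f "k * d" "\<lambda>x. f x ^ k"] by simp
qed (auto intro: polyfun.const)

lemma polyfun_prod: "(\<And>i. i \<in> I \<Longrightarrow> polyfun V (d i) (f i)) \<Longrightarrow> polyfun V (\<Sum>i\<in>I. d i) (\<lambda>x. \<Prod>i\<in>I. f i x)"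
proof (induction I rule: infinite_finite_induct)
  case (insert i I)
  then show ?case using polyfun.mult[of V "d i" "f i" "sum d I" "\<lambda>x. \<Prod>i\<in>I. f i x"] by simp
qed (auto intro: polyfun.const)

lemma polyfun_cong:
  assumes "polyfun V d f" "\<forall>i\<in>V. x i = y i"
  shows "f x = f y"
proof -
  have "\<forall>x y. (\<forall>i\<in>V. x i = y i) \<longrightarrow> f x = f y"
    using assms(1)
  proof (induction rule: polyfun.induct)
    case (add d f g)
    show ?case
    proof (intro allI impI)
      fix x y :: "nat \<Rightarrow> 'a" assume "\<forall>i\<in>V. x i = y i"
      with add.IH have "f x = f y" "g x = g y" by blast+
      then show "f x + g x = f y + g y" by (rule arg_cong2)
    qed
  next
    case (mult d f e g)
    show ?case
    proof (intro allI impI)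
      fix x y :: "nat \<Rightarrow> 'a" assume "\<forall>i\<in>V. x i = y i"
      with mult.IH have "f x = f y" "g x = g y" by blast+
      then show "f x * g x = f y * g y" by (rule arg_cong2)
    qed
  qed simp_all
  with assms(2) show ?thesis by blast
qed

lemma polyfun_subst:
  assumes "polyfun V d f" "\<And>i. i \<in> V \<Longrightarrow> polyfun W 1 (\<lambda>x. l x i)"
  shows "polyfun W d (\<lambda>x. f (l x))"
  using assms
proof (induction)
  case (const d c)
  show ?case by (rule polyfun.const)
next
  case (var i d)
  show ?case by (rule polyfun_mono[OF var(2)[OF var(1)]]) simp
next
  case (add d f g)
  show ?case by (rule polyfun.add[OF add.IH(1)[OF add.prems] add.IH(2)[OF add.prems]])
next
  case (mult d f e g)
  show ?case by (rule polyfun.mult[OF mult.IH(1)[OF mult.prems] mult.IH(2)[OF mult.prems]])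
qed

text \<open>The degree bound of the coefficient drops by one with every power of \<open>y\<close>.
  This lets inductions on the variables balance degree against multiplicity.\<close>

lemma polyfun_split:
  assumes "polyfun (insert y V) d f"
  shows "\<exists>g. (\<forall>j\<le>d. polyfun V (d - j) (g j)) \<and> (\<forall>x. f x = (\<Sum>j\<le>d. g j x * x y ^ j))"
  using assms
proof (induction)
  case (const d c)
  have "(\<Sum>j\<le>d. (if j = 0 then c else 0) * x y ^ j) = c" for x :: "nat \<Rightarrow> 'a"
    by (subst sum.remove[of _ 0]) auto
  then show ?case
    by (intro exI[of _ "\<lambda>j x. if j = 0 then c else 0"]) (auto intro: polyfun.const)
next
  case (var i d)
  show ?case
  proof (cases "i = y")
    case True
    have "(\<Sum>j\<le>Suc d. (if j = 1 then 1 else 0) * x y ^ j) = x y" for x :: "nat \<Rightarrow> 'a"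
      by (subst sum.remove[of _ 1]) auto
    with True show ?thesis
      by (intro exI[of _ "\<lambda>j x. if j = 1 then 1 else 0"]) (auto intro: polyfun.const)
  next
    case False
    with var have "i \<in> V" by auto
    moreover have "(\<Sum>j\<le>Suc d. (if j = 0 then x i else 0) * x y ^ j) = x i" for x :: "nat \<Rightarrow> 'a"
      by (subst sum.remove[of _ 0]) auto
    moreover have "polyfun V (Suc d - j) (\<lambda>x. if j = 0 then x i else 0)" for j
      using polyfun.var[OF \<open>i \<in> V\<close>, of d] polyfun.const[of V "Suc d - j" 0] by (cases j) auto
    ultimately show ?thesis
      by (intro exI[of _ "\<lambda>j x. if j = 0 then x i else 0"]) auto
  qed
next
  case (add d f g)
  then obtain F G where "\<forall>j\<le>d. polyfun V (d - j) (F j)" "\<forall>x. f x = (\<Sum>j\<le>d. F j x * x y ^ j)"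
     "\<forall>j\<le>d. polyfun V (d - j) (G j)" "\<forall>x. g x = (\<Sum>j\<le>d. G j x * x y ^ j)" by auto
  then show ?case
    by (intro exI[of _ "\<lambda>j x. F j x + G j x"])
      (auto intro!: polyfun.add simp: sum.distrib algebra_simps)
next
  case (mult d f e g)
  then obtain F G where F: "\<forall>j\<le>d. polyfun V (d - j) (F j)" "\<forall>x. f x = (\<Sum>j\<le>d. F j x * x y ^ j)"
     and G: "\<forall>j\<le>e. polyfun V (e - j) (G j)" "\<forall>x. g x = (\<Sum>j\<le>e. G j x * x y ^ j)" by auto
  define H where "H k x = (\<Sum>(i,j)\<in>{(i,j). i \<le> d \<and> j \<le> e \<and> i + j = k}. F i x * G j x)" for k x
  have fin: "finite {(i,j). i \<le> d \<and> j \<le> e \<and> i + j = k}" for k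
    by (rule finite_subset[of _ "{..d} \<times> {..e}"]) auto
  have "polyfun V (d + e - k) (H k)" for k
    unfolding H_def
  proof (rule polyfun_sum, clarify)
    fix i j assume "i \<le> d" "j \<le> e" "k = i + j"
    then have "polyfun V ((d - i) + (e - j)) (\<lambda>x. F i x * G j x)"
      using F G by (intro polyfun.mult) auto
    moreover have "(d - i) + (e - j) = d + e - (i + j)" using \<open>i \<le> d\<close> \<open>j \<le> e\<close> by simp
    ultimately show "polyfun V (d + e - (i + j)) (\<lambda>x. F i x * G j x)" by simp
  qed
  moreover have "f x * g x = (\<Sum>k\<le>d+e. H k x * x y ^ k)" for x
  proof -
    have "f x * g x = (\<Sum>(i,j)\<in>{..d}\<times>{..e}. F i x * G j x * x y ^ (i + j))"
      by (simp add: F(2) G(2) sum_product sum.cartesian_product power_add mult_ac)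
    also have "\<dots> = (\<Sum>k\<le>d+e. \<Sum>(i,j)\<in>{p \<in> {..d}\<times>{..e}. (case p of (i,j) \<Rightarrow> i + j) = k}. F i x * G j x * x y ^ (i + j))"
      by (intro sum.group[symmetric]) auto
    also have "\<dots> = (\<Sum>k\<le>d+e. H k x * x y ^ k)"
      unfolding H_def sum_distrib_right
      by (intro sum.cong) auto
    finally show ?thesis .
  qed
  ultimately show ?case by blast
qed

lemma polyfun_line_exists:
  assumes "polyfun V d f"
  shows "\<exists>L. degree L \<le> d \<and> (\<forall>t. poly L t = f (\<lambda>i. a i + t * w i))"
  using assms
proof (induction)
  case (const d c)
  then show ?case by (intro exI[of _ "[:c:]"]) auto
next
  case (var i d)
  then show ?case by (intro exI[of _ "[:a i, w i:]"]) auto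
next
  case (add d f g)
  then obtain L M where "degree L \<le> d" "\<forall>t. poly L t = f (\<lambda>i. a i + t * w i)"
    "degree M \<le> d" "\<forall>t. poly M t = g (\<lambda>i. a i + t * w i)" by blast
  then show ?case by (intro exI[of _ "L + M"]) (auto intro: degree_add_le)
next
  case (mult d f e g)
  then obtain L M where "degree L \<le> d" "\<forall>t. poly L t = f (\<lambda>i. a i + t * w i)"
    "degree M \<le> e" "\<forall>t. poly M t = g (\<lambda>i. a i + t * w i)" by blast
  then show ?case
    by (intro exI[of _ "L * M"]) (auto intro: order_trans[OF degree_mult_le] add_mono)
qed

section \<open>Restriction to lines and orders of vanishing\<close>

lemma poly_eqI_infinite:
  fixes p q :: "'r::idom poly"
  assumes "infinite (UNIV :: 'r set)" "\<And>t. poly p t = poly q t"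
  shows "p = q"
proof (rule ccontr)
  assume "p \<noteq> q"
  then have "finite {t. poly (p - q) t = 0}" by (intro poly_roots_finite) auto
  with assms show False by simp
qed

text \<open>The choice is harmless over an infinite domain: univariate polynomials with equal values
  coincide, so \<open>line_poly_eqI\<close> identifies the chosen one.\<close>

definition line_poly :: "((nat \<Rightarrow> 'r::idom) \<Rightarrow> 'r) \<Rightarrow> (nat \<Rightarrow> 'r) \<Rightarrow> (nat \<Rightarrow> 'r) \<Rightarrow> 'r poly" where
  "line_poly f a w = (SOME L. \<forall>t. poly L t = f (\<lambda>i. a i + t * w i))"

lemma poly_line_poly:
  assumes "polyfun V d f"
  shows "poly (line_poly f a w) t = f (\<lambda>i. a i + t * w i)"
proof -
  have "\<exists>L. \<forall>t. poly L t = f (\<lambda>i. a i + t * w i)"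
    using polyfun_line_exists[OF assms] by blast
  from someI_ex[OF this] show ?thesis unfolding line_poly_def by blast
qed

lemma line_poly_eqI:
  fixes L :: "'r::idom poly"
  assumes "infinite (UNIV :: 'r set)" "\<And>t. poly L t = f (\<lambda>i. a i + t * w i)"
  shows "line_poly f a w = L"
proof (rule poly_eqI_infinite[OF assms(1)])
  have "\<forall>t. poly (line_poly f a w) t = f (\<lambda>i. a i + t * w i)"
    unfolding line_poly_def by (rule someI[of _ L]) (use assms(2) in blast)
  then show "poly (line_poly f a w) t = poly L t" for t using assms(2) by simp
qed

lemma order_0_le: "coeff p i \<noteq> 0 \<Longrightarrow> order 0 p \<le> i"
  by (metis coeff_0 leI monom_1_dvd_iff monom_1_dvd_iff' order_refl)

lemma order_0_ge: "p \<noteq> 0 \<Longrightarrow> (\<And>i. i < n \<Longrightarrow> coeff p i = 0) \<Longrightarrow> n \<le> order 0 p"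
  by (metis monom_1_dvd_iff monom_1_dvd_iff')

lemma sum_order_le_degree_on:
  assumes "p \<noteq> 0" "finite A"
  shows "(\<Sum>x\<in>A. order x p) \<le> degree p"
proof -
  have "(\<Sum>x\<in>A. order x p) = (\<Sum>x\<in>A \<inter> {x. poly p x = 0}. order x p)"
    using assms by (intro sum.mono_neutral_right) (auto simp: order_root)
  also have "\<dots> \<le> (\<Sum>x | poly p x = 0. order x p)"
    using assms by (intro sum_mono2 poly_roots_finite) auto
  also have "\<dots> \<le> degree p" using assms by (intro sum_order_le_degree)
  finally show ?thesis .
qed

lemma pcompose_power: "pcompose (p ^ n) q = pcompose p q ^ n" for p q :: "'r::comm_ring_1 poly"
  by (induction n) (simp_all add: pcompose_mult pcompose_1)

text \<open>Splitting off the full power of the root and shifting it to 0 leaves a cofactor whose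
  constant term is its nonzero value at \<open>b\<close>.\<close>

lemma coeff_shift_order:
  fixes p :: "'r::idom poly"
  assumes "p \<noteq> 0"
  shows "coeff (pcompose p [:b, 1:]) (order b p) \<noteq> 0"
proof -
  obtain q where q: "p = [:- b, 1:] ^ order b p * q" "\<not> [:- b, 1:] dvd q"
    using order_decomp[OF assms] by blast
  have "pcompose p [:b,1:] = monom 1 (order b p) * pcompose q [:b,1:]"
    by (subst q(1)) (simp add: pcompose_mult pcompose_power pcompose_pCons monom_altdef)
  then have "coeff (pcompose p [:b, 1:]) (order b p) = coeff (pcompose q [:b,1:]) 0"
    by (simp add: coeff_monom_mult)
  also have "\<dots> = poly q b" by simp
  also have "\<dots> \<noteq> 0" using q(2) by (simp add: poly_eq_0_iff_dvd)
  finally show ?thesis .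
qed

text \<open>The coefficient of \<open>w ^ e\<close>, with \<open>e\<close> the order of the initial form \<open>R\<close> at \<open>b\<close>,
  comes from the lowest-order parts of the \<open>L j\<close> alone; hence it does not cancel.\<close>

lemma generic_direction:
  fixes L :: "nat \<Rightarrow> 'r::idom poly"
  assumes "L t \<noteq> 0"
  obtains R \<mu> where "R \<noteq> 0" "degree R \<le> t" "\<mu> \<le> order 0 (L t)"
    "\<And>b. finite {w. \<not> ((\<Sum>j\<le>t. L j * [:b, w:] ^ j) \<noteq> 0 \<and>
        order 0 (\<Sum>j\<le>t. L j * [:b, w:] ^ j) \<le> \<mu> + order b R)}"
proof -
  define \<mu> where "\<mu> = (LEAST i. \<exists>j\<le>t. coeff (L j) i \<noteq> 0)"
  define R where "R = (\<Sum>j\<le>t. monom (coeff (L j) \<mu>) j)"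
  have ex: "\<exists>j\<le>t. coeff (L j) (order 0 (L t)) \<noteq> 0"
    using coeff_shift_order[OF assms, of 0] by (auto simp: coeff_pcompose_linear)
  then have "\<exists>j\<le>t. coeff (L j) \<mu> \<noteq> 0" unfolding \<mu>_def by (rule LeastI)
  then obtain j0 where j0: "j0 \<le> t" "coeff (L j0) \<mu> \<noteq> 0" by blast
  have low: "coeff (L j) i = 0" if "j \<le> t" "i < \<mu>" for i j
    using not_less_Least[of i "\<lambda>i. \<exists>j\<le>t. coeff (L j) i \<noteq> 0"] that unfolding \<mu>_def by blast
  have cR: "coeff R j = (if j \<le> t then coeff (L j) \<mu> else 0)" for j
    unfolding R_def by (simp add: coeff_sum)
  have "R \<noteq> 0" using j0 cR by (metis coeff_0)
  moreover have "degree R \<le> t" by (intro degree_le) (simp add: cR)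
  moreover have "\<mu> \<le> order 0 (L t)" unfolding \<mu>_def by (rule Least_le) (rule ex)
  moreover have "finite {w. \<not> ((\<Sum>j\<le>t. L j * [:b, w:] ^ j) \<noteq> 0 \<and>
        order 0 (\<Sum>j\<le>t. L j * [:b, w:] ^ j) \<le> \<mu> + order b R)}" for b
  proof -
    define e where "e = order b R"
    \<comment> \<open>\<open>W\<close> is the coefficient of degree \<open>\<mu> + e\<close> after
      the substitution, read as a polynomial in the direction \<open>w\<close>. Only its roots can
      be bad directions.\<close>
    define W where "W = (\<Sum>k\<le>e. monom (\<Sum>j\<le>t. coeff (L j) (\<mu> + e - k) * coeff ([:b, 1:] ^ j) k) k)"
    have cW: "coeff W e = (\<Sum>j\<le>t. coeff (L j) \<mu> * coeff ([:b, 1:] ^ j) e)"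
      unfolding W_def by (simp add: coeff_sum)
    have "pcompose R [:b, 1:] = (\<Sum>j\<le>t. smult (coeff (L j) \<mu>) ([:b, 1:] ^ j))"
      unfolding R_def by (simp add: pcompose_sum monom_altdef pcompose_smult pcompose_power pcompose_pCons)
    then have "coeff W e = coeff (pcompose R [:b, 1:]) e"
      unfolding cW by (simp add: coeff_sum)
    with \<open>R \<noteq> 0\<close> have "coeff W e \<noteq> 0" unfolding e_def by (simp add: coeff_shift_order)
    then have "W \<noteq> 0" by auto
    have cH: "coeff (\<Sum>j\<le>t. L j * [:b, w:] ^ j) (\<mu> + e) = poly W w" for w
    proof -
      have cp: "coeff ([:b, w:] ^ j) k = coeff ([:b, 1:] ^ j) k * w ^ k" for j k
      proof (cases "k \<le> j")
        case False
        have "degree ([:b, w:] ^ j) < k" for w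
          using degree_power_le[of "[:b, w:]" j] False by (auto split: if_splits)
        then show ?thesis by (simp add: coeff_eq_0)
      qed (simp add: coeff_linear_poly_power mult_ac)
      have "coeff (\<Sum>j\<le>t. L j * [:b, w:] ^ j) (\<mu> + e)
          = (\<Sum>j\<le>t. \<Sum>k\<le>\<mu>+e. coeff ([:b, w:] ^ j) k * coeff (L j) (\<mu> + e - k))"
        by (simp add: coeff_sum mult.commute[of "L _"] coeff_mult)
      also have "\<dots> = (\<Sum>j\<le>t. \<Sum>k\<le>e. coeff ([:b, w:] ^ j) k * coeff (L j) (\<mu> + e - k))"
        by (intro sum.cong sum.mono_neutral_right) (auto intro!: low)
      also have "\<dots> = poly W w"
        unfolding W_def by (subst sum.swap) (simp add: poly_sum poly_monom cp sum_distrib_left sum_distrib_right mult_ac)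
      finally show ?thesis .
    qed
    have "{w. \<not> ((\<Sum>j\<le>t. L j * [:b, w:] ^ j) \<noteq> 0 \<and>
        order 0 (\<Sum>j\<le>t. L j * [:b, w:] ^ j) \<le> \<mu> + order b R)} \<subseteq> {w. poly W w = 0}"
    proof
      fix w assume w: "w \<in> {w. \<not> ((\<Sum>j\<le>t. L j * [:b, w:] ^ j) \<noteq> 0 \<and>
        order 0 (\<Sum>j\<le>t. L j * [:b, w:] ^ j) \<le> \<mu> + order b R)}"
      show "w \<in> {w. poly W w = 0}"
      proof (rule ccontr)
        assume "w \<notin> {w. poly W w = 0}"
        then have "coeff (\<Sum>j\<le>t. L j * [:b, w:] ^ j) (\<mu> + e) \<noteq> 0" using cH by simp
        moreover from this have "(\<Sum>j\<le>t. L j * [:b, w:] ^ j) \<noteq> 0" by auto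
        ultimately show False using w order_0_le[of "\<Sum>j\<le>t. L j * [:b, w:] ^ j" "\<mu> + e"]
          unfolding e_def by blast
      qed
    qed
    then show ?thesis using poly_roots_finite[OF \<open>W \<noteq> 0\<close>] by (rule finite_subset)
  qed
  ultimately show thesis using that by blast
qed

text \<open>The multiplicity of a zero is measured along lines in a single direction \<open>w\<close>; the direction
  is chosen coordinate by coordinate, avoiding finitely many values each time.\<close>

lemma schwartz_zippel_multiplicity:
  fixes f :: "(nat \<Rightarrow> 'r::idom) \<Rightarrow> 'r"
  assumes inf: "infinite (UNIV :: 'r set)"
    and "finite V" "finite A" "polyfun V d f" "f x0 \<noteq> 0"
  shows "\<exists>w. (\<forall>a\<in>PiE V (\<lambda>_. A). line_poly f a w \<noteq> 0) \<and>
    (\<Sum>a\<in>PiE V (\<lambda>_. A). order 0 (line_poly f a w)) * card A \<le> d * card A ^ card V"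
  using assms(2-5)
proof (induction V arbitrary: d f x0 rule: finite_induct)
  case empty
  have "line_poly f a w = [:f x0:]" for a w
  proof (rule line_poly_eqI[OF inf])
    show "poly [:f x0:] t = f (\<lambda>i. a i + t * w i)" for t
      using polyfun_cong[OF empty(2), of x0 "\<lambda>i. a i + t * w i"] by simp
  qed
  with empty show ?case by (auto simp: order_0I)
next
  case (insert y V)
  obtain g where g: "\<And>j. j \<le> d \<Longrightarrow> polyfun V (d - j) (g j)"
      "\<And>x. f x = (\<Sum>j\<le>d. g j x * x y ^ j)"
    using polyfun_split[OF insert.prems(2)] by blast
  have fx0: "(\<Sum>j\<le>d. g j x0 * x0 y ^ j) \<noteq> 0" using insert.prems(3) g(2) by metis
  have "\<exists>j\<in>{..d}. g j x0 * x0 y ^ j \<noteq> 0"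
  proof (rule ccontr)
    assume "\<not> ?thesis"
    then have "(\<Sum>j\<le>d. g j x0 * x0 y ^ j) = 0" by (intro sum.neutral) auto
    with fx0 show False by blast
  qed
  then have ex: "\<exists>j. j \<le> d \<and> (\<exists>x. g j x \<noteq> 0)" by auto
  \<comment> \<open>The degree of \<open>f\<close> in \<open>y\<close>. The induction hypothesis,
    with bound \<open>d - t\<close>, goes to the leading coefficient \<open>g t\<close>; the initial
    forms \<open>R a\<close>, of degree at most \<open>t\<close>, pay for the new
    coordinate.\<close>
  define t where "t = (GREATEST j. j \<le> d \<and> (\<exists>x. g j x \<noteq> 0))"
  have t: "t \<le> d \<and> (\<exists>x. g t x \<noteq> 0)"
    unfolding t_def by (rule GreatestI_ex_nat[of _ d]) (use ex in auto)
  then obtain x1 where x1: "g t x1 \<noteq> 0" by blast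
  have above: "g j x = 0" if "j \<le> d" "t < j" for j x
  proof (rule ccontr)
    assume "g j x \<noteq> 0"
    then have "j \<le> t" unfolding t_def by (intro Greatest_le_nat[of _ _ d]) (use that in auto)
    with that show False by simp
  qed
  obtain w where w: "\<And>a. a \<in> PiE V (\<lambda>_. A) \<Longrightarrow> line_poly (g t) a w \<noteq> 0"
    "(\<Sum>a\<in>PiE V (\<lambda>_. A). order 0 (line_poly (g t) a w)) * card A \<le> (d - t) * card A ^ card V"
    using insert.IH[OF insert.prems(1) g(1)[of t] x1] t by blast
  define L where "L a j = line_poly (g j) a w" for a j
  define H where "H a b u = (\<Sum>j\<le>t. L a j * [:b, u:] ^ j)" for a b u
  have EX: "\<forall>a\<in>PiE V (\<lambda>_. A). \<exists>p. fst p \<noteq> 0 \<and> degree (fst p) \<le> t \<and> snd p \<le> order 0 (L a t) \<and>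
      (\<forall>b. finite {u. \<not> (H a b u \<noteq> 0 \<and> order 0 (H a b u) \<le> snd p + order b (fst p))})"
  proof
    fix a assume a: "a \<in> PiE V (\<lambda>_. A)"
    have "L a t \<noteq> 0" unfolding L_def by (rule w(1)[OF a])
    then obtain R \<mu> where "R \<noteq> 0" "degree R \<le> t" "\<mu> \<le> order 0 (L a t)"
      "\<And>b. finite {u. \<not> ((\<Sum>j\<le>t. L a j * [:b, u:] ^ j) \<noteq> 0 \<and>
        order 0 (\<Sum>j\<le>t. L a j * [:b, u:] ^ j) \<le> \<mu> + order b R)}"
      by (rule generic_direction[of "L a" t]) (rule that)
    then show "\<exists>p. fst p \<noteq> 0 \<and> degree (fst p) \<le> t \<and> snd p \<le> order 0 (L a t) \<and>
      (\<forall>b. finite {u. \<not> (H a b u \<noteq> 0 \<and> order 0 (H a b u) \<le> snd p + order b (fst p))})"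
      unfolding H_def by (intro exI[of _ "(R, \<mu>)"]) simp
  qed
  from bchoice[OF EX] obtain F where F: "\<forall>a\<in>PiE V (\<lambda>_. A). fst (F a) \<noteq> 0 \<and> degree (fst (F a)) \<le> t \<and>
      snd (F a) \<le> order 0 (L a t) \<and>
      (\<forall>b. finite {u. \<not> (H a b u \<noteq> 0 \<and> order 0 (H a b u) \<le> snd (F a) + order b (fst (F a)))})" ..
  define R \<mu> where "R a = fst (F a)" and "\<mu> a = snd (F a)" for a
  have R: "R a \<noteq> 0 \<and> degree (R a) \<le> t \<and> \<mu> a \<le> order 0 (L a t) \<and>
      (\<forall>b. finite {u. \<not> (H a b u \<noteq> 0 \<and> order 0 (H a b u) \<le> \<mu> a + order b (R a))})"
    if "a \<in> PiE V (\<lambda>_. A)" for a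
    using F that unfolding R_def \<mu>_def by blast
  have finV: "finite (PiE V (\<lambda>_. A))" using insert by (intro finite_PiE) auto
  \<comment> \<open>There are finitely many grid points with finitely many bad values each, so in an
    infinite ring one \<open>u\<close> serves the whole grid.\<close>
  define Bad where "Bad = (\<Union>a\<in>PiE V (\<lambda>_. A). \<Union>b\<in>A. {u. \<not> (H a b u \<noteq> 0 \<and> order 0 (H a b u) \<le> \<mu> a + order b (R a))})"
  have "finite Bad" unfolding Bad_def using finV insert.prems(1) R by (intro finite_UN_I) blast+
  then obtain u where u: "u \<notin> Bad" using inf ex_new_if_finite by blast
  have Hu: "H a b u \<noteq> 0" "order 0 (H a b u) \<le> \<mu> a + order b (R a)"
    if "a \<in> PiE V (\<lambda>_. A)" "b \<in> A" for a b
    using u that unfolding Bad_def by blast+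
  have line: "line_poly f (a(y := b)) (w(y := u)) = H a b u" for a b
  proof (rule line_poly_eqI[OF inf])
    fix s
    let ?x = "\<lambda>i. (a(y := b)) i + s * (w(y := u)) i"
    have "f ?x = (\<Sum>j\<le>d. g j ?x * ?x y ^ j)" by (rule g(2))
    also have "\<dots> = (\<Sum>j\<le>t. g j ?x * ?x y ^ j)"
      using t above by (intro sum.mono_neutral_right) auto
    also have "\<dots> = (\<Sum>j\<le>t. g j (\<lambda>i. a i + s * w i) * (b + s * u) ^ j)"
    proof (intro sum.cong refl)
      fix j assume "j \<in> {..t}"
      then have "j \<le> d" using t by simp
      have "g j ?x = g j (\<lambda>i. a i + s * w i)"
        by (rule polyfun_cong[OF g(1)[OF \<open>j \<le> d\<close>]]) (use insert.hyps in auto)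
      then show "g j ?x * ?x y ^ j = g j (\<lambda>i. a i + s * w i) * (b + s * u) ^ j" by simp
    qed
    also have "\<dots> = poly (H a b u) s"
      unfolding H_def L_def poly_sum
    proof (intro sum.cong refl)
      fix j assume "j \<in> {..t}"
      then have "j \<le> d" using t by simp
      show "g j (\<lambda>i. a i + s * w i) * (b + s * u) ^ j = poly (line_poly (g j) a w * [:b, u:] ^ j) s"
        using poly_line_poly[OF g(1)[OF \<open>j \<le> d\<close>], of a w s] by simp
    qed
    finally show "poly (H a b u) s = f ?x" by simp
  qed
  have inj: "inj_on (\<lambda>(b, a). a(y := b)) (A \<times> PiE V (\<lambda>_. A))"
    using inj_combinator[OF insert.hyps(2), of "\<lambda>_. A"] .
  have PiE: "PiE (insert y V) (\<lambda>_. A) = (\<lambda>(b, a). a(y := b)) ` (A \<times> PiE V (\<lambda>_. A))"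
    by (simp add: PiE_insert_eq)
  have "(\<Sum>c\<in>PiE (insert y V) (\<lambda>_. A). order 0 (line_poly f c (w(y := u))))
      = (\<Sum>(b,a)\<in>A \<times> PiE V (\<lambda>_. A). order 0 (H a b u))"
    unfolding PiE by (subst sum.reindex[OF inj]) (simp add: case_prod_unfold line)
  also have "\<dots> = (\<Sum>a\<in>PiE V (\<lambda>_. A). \<Sum>b\<in>A. order 0 (H a b u))"
    by (subst sum.swap) (simp add: sum.cartesian_product)
  also have "\<dots> \<le> (\<Sum>a\<in>PiE V (\<lambda>_. A). \<Sum>b\<in>A. order 0 (L a t) + order b (R a))"
    using R Hu(2) by (intro sum_mono) (meson add_right_mono order_trans)
  also have "\<dots> = (\<Sum>a\<in>PiE V (\<lambda>_. A). card A * order 0 (L a t) + (\<Sum>b\<in>A. order b (R a)))"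
    by (simp add: sum.distrib)
  also have "\<dots> \<le> (\<Sum>a\<in>PiE V (\<lambda>_. A). card A * order 0 (L a t) + t)"
    by (intro sum_mono add_left_mono order_trans[OF sum_order_le_degree_on])
      (use R insert.prems(1) in auto)
  also have "\<dots> = (\<Sum>a\<in>PiE V (\<lambda>_. A). order 0 (L a t)) * card A + t * card A ^ card V"
    using insert.hyps by (simp add: sum.distrib sum_distrib_left card_PiE mult_ac)
  also have "\<dots> \<le> (d - t) * card A ^ card V + t * card A ^ card V"
    using w(2) unfolding L_def by (intro add_right_mono)
  also have "\<dots> = d * card A ^ card V"
    using t by (simp flip: distrib_right)
  finally have "(\<Sum>c\<in>PiE (insert y V) (\<lambda>_. A). order 0 (line_poly f c (w(y := u)))) * card A
      \<le> d * card A ^ card V * card A" by (rule mult_right_mono) simp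
  then have "(\<Sum>c\<in>PiE (insert y V) (\<lambda>_. A). order 0 (line_poly f c (w(y := u)))) * card A
      \<le> d * card A ^ card (insert y V)" using insert.hyps by (simp add: mult_ac)
  moreover have "line_poly f c (w(y := u)) \<noteq> 0" if "c \<in> PiE (insert y V) (\<lambda>_. A)" for c
    using that unfolding PiE by (auto simp: line Hu)
  ultimately show ?case by blast
qed

section \<open>Planes in many directions\<close>

definition exponents :: "nat \<Rightarrow> nat \<Rightarrow> (nat \<Rightarrow> nat) set" where
  "exponents m d = {\<alpha> \<in> {..<m} \<rightarrow>\<^sub>E UNIV. (\<Sum>i<m. \<alpha> i) \<le> d}"

lemma card_exponents: "card (exponents m d) = (d + m) choose m"
proof -
  let ?f = "\<lambda>\<alpha>. map \<alpha> [0..<m] @ [d - (\<Sum>i<m. \<alpha> i)]"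
  let ?g = "\<lambda>l. \<lambda>i\<in>{..<m}. l ! i :: nat"
  have "bij_betw ?f (exponents m d) {l. length l = Suc m \<and> sum_list l = d}"
  proof (rule bij_betwI[of _ _ _ ?g])
    show "?f \<in> exponents m d \<rightarrow> {l. length l = Suc m \<and> sum_list l = d}"
      by (auto simp: exponents_def sum_list_sum_nth lessThan_atLeast0 nth_append)
    show "?g \<in> {l. length l = Suc m \<and> sum_list l = d} \<rightarrow> exponents m d"
      by (auto simp: exponents_def sum_list_sum_nth lessThan_atLeast0)
    show "?g (?f \<alpha>) = \<alpha>" if "\<alpha> \<in> exponents m d" for \<alpha>
      using that by (auto simp: exponents_def nth_append PiE_def extensional_def)
    show "?f (?g l) = l" if "l \<in> {l. length l = Suc m \<and> sum_list l = d}" for l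
    proof (rule nth_equalityI)
      fix i assume "i < length (?f (?g l))"
      with that show "?f (?g l) ! i = l ! i"
        by (auto simp: nth_append sum_list_sum_nth lessThan_atLeast0 less_Suc_eq)
    qed (use that in auto)
  qed
  then have "card (exponents m d) = (d + Suc m - 1) choose d"
    by (simp add: bij_betw_same_card card_length_sum_list)
  also have "\<dots> = (d + m) choose m" using binomial_symmetric[of m "d + m"] by simp
  finally show ?thesis .
qed

lemma finite_exponents: "finite (exponents m d)"
  by (rule card_ge_0_finite) (simp add: card_exponents)

text \<open>The binomial theorem in several variables. Binomials vanish outside the box below
  \<alpha>, so \<beta> may range over a set independent of \<alpha>; the Taylor expansion then only
  has to swap two sums.\<close>

lemma prod_add_power:
  fixes x y :: "nat \<Rightarrow> 'r::comm_semiring_1"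
  assumes "\<alpha> \<in> exponents m d"
  shows "(\<Prod>i<m. (x i + y i) ^ \<alpha> i) =
    (\<Sum>\<beta>\<in>exponents m d. (\<Prod>i<m. of_nat (\<alpha> i choose \<beta> i) * x i ^ (\<alpha> i - \<beta> i)) * (\<Prod>i<m. y i ^ \<beta> i))"
proof -
  have "(\<Prod>i<m. (x i + y i) ^ \<alpha> i) = (\<Prod>i<m. \<Sum>j\<le>\<alpha> i. of_nat (\<alpha> i choose j) * x i ^ (\<alpha> i - j) * y i ^ j)"
    by (intro prod.cong refl) (subst add.commute, simp add: binomial_ring mult_ac)
  also have "\<dots> = (\<Sum>\<beta>\<in>PiE {..<m} (\<lambda>i. {..\<alpha> i}). \<Prod>i<m. of_nat (\<alpha> i choose \<beta> i) * x i ^ (\<alpha> i - \<beta> i) * y i ^ \<beta> i)"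
    by (rule prod_sum_PiE) auto
  also have "\<dots> = (\<Sum>\<beta>\<in>exponents m d. \<Prod>i<m. of_nat (\<alpha> i choose \<beta> i) * x i ^ (\<alpha> i - \<beta> i) * y i ^ \<beta> i)"
  proof (rule sum.mono_neutral_left[OF finite_exponents])
    show "PiE {..<m} (\<lambda>i. {..\<alpha> i}) \<subseteq> exponents m d"
    proof
      fix \<beta> assume b: "\<beta> \<in> PiE {..<m} (\<lambda>i. {..\<alpha> i})"
      then have "(\<Sum>i<m. \<beta> i) \<le> (\<Sum>i<m. \<alpha> i)" by (intro sum_mono) (auto dest: PiE_mem)
      with assms b show "\<beta> \<in> exponents m d" unfolding exponents_def by (auto simp: PiE_def)
    qed
    show "\<forall>\<beta>\<in>exponents m d - PiE {..<m} (\<lambda>i. {..\<alpha> i}).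
      (\<Prod>i<m. of_nat (\<alpha> i choose \<beta> i) * x i ^ (\<alpha> i - \<beta> i) * y i ^ \<beta> i) = 0"
    proof
      fix \<beta> assume "\<beta> \<in> exponents m d - PiE {..<m} (\<lambda>i. {..\<alpha> i})"
      then obtain i where "i < m" "\<alpha> i < \<beta> i"
        unfolding exponents_def by (auto simp: PiE_def Pi_def not_le)
      then show "(\<Prod>i<m. of_nat (\<alpha> i choose \<beta> i) * x i ^ (\<alpha> i - \<beta> i) * y i ^ \<beta> i) = 0"
        by (intro prod_zero) (auto intro!: bexI[of _ i] simp: binomial_eq_0)
    qed
  qed
  finally show ?thesis by (simp add: prod.distrib)
qed

text \<open>The Hasse derivative of index \<beta> at \<open>e\<close> of the polynomial with
  coefficients \<open>c\<close>. Binomials replace iterated derivatives, which lose information in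
  positive characteristic.\<close>

definition taylor_coeff :: "nat \<Rightarrow> nat \<Rightarrow> ((nat \<Rightarrow> nat) \<Rightarrow> 'a) \<Rightarrow> (nat \<Rightarrow> 'a) \<Rightarrow> (nat \<Rightarrow> nat) \<Rightarrow> 'a::comm_ring_1" where
  "taylor_coeff m d c e \<beta> =
    (\<Sum>\<alpha>\<in>exponents m d. c \<alpha> * (\<Prod>i<m. of_nat (\<alpha> i choose \<beta> i) * e i ^ (\<alpha> i - \<beta> i)))"

text \<open>Pigeonhole in place of linear algebra: there are more coefficient vectors than vectors
  of Taylor coefficients, so two of them agree, and \<open>taylor_coeff\<close> is linear in
  \<open>c\<close>. The orders below \<open>l\<close> are those indexed by
  \<open>exponents m (l - 1)\<close>.\<close>

lemma vanishing_polynomial_exists: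
  fixes E :: "(nat \<Rightarrow> 'a::{field,finite}) set"
  assumes "finite E" "0 < l" "card E * card (exponents m (l - 1)) < card (exponents m d)"
  obtains c where "\<exists>\<alpha>\<in>exponents m d. c \<alpha> \<noteq> 0"
    "\<And>e \<beta>. e \<in> E \<Longrightarrow> \<beta> \<in> exponents m d \<Longrightarrow> (\<Sum>i<m. \<beta> i) < l \<Longrightarrow> taylor_coeff m d c e \<beta> = 0"
proof -
  define X where "X = PiE (exponents m d) (\<lambda>_. UNIV :: 'a set)"
  define Y where "Y = PiE (E \<times> exponents m (l - 1)) (\<lambda>_. UNIV :: 'a set)"
  define F where "F c = (\<lambda>(e, \<beta>)\<in>E \<times> exponents m (l - 1). taylor_coeff m d c e \<beta>)" for c :: "(nat \<Rightarrow> nat) \<Rightarrow> 'a"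
  have "card {0::'a, 1} \<le> CARD('a)" by (intro card_mono) auto
  then have q: "1 < CARD('a)" by simp
  have "card Y < card X"
  proof -
    have "card X = CARD('a) ^ card (exponents m d)"
      unfolding X_def by (simp add: card_PiE finite_exponents)
    moreover have "card Y = CARD('a) ^ (card E * card (exponents m (l - 1)))"
      unfolding Y_def using assms(1) by (simp add: card_PiE finite_exponents card_cartesian_product)
    ultimately show ?thesis using power_strict_increasing[OF assms(3) q] by simp
  qed
  moreover have "F ` X \<subseteq> Y" unfolding F_def Y_def by (intro image_subsetI) (simp only: restrict_PiE_iff UNIV_I simp_thms ball_triv)
  moreover have "finite Y" unfolding Y_def
    by (rule finite_PiE) (simp_all add: assms(1) finite_exponents)
  ultimately have "\<not> inj_on F X" using card_inj_on_le[of F X Y] by linarith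
  then obtain c1 c2 where c: "c1 \<in> X" "c2 \<in> X" "F c1 = F c2" "c1 \<noteq> c2" unfolding inj_on_def by blast
  have "\<exists>\<alpha>\<in>exponents m d. c1 \<alpha> \<noteq> c2 \<alpha>"
    using PiE_ext[OF c(1)[unfolded X_def] c(2)[unfolded X_def]] c(4) by blast
  then have "\<exists>\<alpha>\<in>exponents m d. (\<lambda>\<alpha>. c1 \<alpha> - c2 \<alpha>) \<alpha> \<noteq> 0" by simp
  then show thesis
  proof (rule that)
    show "taylor_coeff m d (\<lambda>\<alpha>. c1 \<alpha> - c2 \<alpha>) e \<beta> = 0"
    if "e \<in> E" "\<beta> \<in> exponents m d" "(\<Sum>i<m. \<beta> i) < l" for e \<beta>
    proof -
    have "(e, \<beta>) \<in> E \<times> exponents m (l - 1)" using that unfolding exponents_def by auto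
    then have "taylor_coeff m d c1 e \<beta> = taylor_coeff m d c2 e \<beta>"
      using fun_cong[OF c(3), of "(e, \<beta>)"] unfolding F_def by simp
    then show ?thesis unfolding taylor_coeff_def by (simp add: left_diff_distrib sum_subtractf)
    qed
  qed
qed

lemma infinite_UNIV_poly: "infinite (UNIV :: 'a::zero_neq_one poly set)"
proof
  assume "finite (UNIV :: 'a poly set)"
  moreover have "inj (\<lambda>n. monom (1::'a) n)"
    by (intro injI) (metis degree_monom_eq zero_neq_one)
  ultimately have "finite (UNIV :: nat set)"
    by (rule inj_on_finite[where A = "UNIV :: nat set", rotated 2]) auto
  then show False by simp
qed

lemma prod_const_poly: "(\<Prod>i\<in>I. [:g i:]) = [:\<Prod>i\<in>I. g i:]"
  for g :: "'b \<Rightarrow> 'a::comm_semiring_1"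
  by (induction I rule: infinite_finite_induct) (auto simp: one_pCons mult.commute)

lemma sum_const_poly: "(\<Sum>i\<in>I. [:g i:]) = [:\<Sum>i\<in>I. g i:]"
  by (induction I rule: infinite_finite_induct) auto

text \<open>The coefficients stay in the finite field, where the pigeonhole argument applies, while
  points have coordinates in its polynomial ring, where generic directions exist.\<close>

definition eval_over :: "nat \<Rightarrow> (nat \<Rightarrow> nat) set \<Rightarrow> ((nat \<Rightarrow> nat) \<Rightarrow> 'a::comm_ring_1) \<Rightarrow> (nat \<Rightarrow> 'a poly) \<Rightarrow> 'a poly" where
  "eval_over m M c x = (\<Sum>\<alpha>\<in>M. [:c \<alpha>:] * (\<Prod>i<m. x i ^ \<alpha> i))"

lemma polyfun_eval_over:
  assumes "\<And>\<alpha>. \<alpha> \<in> M \<Longrightarrow> (\<Sum>i<m. \<alpha> i) \<le> d"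
  shows "polyfun {..<m} d (eval_over m M c)"
proof -
  have "polyfun {..<m} d (\<lambda>x. [:c \<alpha>:] * (\<Prod>i<m. x i ^ \<alpha> i))" if "\<alpha> \<in> M" for \<alpha>
  proof (rule polyfun_cmult, rule polyfun_mono[OF _ assms[OF that]], rule polyfun_prod)
    fix i assume "i \<in> {..<m}"
    show "polyfun {..<m} (\<alpha> i) (\<lambda>x. x i ^ \<alpha> i)"
      using polyfun_power[OF polyfun.var[OF \<open>i \<in> {..<m}\<close>, of 0], of "\<alpha> i"] by simp
  qed
  from polyfun_sum[of M "{..<m}" d "\<lambda>\<alpha> x. [:c \<alpha>:] * (\<Prod>i<m. x i ^ \<alpha> i)", OF this]
  show ?thesis unfolding eval_over_def .
qed

text \<open>The Taylor expansion at a point over the field, grouped by total order. The direction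
  may have polynomial coordinates, so vanishing Hasse derivatives give multiplicity along these
  directions as well.\<close>

lemma eval_over_line:
  fixes c :: "(nat \<Rightarrow> nat) \<Rightarrow> 'a::idom"
  shows "line_poly (eval_over m (exponents m d) c) (\<lambda>i. [:e i:]) w =
    (\<Sum>\<beta>\<in>exponents m d. monom ([:taylor_coeff m d c e \<beta>:] * (\<Prod>i<m. w i ^ \<beta> i)) (\<Sum>i<m. \<beta> i))"
proof (rule line_poly_eqI[OF infinite_UNIV_poly])
  fix t
  have *: "of_nat n * [:z:] ^ k = [:of_nat n * z ^ k:]" for n k and z :: 'a
    by (simp add: of_nat_poly poly_const_pow)
  have "eval_over m (exponents m d) c (\<lambda>i. [:e i:] + t * w i)
    = (\<Sum>\<alpha>\<in>exponents m d. \<Sum>\<beta>\<in>exponents m d. [:c \<alpha> * (\<Prod>i<m. of_nat (\<alpha> i choose \<beta> i) * e i ^ (\<alpha> i - \<beta> i)):] * (\<Prod>i<m. (t * w i) ^ \<beta> i))"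
    unfolding eval_over_def
  proof (intro sum.cong refl)
    fix \<alpha> assume "\<alpha> \<in> exponents m d"
    from prod_add_power[OF this, of "\<lambda>i. [:e i:]" "\<lambda>i. t * w i"]
    show "[:c \<alpha>:] * (\<Prod>i<m. ([:e i:] + t * w i) ^ \<alpha> i) =
      (\<Sum>\<beta>\<in>exponents m d. [:c \<alpha> * (\<Prod>i<m. of_nat (\<alpha> i choose \<beta> i) * e i ^ (\<alpha> i - \<beta> i)):] * (\<Prod>i<m. (t * w i) ^ \<beta> i))"
      by (simp only: * prod_const_poly sum_distrib_left mult.assoc[symmetric]) (simp add: mult.commute)
  qed
  also have "\<dots> = (\<Sum>\<beta>\<in>exponents m d. [:taylor_coeff m d c e \<beta>:] * (\<Prod>i<m. (t * w i) ^ \<beta> i))"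
    unfolding taylor_coeff_def sum_const_poly[symmetric] sum_distrib_right by (rule sum.swap)
  also have "\<dots> = poly (\<Sum>\<beta>\<in>exponents m d. monom ([:taylor_coeff m d c e \<beta>:] * (\<Prod>i<m. w i ^ \<beta> i)) (\<Sum>i<m. \<beta> i)) t"
    unfolding poly_sum poly_monom
    by (intro sum.cong refl) (simp only: power_mult_distrib prod.distrib power_sum mult_ac)
  finally show "poly (\<Sum>\<beta>\<in>exponents m d. monom ([:taylor_coeff m d c e \<beta>:] * (\<Prod>i<m. w i ^ \<beta> i)) (\<Sum>i<m. \<beta> i)) t
     = eval_over m (exponents m d) c (\<lambda>i. [:e i:] + t * w i)" ..
qed

lemma coeff_eval_over_line_eq_0:
  fixes c :: "(nat \<Rightarrow> nat) \<Rightarrow> 'a::idom"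
  assumes "\<And>\<beta>. \<beta> \<in> exponents m d \<Longrightarrow> (\<Sum>i<m. \<beta> i) < l \<Longrightarrow> taylor_coeff m d c e \<beta> = 0" "n < l"
  shows "coeff (line_poly (eval_over m (exponents m d) c) (\<lambda>i. [:e i:]) w) n = 0"
  unfolding eval_over_line using assms by (auto simp: coeff_sum intro!: sum.neutral)

lemma coeff_mult_degree_le:
  assumes "degree p \<le> a" "degree q \<le> b"
  shows "coeff (p * q) (a + b) = coeff p a * coeff q b"
proof -
  have "coeff (p * q) (a + b) = (\<Sum>i\<in>{a}. coeff p i * coeff q (a + b - i))"
    unfolding coeff_mult
  proof (rule sum.mono_neutral_right)
    show "\<forall>i\<in>{..a + b} - {a}. coeff p i * coeff q (a + b - i) = 0"
    proof
      fix i assume "i \<in> {..a + b} - {a}"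
      then consider "a < i" | "b < a + b - i" by force
      then show "coeff p i * coeff q (a + b - i) = 0"
        using assms by cases (simp_all add: coeff_eq_0)
    qed
  qed auto
  then show ?thesis by simp
qed

lemma coeff_prod_linear_top:
  fixes x y :: "nat \<Rightarrow> 'r::idom"
  shows "degree (\<Prod>i<m. [:x i, y i:] ^ \<alpha> i) \<le> (\<Sum>i<m. \<alpha> i)"
    "coeff (\<Prod>i<m. [:x i, y i:] ^ \<alpha> i) (\<Sum>i<m. \<alpha> i) = (\<Prod>i<m. y i ^ \<alpha> i)"
proof (induction m)
  case (Suc m)
  have 1: "degree ([:x m, y m:] ^ \<alpha> m) \<le> \<alpha> m"
    using degree_power_le[of "[:x m, y m:]" "\<alpha> m"] by (auto split: if_splits)
  {
    case 1
    show ?case using Suc(1) \<open>degree ([:x m, y m:] ^ \<alpha> m) \<le> \<alpha> m\<close>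
      by (auto intro: order_trans[OF degree_mult_le])
  next
    case 2
    have "coeff ([:x m, y m:] ^ \<alpha> m) (\<alpha> m) = y m ^ \<alpha> m"
      by (simp add: coeff_linear_poly_power)
    with Suc 1 show ?case
      by (simp add: coeff_mult_degree_le)
  }
qed auto

lemma digits_unique:
  fixes d e :: "nat \<Rightarrow> nat"
  assumes "\<And>i. i < n \<Longrightarrow> d i < N" "\<And>i. i < n \<Longrightarrow> e i < N"
    "(\<Sum>i<n. d i * N ^ i) = (\<Sum>i<n. e i * N ^ i)" "i < n"
  shows "d i = e i"
  using assms
proof (induction n arbitrary: d e i)
  case (Suc n)
  have split: "(\<Sum>i<Suc n. f i * N ^ i) = f 0 + N * (\<Sum>i<n. f (Suc i) * N ^ i)" for f :: "nat \<Rightarrow> nat"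
    by (subst sum.lessThan_Suc_shift) (simp add: sum_distrib_left mult_ac)
  have "d 0 + N * (\<Sum>i<n. d (Suc i) * N ^ i) = e 0 + N * (\<Sum>i<n. e (Suc i) * N ^ i)"
    using Suc.prems(3) unfolding split .
  moreover have "d 0 < N" "e 0 < N" using Suc.prems by auto
  ultimately have eq0: "d 0 = e 0" by (metis mod_less mod_mult_self2)
  with \<open>d 0 + _ = _\<close> \<open>d 0 < N\<close> have eq: "(\<Sum>i<n. d (Suc i) * N ^ i) = (\<Sum>i<n. e (Suc i) * N ^ i)" by simp
  show ?case
  proof (cases i)
    case (Suc i')
    then show ?thesis
      using Suc.IH[of "\<lambda>i. d (Suc i)" "\<lambda>i. e (Suc i)" i'] Suc.prems eq by auto
  qed (use eq0 in simp)
qed simp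

text \<open>A plane that is a graph over the last two coordinates: it passes through (x, 0, 0) and
  is spanned by (a, 1, 0) and (b, 0, 1).\<close>

definition plane_point ::
  "nat \<Rightarrow> (nat \<Rightarrow> 'a) \<Rightarrow> (nat \<Rightarrow> 'a) \<Rightarrow> (nat \<Rightarrow> 'a) \<Rightarrow> 'a \<Rightarrow> 'a \<Rightarrow> nat \<Rightarrow> 'a::comm_ring_1" where
  "plane_point k x a b y z =
    (\<lambda>i\<in>{..<k+2}. if i < k then x i + y * a i + z * b i else if i = k then y else z)"

text \<open>Variables 0 and 1 run along a plane and variable 2 leaves it. Vanishing to order
  \<open>l\<close> at a point of the plane makes the coefficient \<open>g j\<close> of the j-th
  transversal power vanish there to order \<open>l - j\<close>. Summed over \<open>B\<close> this
  exceeds what the degree \<open>d - j\<close> allows on a two-dimensional grid.\<close>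

lemma vanishing_on_plane:
  fixes f :: "(nat \<Rightarrow> 'r::idom) \<Rightarrow> 'r"
  assumes inf: "infinite (UNIV :: 'r set)"
    and A: "finite A" and B: "B \<subseteq> PiE {0,1} (\<lambda>_. A)"
    and g: "\<And>j. j \<le> d \<Longrightarrow> polyfun {0,1} (d - j) (g j)"
    and f: "\<And>x. f x = (\<Sum>j\<le>d. g j x * x 2 ^ j)"
    and vanish: "\<And>a w n. a \<in> B \<Longrightarrow> n < l \<Longrightarrow> coeff (line_poly f (a(2 := 0)) w) n = 0"
    and j: "j \<le> d" "(d - j) * card A < card B * (l - j)"
  shows "g j x = 0"
proof (rule ccontr)
  assume "g j x \<noteq> 0"
  from schwartz_zippel_multiplicity[of "{0,1}" A "d - j" "g j", OF inf _ A g[OF j(1)] this]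
  obtain w where "\<forall>a\<in>PiE {0,1} (\<lambda>_. A). line_poly (g j) a w \<noteq> 0"
    "(\<Sum>a\<in>PiE {0,1} (\<lambda>_. A). order 0 (line_poly (g j) a w)) * card A \<le> (d - j) * card A ^ card {0,1::nat}"
    by blast
  then have w: "\<And>a. a \<in> PiE {0,1} (\<lambda>_. A) \<Longrightarrow> line_poly (g j) a w \<noteq> 0"
    "(\<Sum>a\<in>PiE {0,1} (\<lambda>_. A). order 0 (line_poly (g j) a w)) * card A \<le> (d - j) * card A ^ 2"
    by (blast, simp add: numeral_2_eq_2)
  have ord: "l - j \<le> order 0 (line_poly (g j) a w)" if a: "a \<in> B" for a
  proof (rule order_0_ge)
    show "line_poly (g j) a w \<noteq> 0" using B a by (intro w(1)) blast
    fix i assume i: "i < l - j"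
    let ?n = "i + j"
    \<comment> \<open>The coefficient of degree \<open>i + j\<close> along a direction with third
      entry \<open>u\<close>, as a polynomial in \<open>u\<close>. It vanishes on an infinite ring,
      hence identically, and its j-th coefficient is the one wanted.\<close>
    define Q where "Q = (\<Sum>j\<le>d. monom (if j \<le> ?n then coeff (line_poly (g j) a w) (?n - j) else 0) j)"
    have "poly Q u = 0" for u
    proof -
      have "line_poly f (a(2 := 0)) (w(2 := u)) = (\<Sum>j\<le>d. monom (u ^ j) j * line_poly (g j) a w)"
      proof (rule line_poly_eqI[OF inf])
        fix t
        let ?x = "\<lambda>i. (a(2 := 0)) i + t * (w(2 := u)) i"
        have "g j ?x = poly (line_poly (g j) a w) t" if "j \<le> d" for j
          unfolding poly_line_poly[OF g[OF that]] by (rule polyfun_cong[OF g[OF that]]) simp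
        then show "poly (\<Sum>j\<le>d. monom (u ^ j) j * line_poly (g j) a w) t = f ?x"
          unfolding f poly_sum by (intro sum.cong) (auto simp: poly_monom power_mult_distrib mult_ac)
      qed
      then have "coeff (\<Sum>j\<le>d. monom (u ^ j) j * line_poly (g j) a w) ?n = 0"
        using vanish[OF a, of ?n "w(2 := u)"] i by simp
      also have "coeff (\<Sum>j\<le>d. monom (u ^ j) j * line_poly (g j) a w) ?n = poly Q u"
        unfolding Q_def poly_sum coeff_sum
        by (intro sum.cong refl) (simp add: coeff_monom_mult poly_monom)
      finally show ?thesis .
    qed
    then have "Q = 0" by (intro poly_eqI_infinite[OF inf]) simp
    then have "coeff Q j = 0" by simp
    moreover have "coeff Q j = coeff (line_poly (g j) a w) i"
      unfolding Q_def coeff_sum using j(1) by (simp add: sum.delta)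
    ultimately show "coeff (line_poly (g j) a w) i = 0" by simp
  qed
  have fin: "finite (PiE {0,1::nat} (\<lambda>_. A))" using A by (intro finite_PiE) auto
  have "card B * (l - j) = (\<Sum>a\<in>B. l - j)" by simp
  also have "\<dots> \<le> (\<Sum>a\<in>B. order 0 (line_poly (g j) a w))" by (intro sum_mono ord)
  also have "\<dots> \<le> (\<Sum>a\<in>PiE {0,1} (\<lambda>_. A). order 0 (line_poly (g j) a w))"
    by (intro sum_mono2 fin B) simp
  finally have "card B * (l - j) * card A \<le> (d - j) * card A ^ 2"
    using w(2) by (meson mult_le_mono1 order_trans)
  moreover have "(d - j) * card A * card A < card B * (l - j) * card A" if "0 < card A"
    using j(2) that by simp
  moreover have "0 < card A"
  proof (rule ccontr)
    assume "\<not> 0 < card A"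
    then have "A = {}" using A by simp
    then have "PiE {0,1::nat} (\<lambda>_. A) = {}" by (auto simp: PiE_eq_empty_iff)
    with B j(2) show False by simp
  qed
  ultimately show False by (simp add: power2_eq_square)
qed

text \<open>Evaluating the leading form at \<open>X i = s ^ (N ^ (i + 1))\<close> separates its monomials.\<close>

lemma leading_form_nonzero:
  fixes c :: "(nat \<Rightarrow> nat) \<Rightarrow> 'a::idom"
  assumes M: "M \<subseteq> {\<alpha>. \<alpha> \<in> {..<k+2} \<rightarrow>\<^sub>E UNIV \<and> (\<Sum>i<k+2. \<alpha> i) = d}" "finite M"
    and \<alpha>: "\<alpha> \<in> M" "c \<alpha> \<noteq> 0"
  shows "\<exists>X. eval_over (k+2) M c (\<lambda>i. if i < k then X i else if i = k then 1 else [:0, 1:]) \<noteq> 0"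
proof -
  define N where "N = Suc d"
  define X where "X i = monom (1::'a) (N ^ Suc i)" for i
  \<comment> \<open>Coordinate \<open>k\<close> is set to 1, so the exponent
    \<open>\<beta> k\<close> leaves no trace in the power of s. It is recovered from the common
    total degree.\<close>
  define \<kappa> where "\<kappa> \<beta> = \<beta> (Suc k) + (\<Sum>i<k. \<beta> i * N ^ Suc i)" for \<beta> :: "nat \<Rightarrow> nat"
  have prod_monom: "(\<Prod>i\<in>I. monom 1 (f i)) = monom (1::'a) (\<Sum>i\<in>I. f i)"
    for f and I :: "nat set"
    by (induction I rule: infinite_finite_induct) (auto simp: mult_monom)
  have ev: "eval_over (k+2) M c (\<lambda>i. if i < k then X i else if i = k then 1 else [:0, 1:])
      = (\<Sum>\<beta>\<in>M. monom (c \<beta>) (\<kappa> \<beta>))"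
    unfolding eval_over_def
  proof (intro sum.cong refl)
    fix \<beta>
    have "(\<Prod>i<k+2. (if i < k then X i else if i = k then 1 else [:0, 1:]) ^ \<beta> i)
      = (\<Prod>i<k. X i ^ \<beta> i) * [:0, 1:] ^ \<beta> (Suc k)" by simp
    also have "(\<Prod>i<k. X i ^ \<beta> i) = monom 1 (\<Sum>i<k. \<beta> i * N ^ Suc i)"
      unfolding X_def by (simp add: monom_power prod_monom mult.commute)
    also have "[:0, 1:] ^ \<beta> (Suc k) = monom (1::'a) (\<beta> (Suc k))"
      by (simp add: monom_altdef)
    finally show "[:c \<beta>:] * (\<Prod>i<k+2. (if i < k then X i else if i = k then 1 else [:0, 1:]) ^ \<beta> i)
      = monom (c \<beta>) (\<kappa> \<beta>)"
      by (simp add: mult_monom \<kappa>_def smult_monom add.commute)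
  qed
  have inj: "\<beta> = \<alpha>" if "\<beta> \<in> M" "\<kappa> \<beta> = \<kappa> \<alpha>" for \<beta>
  proof -
    define D where "D \<gamma> i = (if i = 0 then \<gamma> (Suc k) else \<gamma> (i - 1))" for \<gamma> :: "nat \<Rightarrow> nat" and i
    have small: "D \<gamma> i < N" if "\<gamma> \<in> M" "i < Suc k" for \<gamma> i
    proof -
      have "\<gamma> j \<le> d" if "j < k + 2" for j
        using member_le_sum[of j "{..<k+2}" \<gamma>] M \<open>\<gamma> \<in> M\<close> that by auto
      then show ?thesis using that unfolding D_def N_def by (auto simp: less_Suc_eq_le)
    qed
    have \<kappa>: "\<kappa> \<gamma> = (\<Sum>i<Suc k. D \<gamma> i * N ^ i)" for \<gamma>
      unfolding \<kappa>_def D_def by (subst sum.lessThan_Suc_shift) simp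
    have D: "D \<beta> i = D \<alpha> i" if "i < Suc k" for i
      using digits_unique[of "Suc k" "D \<beta>" N "D \<alpha>" i] small \<open>\<beta> \<in> M\<close> \<alpha>(1) \<open>\<kappa> \<beta> = \<kappa> \<alpha>\<close> that
      unfolding \<kappa> by blast
    have eq: "\<beta> i = \<alpha> i" if "i < k" for i using D[of "Suc i"] that unfolding D_def by simp
    have eq': "\<beta> (Suc k) = \<alpha> (Suc k)" using D[of 0] unfolding D_def by simp
    have "(\<Sum>i<k+2. \<beta> i) = (\<Sum>i<k+2. \<alpha> i)" using M \<open>\<beta> \<in> M\<close> \<alpha>(1) by auto
    moreover have "(\<Sum>i<k. \<beta> i) = (\<Sum>i<k. \<alpha> i)" using eq by (intro sum.cong) auto
    ultimately have "\<beta> k = \<alpha> k" using eq' by simp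
    with eq eq' have "\<beta> i = \<alpha> i" if "i \<in> {..<k+2}" for i
      using that by (cases "i < k"; cases "i = k"; cases "i = Suc k") auto
    moreover have "\<beta> \<in> {..<k+2} \<rightarrow>\<^sub>E UNIV" "\<alpha> \<in> {..<k+2} \<rightarrow>\<^sub>E UNIV" using M \<open>\<beta> \<in> M\<close> \<alpha>(1) by auto
    ultimately show ?thesis by (intro PiE_ext)
  qed
  have "coeff (\<Sum>\<beta>\<in>M. monom (c \<beta>) (\<kappa> \<beta>)) (\<kappa> \<alpha>) = (\<Sum>\<beta>\<in>{\<alpha>}. c \<beta>)"
    unfolding coeff_sum using \<alpha>(1) M(2) inj by (intro sum.mono_neutral_cong_right) auto
  with \<alpha>(2) have "(\<Sum>\<beta>\<in>M. monom (c \<beta>) (\<kappa> \<beta>)) \<noteq> 0" by auto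
  with ev show ?thesis by metis
qed

text \<open>The base point \<open>x\<close> disappears: at infinity a line only remembers its
  direction. So the leading form is tied to the direction of a plane, wherever the plane
  lies.\<close>

lemma coeff_line_eval_over_top:
  fixes c :: "(nat \<Rightarrow> nat) \<Rightarrow> 'a::idom"
  assumes "finite M" "\<And>\<alpha>. \<alpha> \<in> M \<Longrightarrow> (\<Sum>i<m. \<alpha> i) \<le> d"
  shows "coeff (line_poly (eval_over m M c) x y) d = eval_over m {\<alpha>\<in>M. (\<Sum>i<m. \<alpha> i) = d} c y"
proof -
  have "line_poly (eval_over m M c) x y = (\<Sum>\<alpha>\<in>M. smult [:c \<alpha>:] (\<Prod>i<m. [:x i, y i:] ^ \<alpha> i))"
  proof (rule line_poly_eqI[OF infinite_UNIV_poly])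
    fix t
    show "poly (\<Sum>\<alpha>\<in>M. smult [:c \<alpha>:] (\<Prod>i<m. [:x i, y i:] ^ \<alpha> i)) t
      = eval_over m M c (\<lambda>i. x i + t * y i)"
      unfolding eval_over_def poly_sum by (intro sum.cong refl) (simp add: poly_prod)
  qed
  then have "coeff (line_poly (eval_over m M c) x y) d
      = (\<Sum>\<alpha>\<in>M. [:c \<alpha>:] * coeff (\<Prod>i<m. [:x i, y i:] ^ \<alpha> i) d)"
    by (simp add: coeff_sum)
  also have "\<dots> = (\<Sum>\<alpha>\<in>M. if (\<Sum>i<m. \<alpha> i) = d then [:c \<alpha>:] * (\<Prod>i<m. y i ^ \<alpha> i) else 0)"
  proof (intro sum.cong refl)
    fix \<alpha> assume "\<alpha> \<in> M"
    show "[:c \<alpha>:] * coeff (\<Prod>i<m. [:x i, y i:] ^ \<alpha> i) d = (if (\<Sum>i<m. \<alpha> i) = d then [:c \<alpha>:] * (\<Prod>i<m. y i ^ \<alpha> i) else 0)"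
    proof (cases "(\<Sum>i<m. \<alpha> i) = d")
      case True
      then show ?thesis using coeff_prod_linear_top(2)[of x y \<alpha> m] by simp
    next
      case False
      with assms(2)[OF \<open>\<alpha> \<in> M\<close>] have "(\<Sum>i<m. \<alpha> i) < d" by simp
      then have "coeff (\<Prod>i<m. [:x i, y i:] ^ \<alpha> i) d = 0"
        using coeff_prod_linear_top(1)[of x y \<alpha> m] by (intro coeff_eq_0) linarith
      with False show ?thesis by simp
    qed
  qed
  also have "\<dots> = eval_over m {\<alpha>\<in>M. (\<Sum>i<m. \<alpha> i) = d} c y"
    unfolding eval_over_def using assms(1) by (intro sum.inter_filter[symmetric])
  finally show ?thesis .
qed

text \<open>The method of multiplicities for planes. A nonzero polynomial vanishes to order
  \<open>l\<close> on \<open>E\<close>. Around a plane rich in points of \<open>E\<close> its first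
  \<open>J\<close> transversal coefficients vanish identically, so at infinity its leading form
  vanishes to order \<open>J\<close> at the point coding the direction. The multiplicity bound on a
  grid then limits the number of directions.\<close>

lemma kakeya_planes:
  fixes E :: "(nat \<Rightarrow> 'a::{field,finite}) set" and k l d J N :: nat
  assumes fin: "finite E" and l: "0 < l"
    and small: "card E * card (exponents (k+2) (l - 1)) < card (exponents (k+2) d)"
    and mult: "\<And>j. j < J \<Longrightarrow> j \<le> d \<Longrightarrow> (d - j) * CARD('a) < N * (l - j)"
    and G: "G \<subseteq> {(a, b). a \<in> {..<k} \<rightarrow>\<^sub>E UNIV \<and> b \<in> {..<k} \<rightarrow>\<^sub>E UNIV \<and>
      (\<exists>x. N \<le> card {(y, z). plane_point k x a b y z \<in> E})}"
  shows "card G * J * CARD('a) ^ 2 \<le> d * CARD('a) ^ (2 * k)"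
proof -
  let ?s = "[:0, 1:] :: 'a poly"
  obtain c where c: "\<exists>\<alpha>\<in>exponents (k+2) d. c \<alpha> \<noteq> (0::'a)"
    and van: "\<And>e \<beta>. e \<in> E \<Longrightarrow> \<beta> \<in> exponents (k+2) d \<Longrightarrow> (\<Sum>i<k+2. \<beta> i) < l \<Longrightarrow> taylor_coeff (k+2) d c e \<beta> = 0"
    using vanishing_polynomial_exists[OF fin l small] by blast
  define M where "M = {\<alpha>\<in>exponents (k+2) d. c \<alpha> \<noteq> 0}"
  have finM: "finite M" unfolding M_def using finite_exponents by simp
  define D where "D = Max ((\<lambda>\<alpha>. \<Sum>i<k+2. \<alpha> i) ` M)"
  have M_le: "(\<Sum>i<k+2. \<alpha> i) \<le> D" if "\<alpha> \<in> M" for \<alpha>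
    unfolding D_def using finM that by (intro Max_ge) auto
  have "D \<in> (\<lambda>\<alpha>. \<Sum>i<k+2. \<alpha> i) ` M"
    unfolding D_def using finM c by (intro Max_in) (auto simp: M_def)
  then obtain \<alpha>0 where \<alpha>0: "\<alpha>0 \<in> M" "(\<Sum>i<k+2. \<alpha>0 i) = D" by blast
  have Dd: "D \<le> d" using \<alpha>0 unfolding M_def exponents_def by auto
  define P where "P = eval_over (k+2) (exponents (k+2) d) c"
  have P_M: "P = eval_over (k+2) M c"
    unfolding P_def eval_over_def M_def
    by (intro ext sum.mono_neutral_right finite_exponents) auto
  have pfP: "polyfun {..<k+2} D P" unfolding P_M by (rule polyfun_eval_over) (rule M_le)
  define M' where "M' = {\<alpha>\<in>M. (\<Sum>i<k+2. \<alpha> i) = D}"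
  \<comment> \<open>The leading form at (X, 1, s). For X = a + s b this is (a, 1, 0) + s (b, 0, 1),
    a vector along the plane.\<close>
  define T where "T X = eval_over (k+2) M' c (\<lambda>i. if i < k then X i else if i = k then 1 else ?s)" for X
  obtain X0 where X0: "T X0 \<noteq> 0"
  proof -
    have "M' \<subseteq> {\<alpha>. \<alpha> \<in> {..<k+2} \<rightarrow>\<^sub>E UNIV \<and> (\<Sum>i<k+2. \<alpha> i) = D}"
      unfolding M'_def M_def exponents_def by blast
    moreover have "finite M'" "\<alpha>0 \<in> M'" "c \<alpha>0 \<noteq> 0"
      using finM \<alpha>0 unfolding M'_def by (simp, simp, simp add: M_def)
    ultimately show thesis using leading_form_nonzero[of M' k D \<alpha>0 c] that unfolding T_def by blast
  qed
  have pfT: "polyfun {..<k} D T"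
    unfolding T_def
  proof (rule polyfun_subst[where l = "\<lambda>X i. if i < k then X i else if i = k then 1 else ?s"])
    show "polyfun {..<k+2} D (eval_over (k+2) M' c)"
      by (rule polyfun_eval_over) (simp add: M'_def)
    show "polyfun {..<k} 1 (\<lambda>X. if i < k then X i else if i = k then 1 else ?s)" for i
      using polyfun.var[of i "{..<k}" 0] polyfun.const[of "{..<k}" 1 "if i = k then 1 else ?s"]
      by (cases "i < k") simp_all
  qed
  \<comment> \<open>The polynomials u + v s code pairs of field elements, so the grid over
    \<open>k\<close> coordinates consists exactly of the direction pairs.\<close>
  define A :: "'a poly set" where "A = (\<lambda>(u, v). [:u, v:]) ` UNIV"
  have cardA: "card A = CARD('a) ^ 2"
    unfolding A_def by (subst card_image) (auto simp: inj_on_def card_cartesian_product power2_eq_square simp flip: UNIV_Times_UNIV)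
  have finA: "finite A" unfolding A_def by simp
  obtain w where w: "\<And>a. a \<in> PiE {..<k} (\<lambda>_. A) \<Longrightarrow> line_poly T a w \<noteq> 0"
    "(\<Sum>a\<in>PiE {..<k} (\<lambda>_. A). order 0 (line_poly T a w)) * card A \<le> D * card A ^ k"
    using schwartz_zippel_multiplicity[OF infinite_UNIV_poly _ finA pfT X0] by auto
  define pt where "pt = (\<lambda>(a, b). \<lambda>i\<in>{..<k}. [:a i, b i:] :: 'a poly)"
  have pt_in: "pt p \<in> PiE {..<k} (\<lambda>_. A)" for p
    unfolding pt_def A_def by (cases p) auto
  have ord: "J \<le> order 0 (line_poly T (pt p) w)" if p: "p \<in> G" for p
  proof -
    obtain a b where ab: "p = (a, b)" by (cases p)
    with p G obtain x where x: "N \<le> card {(y, z). plane_point k x a b y z \<in> E}" by blast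
    \<comment> \<open>\<open>v 0\<close> and \<open>v 1\<close> are the parameters of the plane;
      \<open>v 2\<close> is a displacement along the generic direction \<open>w\<close>, which moves
      only the first \<open>k\<close> coordinates.\<close>
    define lin where "lin v = (\<lambda>i. if i < k then [:x i:] + v 0 * [:a i:] + v 1 * [:b i:] + v 2 * w i
      else if i = k then v 0 else v (1::nat))" for v :: "nat \<Rightarrow> 'a poly"
    define h where "h v = P (lin v)" for v
    have "polyfun (insert 2 {0,1}) D h"
      unfolding h_def
    proof (rule polyfun_subst[OF pfP])
      fix i
      have v: "polyfun (insert 2 {0,1}) 1 (\<lambda>v. v j * c)" if "j \<in> insert 2 {0,1}" for j and c :: "'a poly"
        using polyfun_cmult[OF polyfun.var[OF that, of 0], of c] by (simp add: mult.commute)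
      have "polyfun (insert 2 {0,1}) 1 (\<lambda>v. [:x i:] + v 0 * [:a i:] + v 1 * [:b i:] + v 2 * w i)"
        by (intro polyfun.add v polyfun.const) auto
      moreover have "polyfun (insert 2 {0,1}) 1 (\<lambda>v::nat \<Rightarrow> 'a poly. v 0)" "polyfun (insert 2 {0,1}) 1 (\<lambda>v::nat \<Rightarrow> 'a poly. v 1)"
        using v[of 0 1] v[of 1 1] by simp_all
      ultimately show "polyfun (insert 2 {0,1}) 1 (\<lambda>v. lin v i)"
        unfolding lin_def by (cases "i < k"; cases "i = k") simp_all
    qed
    from polyfun_split[OF this] obtain g where g: "\<And>j. j \<le> D \<Longrightarrow> polyfun {0,1} (D - j) (g j)"
      "\<And>v. h v = (\<Sum>j\<le>D. g j v * v 2 ^ j)" by blast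
    define B where "B = (\<lambda>(y, z). \<lambda>i\<in>{0,1::nat}. if i = 0 then [:y:] else [:z:]) ` {(y, z). plane_point k x a b y z \<in> E}"
    have cardB: "N \<le> card B"
      unfolding B_def
    proof (subst card_image)
      show "inj_on (\<lambda>(y, z). \<lambda>i\<in>{0,1::nat}. if i = 0 then [:y:] else [:z:]) {(y, z). plane_point k x a b y z \<in> E}"
      proof (rule inj_onI, clarify)
        fix y z y' z'
        assume eq: "(\<lambda>i\<in>{0,1::nat}. if i = 0 then [:y:] else [:z:]) = (\<lambda>i\<in>{0,1::nat}. if i = 0 then [:y':] else [:z':])"
        from fun_cong[OF eq, of 0] fun_cong[OF eq, of 1] show "y = y' \<and> z = z'" by simp
      qed
    qed (rule x)
    have g0: "g j v = 0" if j: "j < J" "j \<le> D" for j v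
    proof (rule vanishing_on_plane[OF infinite_UNIV_poly _ _ g])
      show "finite ((\<lambda>y. [:y:]) ` (UNIV :: 'a set))" by simp
      show "B \<subseteq> PiE {0,1} (\<lambda>_. (\<lambda>y. [:y:]) ` UNIV)" unfolding B_def by (auto split: if_splits)
      show "j \<le> D" by fact
      have cA: "card ((\<lambda>y. [:y:]) ` (UNIV :: 'a set)) = CARD('a)" by (rule card_image) (auto simp: inj_on_def)
      have "(D - j) * CARD('a) \<le> (d - j) * CARD('a)" using Dd by (intro mult_right_mono) auto
      moreover have "N * (l - j) \<le> card B * (l - j)" using cardB by (intro mult_right_mono) auto
      moreover have "(d - j) * CARD('a) < N * (l - j)" using mult[OF j(1)] j(2) Dd by simp
      ultimately have "(D - j) * CARD('a) < card B * (l - j)" by linarith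
      then show "(D - j) * card ((\<lambda>y. [:y:]) ` (UNIV :: 'a set)) < card B * (l - j)"
        unfolding cA .
      fix u v n assume "u \<in> B" and n: "n < l"
      then obtain y z where yz: "plane_point k x a b y z \<in> E" "u = (\<lambda>i\<in>{0,1::nat}. if i = 0 then [:y:] else [:z:])"
      proof -
        from \<open>u \<in> B\<close> obtain p where "p \<in> {(y, z). plane_point k x a b y z \<in> E}"
          "u = (\<lambda>(y, z). \<lambda>i\<in>{0,1::nat}. if i = 0 then [:y:] else [:z:]) p"
          unfolding B_def by (rule imageE)
        then show thesis using that by (cases p) simp
      qed
      define dir where "dir i = (if i < k then v 0 * [:a i:] + v 1 * [:b i:] + v 2 * w i else if i = k then v 0 else v (1::nat))" for i
      have "line_poly h (u(2 := 0)) v = line_poly P (\<lambda>i. [:plane_point k x a b y z i:]) dir"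
      proof (rule line_poly_eqI[OF infinite_UNIV_poly])
        fix t
        have "P (\<lambda>i. [:plane_point k x a b y z i:] + t * dir i) = P (lin (\<lambda>i. (u(2 := 0)) i + t * v i))"
        proof (rule polyfun_cong[OF pfP], rule ballI)
          fix i assume "i \<in> {..<k+2}"
          then show "[:plane_point k x a b y z i:] + t * dir i = lin (\<lambda>i. (u(2 := 0)) i + t * v i) i"
            unfolding lin_def dir_def plane_point_def yz(2) by (simp add: algebra_simps)
        qed
        then show "poly (line_poly P (\<lambda>i. [:plane_point k x a b y z i:]) dir) t = h (\<lambda>i. (u(2 := 0)) i + t * v i)"
          unfolding poly_line_poly[OF pfP] h_def .
      qed
      also have "coeff \<dots> n = 0"
        unfolding P_def by (rule coeff_eval_over_line_eq_0[OF van[OF yz(1)] n])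
      finally show "coeff (line_poly h (u(2 := 0)) v) n = 0" .
    qed
    \<comment> \<open>Scaling the parameters (1, s, t) by q and taking the coefficient of degree
      \<open>D\<close> in q extracts the leading form. It comes out as a polynomial in t whose
      coefficient \<open>r j\<close> depends on \<open>g j\<close> alone.\<close>
    define u where "u i = (if i = 0 then 1 else ?s)" for i :: nat
    define r where "r j = coeff (line_poly (g j) (\<lambda>_. 0) u) (D - j)" for j
    have "line_poly T (pt p) w = (\<Sum>j\<le>D. monom (r j) j)"
    proof (rule line_poly_eqI[OF infinite_UNIV_poly])
      fix t
      define Y where "Y i = (if i < k then [:a i, b i:] + t * w i else if i = k then 1 else ?s)" for i
      define x0 where "x0 i = (if i < k then [:x i:] else 0)" for i
      have "T (\<lambda>i. pt p i + t * w i) = eval_over (k+2) M' c Y"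
        unfolding T_def eval_over_def pt_def ab Y_def
        by (intro sum.cong refl arg_cong2[of _ _ _ _ "(*)"] prod.cong) auto
      also have "\<dots> = coeff (line_poly P x0 Y) D"
        unfolding M'_def P_M by (rule coeff_line_eval_over_top[symmetric, OF finM M_le])
      also have "line_poly P x0 Y = (\<Sum>j\<le>D. monom (t ^ j) j * line_poly (g j) (\<lambda>_. 0) u)"
      proof (rule line_poly_eqI[OF infinite_UNIV_poly])
        fix q
        define v where "v i = q * (if i = 0 then 1 else if i = 1 then ?s else t)" for i :: nat
        have "P (\<lambda>i. x0 i + q * Y i) = P (lin v)"
        proof (rule polyfun_cong[OF pfP], rule ballI)
          fix i assume "i \<in> {..<k+2}"
          then show "x0 i + q * Y i = lin v i"
            unfolding lin_def Y_def x0_def v_def by (simp add: algebra_simps)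
        qed
        also have "\<dots> = (\<Sum>j\<le>D. g j v * v 2 ^ j)" using g(2)[of v] unfolding h_def .
        also have "\<dots> = poly (\<Sum>j\<le>D. monom (t ^ j) j * line_poly (g j) (\<lambda>_. 0) u) q"
          unfolding poly_sum
        proof (intro sum.cong refl)
          fix j assume "j \<in> {..D}"
          then have "j \<le> D" by simp
          have "g j v = poly (line_poly (g j) (\<lambda>_. 0) u) q"
            unfolding poly_line_poly[OF g(1)[OF \<open>j \<le> D\<close>]]
            by (rule polyfun_cong[OF g(1)[OF \<open>j \<le> D\<close>]]) (simp add: v_def u_def)
          then show "g j v * v 2 ^ j = poly (monom (t ^ j) j * line_poly (g j) (\<lambda>_. 0) u) q"
            by (simp add: v_def poly_monom power_mult_distrib mult_ac)
        qed
        finally show "poly (\<Sum>j\<le>D. monom (t ^ j) j * line_poly (g j) (\<lambda>_. 0) u) q = P (\<lambda>i. x0 i + q * Y i)" ..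
      qed
      also have "coeff \<dots> D = poly (\<Sum>j\<le>D. monom (r j) j) t"
        unfolding coeff_sum poly_sum r_def
        by (intro sum.cong refl) (simp add: coeff_monom_mult poly_monom)
      finally show "poly (\<Sum>j\<le>D. monom (r j) j) t = T (\<lambda>i. pt p i + t * w i)" ..
    qed
    moreover have "r j = 0" if "j < J" "j \<le> D" for j
    proof -
      have "line_poly (g j) (\<lambda>_. 0) u = 0"
        by (rule line_poly_eqI[OF infinite_UNIV_poly]) (simp add: g0[OF that])
      then show ?thesis unfolding r_def by simp
    qed
    ultimately have "coeff (line_poly T (pt p) w) n = 0" if "n < J" for n
      using that by (auto simp: coeff_sum intro!: sum.neutral)
    with w(1)[OF pt_in] show ?thesis by (intro order_0_ge) auto
  qed
  have inj: "inj_on pt G"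
  proof (rule inj_onI)
    fix p p' assume pp: "p \<in> G" "p' \<in> G" "pt p = pt p'"
    obtain a b a' b' where ab: "p = (a, b)" "p' = (a', b')" by (cases p, cases p')
    have "a i = a' i \<and> b i = b' i" if "i \<in> {..<k}" for i
      using fun_cong[OF pp(3), of i] that unfolding ab pt_def by simp
    moreover have "a \<in> {..<k} \<rightarrow>\<^sub>E UNIV" "b \<in> {..<k} \<rightarrow>\<^sub>E UNIV" "a' \<in> {..<k} \<rightarrow>\<^sub>E UNIV" "b' \<in> {..<k} \<rightarrow>\<^sub>E UNIV"
      using G pp unfolding ab by auto
    ultimately have "a = a'" "b = b'" by (blast intro: PiE_ext)+
    then show "p = p'" using ab by simp
  qed
  have finP: "finite (PiE {..<k} (\<lambda>_. A))" using finA by (intro finite_PiE) auto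
  have "card G * J = (\<Sum>p\<in>G. J)" by simp
  also have "\<dots> \<le> (\<Sum>p\<in>G. order 0 (line_poly T (pt p) w))" by (intro sum_mono ord)
  also have "\<dots> = (\<Sum>a\<in>pt ` G. order 0 (line_poly T a w))" by (simp add: sum.reindex[OF inj])
  also have "\<dots> \<le> (\<Sum>a\<in>PiE {..<k} (\<lambda>_. A). order 0 (line_poly T a w))"
    using pt_in by (intro sum_mono2 finP) auto
  finally have "card G * J * card A \<le> D * card A ^ k"
    using w(2) by (meson mult_le_mono1 order_trans)
  also have "\<dots> \<le> d * card A ^ k" using Dd by simp
  finally show ?thesis unfolding cardA by (simp add: power_mult)
qed

section \<open>Choice of degree and multiplicity\<close>

lemma binomial_ratio:
  assumes "\<And>i. i < m \<Longrightarrow> y * real (a + i + 1) \<le> real (b + i + 1)" "0 \<le> y"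
  shows "y ^ m * real ((a + m) choose m) \<le> real ((b + m) choose m)"
  using assms(1)
proof (induction m)
  case (Suc m)
  have step: "real ((c + Suc m) choose Suc m) = real ((c + m) choose m) * (real (c + m + 1) / real (Suc m))" for c
  proof -
    have "Suc m * ((c + Suc m) choose Suc m) = Suc (c + m) * ((c + m) choose m)"
      using Suc_times_binomial_eq[of "c + m" m] by (simp add: mult.commute)
    then have "real (Suc m) * real ((c + Suc m) choose Suc m) = real (c + m + 1) * real ((c + m) choose m)"
      by (metis Suc_eq_plus1 of_nat_mult)
    then show ?thesis by (simp add: field_simps del: of_nat_Suc binomial_Suc_Suc)
  qed
  have "y ^ Suc m * real ((a + Suc m) choose Suc m)
      = (y ^ m * real ((a + m) choose m)) * ((y * real (a + m + 1)) / real (Suc m))"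
    unfolding step by (simp only: power_Suc times_divide_eq_right mult_ac)
  also have "\<dots> \<le> real ((b + m) choose m) * (real (b + m + 1) / real (Suc m))"
  proof (rule mult_mono)
    show "y ^ m * real ((a + m) choose m) \<le> real ((b + m) choose m)"
      using Suc.IH Suc.prems by (simp add: less_SucI)
    show "y * real (a + m + 1) / real (Suc m) \<le> real (b + m + 1) / real (Suc m)"
      using Suc.prems[of m] by (intro divide_right_mono) auto
    show "0 \<le> y * real (a + m + 1) / real (Suc m)" using assms(2) by simp
  qed simp
  finally show ?case unfolding step .
qed simp

text \<open>The parameters are \<open>J = n\<close>, \<open>l = 2 n^2\<close> and a degree of about
  q (1 - 1/n) l. The loss 1/n in the degree makes room for n transversal coefficients on planes that
  are full up to a share 1/(32 n). It costs the dimension count only a constant factor, since (1 +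
  3/n)^n is at most 27.\<close>

lemma kakeya_planes_dense:
  fixes E :: "(nat \<Rightarrow> 'a::{field,finite}) set" and k n N :: nat
  defines "q \<equiv> real CARD('a)"
  assumes fin: "finite E" and n: "26 \<le> n" "k + 2 \<le> n" and q: "real n \<le> q"
    and small: "real (card E) \<le> q ^ (k + 2) / (8 * real n)"
    and N: "(1 - 1 / (32 * real n)) * q ^ 2 \<le> real N"
    and G: "G \<subseteq> {(a, b). a \<in> {..<k} \<rightarrow>\<^sub>E UNIV \<and> b \<in> {..<k} \<rightarrow>\<^sub>E UNIV \<and>
      (\<exists>x. N \<le> card {(y, z). plane_point k x a b y z \<in> E})}"
  shows "real (card G) * q \<le> 2 * real n * q ^ (2 * k)"
proof -
  define \<rho> where "\<rho> = nat \<lfloor>q * (1 - 1 / real n)\<rfloor>"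
  define l where "l = 2 * n ^ 2"
  define d where "d = \<rho> * l"
  let ?n = "real n"
  have n0: "26 \<le> ?n" using n by simp
  have q0: "26 \<le> q" using n0 q by simp
  have q1: "0 \<le> q * (1 - 1 / ?n)" using n0 q0 by (simp add: field_simps)
  have \<rho>_up: "real \<rho> \<le> q * (1 - 1 / ?n)" unfolding \<rho>_def using q1 by (simp add: of_nat_nat)
  have "q * (1 - 1 / ?n) - 1 < real_of_int \<lfloor>q * (1 - 1 / ?n)\<rfloor>" by linarith
  also have "\<dots> = real \<rho>" unfolding \<rho>_def using q1 by (simp add: of_nat_nat)
  finally have "q * (1 - 1 / ?n) - 1 < real \<rho>" .
  \<comment> \<open>Rounding down loses at most 1, hence at most \<open>q / n\<close>.\<close>
  moreover have "1 \<le> q / ?n" using q n0 by (simp add: field_simps)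
  moreover have "q * (1 - 2 / ?n) = q * (1 - 1 / ?n) - q / ?n" by (simp add: field_simps)
  ultimately have \<rho>_low: "q * (1 - 2 / ?n) \<le> real \<rho>" by linarith
  have l0: "0 < l" unfolding l_def using n by simp
  have rl: "real l = 2 * ?n ^ 2" unfolding l_def by simp
  have rd: "real d = real \<rho> * (2 * ?n ^ 2)" unfolding d_def rl[symmetric] by simp
  \<comment> \<open>This is d / (l + n), because l + n = n (2 n + 1): a lower bound for every factor
    in the quotient of the two binomial coefficients.\<close>
  define y where "y = real \<rho> * (2 * ?n) / (2 * ?n + 1)"
  have y0: "0 \<le> y" unfolding y_def by simp
  have y_low: "q / (1 + 3 / ?n) \<le> y"
  proof -
    have "(2 * ?n + 1) * ?n \<le> (?n - 2) * 2 * (?n + 3)"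
      using n0 by (simp add: algebra_simps)
    then have "?n \<le> (?n - 2) * 2 * (?n + 3) / (2 * ?n + 1)"
      using n0 by (simp add: pos_le_divide_eq mult.commute)
    then have "?n / (?n + 3) \<le> (?n - 2) * 2 / (2 * ?n + 1)"
      using n0 by (simp add: pos_divide_le_eq)
    moreover have "?n / (?n + 3) = 1 / (1 + 3 / ?n)" "(?n - 2) * 2 = (1 - 2 / ?n) * (2 * ?n)"
      using n0 by (simp_all add: field_simps)
    ultimately have "1 / (1 + 3 / ?n) \<le> (1 - 2 / ?n) * (2 * ?n) / (2 * ?n + 1)" by simp
    then have "q * (1 / (1 + 3 / ?n)) \<le> q * ((1 - 2 / ?n) * (2 * ?n) / (2 * ?n + 1))"
      using q0 by (intro mult_left_mono) auto
    also have "\<dots> = (q * (1 - 2 / ?n)) * (2 * ?n) / (2 * ?n + 1)" by simp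
    also have "\<dots> \<le> y" unfolding y_def
      by (intro divide_right_mono mult_right_mono \<rho>_low) auto
    finally show ?thesis by simp
  qed
  have "(1 + 3 / ?n) ^ (k + 2) \<le> exp (3 / ?n) ^ (k + 2)"
    using n0 by (intro power_mono exp_ge_add_one_self) auto
  also have "\<dots> = exp (real (k + 2) * (3 / ?n))" by (rule exp_of_nat_mult[symmetric])
  also have "\<dots> \<le> exp 3"
  proof -
    have "real (k + 2) \<le> ?n" using n(2) by simp
    then have "real (k + 2) * (3 / ?n) \<le> ?n * (3 / ?n)" by (intro mult_right_mono) auto
    also have "\<dots> = 3" using n0 by simp
    finally show ?thesis by simp
  qed
  also have "exp 3 = exp (1::real) ^ 3" by (simp flip: exp_of_nat_mult)
  also have "\<dots> \<le> 3 ^ 3" by (intro power_mono exp_le) auto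
  finally have e27: "(1 + 3 / ?n) ^ (k + 2) \<le> 27" by simp
  have pos: "0 < (1 + 3 / ?n) ^ (k + 2)" using n0 by (intro zero_less_power) (simp add: add_pos_pos)
  have "q ^ (k + 2) / (8 * ?n) < q ^ (k + 2) / 27"
    using n0 q0 by (intro divide_strict_left_mono) auto
  also have "\<dots> \<le> q ^ (k + 2) / (1 + 3 / ?n) ^ (k + 2)"
    using e27 pos q0 by (intro divide_left_mono) auto
  also have "\<dots> = (q / (1 + 3 / ?n)) ^ (k + 2)" by (simp add: power_divide)
  also have "\<dots> \<le> y ^ (k + 2)" using y_low q0 n0 by (intro power_mono) auto
  finally have Ey: "real (card E) < y ^ (k + 2)" using small by linarith
  have "y ^ (k + 2) * real ((l - 1 + (k + 2)) choose (k + 2)) \<le> real ((d + (k + 2)) choose (k + 2))"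
  proof (rule binomial_ratio[OF _ y0])
    fix i assume "i < k + 2"
    with n have i: "real i \<le> ?n" by simp
    have "real (l - 1 + i + 1) = 2 * ?n ^ 2 + real i" using l0 rl by (simp add: of_nat_diff)
    also have "\<dots> \<le> ?n * (2 * ?n + 1)" using i by (simp add: power2_eq_square algebra_simps)
    finally have "y * real (l - 1 + i + 1) \<le> y * (?n * (2 * ?n + 1))"
      using y0 by (intro mult_left_mono)
    also have "\<dots> = real d" unfolding y_def rd using n0 by (simp add: field_simps power2_eq_square)
    also have "\<dots> \<le> real (d + i + 1)" by simp
    finally show "y * real (l - 1 + i + 1) \<le> real (d + i + 1)" .
  qed
  moreover have "0 < real ((l - 1 + (k + 2)) choose (k + 2))"
    by (simp only: of_nat_0_less_iff) (rule zero_less_binomial, simp)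
  ultimately have "real (card E) * real ((l - 1 + (k + 2)) choose (k + 2)) < real ((d + (k + 2)) choose (k + 2))"
    using Ey by (meson mult_strict_right_mono less_le_trans)
  then have sm: "card E * card (exponents (k + 2) (l - 1)) < card (exponents (k + 2) d)"
    unfolding card_exponents by (metis of_nat_less_iff of_nat_mult)
  have mu: "(d - j) * CARD('a) < N * (l - j)" if "j < n" "j \<le> d" for j
  proof -
    have "n \<le> l" unfolding l_def using n by (simp add: power2_eq_square)
    then have lj: "j \<le> l" using that by simp
    have "real ((d - j) * CARD('a)) \<le> real d * q" unfolding q_def by simp
    also have "\<dots> \<le> (q * (1 - 1 / ?n)) * (2 * ?n ^ 2) * q"
      unfolding rd using q0 by (intro mult_right_mono \<rho>_up) auto
    also have "\<dots> = q ^ 2 * (2 * ?n ^ 2 - 2 * ?n)" using n0 by (simp add: field_simps power2_eq_square)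
    \<comment> \<open>The degree takes 2 n^2 - 2 n of the available 2 n^2 - n. The margin n absorbs
      the missing share 1/(32 n) of the plane, which amounts to about n / 16.\<close>
    also have "\<dots> < q ^ 2 * ((1 - 1 / (32 * ?n)) * (2 * ?n ^ 2 - ?n))"
      using n0 q0 by (intro mult_strict_left_mono) (auto simp: field_simps power2_eq_square intro!: add_pos_pos mult_pos_pos)
    also have "\<dots> = (1 - 1 / (32 * ?n)) * q ^ 2 * (2 * ?n ^ 2 - ?n)" by simp
    also have "\<dots> \<le> real N * (real l - real j)"
    proof (intro mult_mono N)
      show "2 * ?n ^ 2 - ?n \<le> real l - real j" using that rl by simp
      show "0 \<le> 2 * ?n ^ 2 - ?n" using n0 by (simp add: power2_eq_square)
    qed simp
    also have "\<dots> = real (N * (l - j))" using lj by (simp add: of_nat_diff)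
    finally show ?thesis by (simp only: of_nat_less_iff)
  qed
  have "card G * n * CARD('a) ^ 2 \<le> d * CARD('a) ^ (2 * k)"
    by (rule kakeya_planes[OF fin l0 sm mu G])
  then have "real (card G) * ?n * q ^ 2 \<le> real d * q ^ (2 * k)"
    unfolding q_def by (metis of_nat_le_iff of_nat_mult of_nat_power)
  also have "\<dots> \<le> q * (2 * ?n ^ 2) * q ^ (2 * k)"
  proof (intro mult_right_mono)
    have "real \<rho> \<le> q" using \<rho>_up q0 n0 by (smt (verit) mult_left_le divide_nonneg_nonneg)
    then show "real d \<le> q * (2 * ?n ^ 2)" unfolding rd by (intro mult_right_mono) auto
  qed (use q0 in auto)
  finally have "(?n * q) * (real (card G) * q) \<le> (?n * q) * (2 * ?n * q ^ (2 * k))"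
    by (simp add: power2_eq_square mult_ac)
  moreover have "0 < ?n * q" using n0 q0 by simp
  ultimately show ?thesis by (simp only: mult_le_cancel_left_pos)
qed

section \<open>Second moments and random subspaces\<close>

text \<open>Expanding the squares counts colliding pairs. Distinct points collide with probability 1
  / \<open>card Y\<close>, and subtracting the mean cancels their share. The diagonal leaves the sum
  of the squares of \<open>f\<close>, at most \<open>B\<close> times the sum of
  \<open>f\<close>.\<close>

lemma pairwise_independent_variance:
  fixes f :: "'x \<Rightarrow> real" and ev :: "'h \<Rightarrow> 'x \<Rightarrow> 'y"
  assumes fin: "finite X" "finite Y" "finite U"
    and ev: "\<And>h u. h \<in> U \<Longrightarrow> u \<in> X \<Longrightarrow> ev h u \<in> Y"
    and pair: "\<And>u v. u \<in> X \<Longrightarrow> v \<in> X \<Longrightarrow> u \<noteq> v \<Longrightarrow> card {h\<in>U. ev h u = ev h v} * card Y = card U"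
    and f: "\<And>u. u \<in> X \<Longrightarrow> 0 \<le> f u \<and> f u \<le> B" and Y: "0 < card Y"
  shows "(\<Sum>h\<in>U. \<Sum>y\<in>Y. ((\<Sum>u | u \<in> X \<and> ev h u = y. f u) - sum f X / card Y)\<^sup>2) \<le> real (card U) * B * sum f X"
proof -
  let ?M = "sum f X" and ?c = "real (card Y)"
  define g where "g h y = (\<Sum>u | u \<in> X \<and> ev h u = y. f u)" for h y
  have g_alt: "g h y = (\<Sum>u\<in>X. if ev h u = y then f u else 0)" for h y
    unfolding g_def using fin by (simp add: sum.inter_filter)
  have sum_g: "(\<Sum>y\<in>Y. g h y) = ?M" if "h \<in> U" for h
    unfolding g_alt using ev[OF that] fin by (subst sum.swap) (simp add: sum.delta')
  have sq: "(\<Sum>y\<in>Y. (g h y)\<^sup>2) = (\<Sum>u\<in>X. \<Sum>v\<in>X. if ev h u = ev h v then f u * f v else 0)"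
    if "h \<in> U" for h
  proof -
    have "(\<Sum>y\<in>Y. (g h y)\<^sup>2) = (\<Sum>y\<in>Y. \<Sum>u\<in>X. \<Sum>v\<in>X. (if ev h u = y then f u else 0) * (if ev h v = y then f v else 0))"
      unfolding g_alt power2_eq_square sum_product ..
    also have "\<dots> = (\<Sum>u\<in>X. \<Sum>v\<in>X. \<Sum>y\<in>Y. (if ev h u = y then f u else 0) * (if ev h v = y then f v else 0))"
      by (subst sum.swap) (intro sum.cong refl sum.swap)
    also have "\<dots> = (\<Sum>u\<in>X. \<Sum>v\<in>X. if ev h u = ev h v then f u * f v else 0)"
    proof (intro sum.cong refl)
      fix u v assume "u \<in> X" "v \<in> X"
      have "(\<Sum>y\<in>Y. (if ev h u = y then f u else 0) * (if ev h v = y then f v else 0))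
        = (\<Sum>y\<in>Y. if ev h u = y then (if ev h v = ev h u then f u * f v else 0) else 0)"
        by (intro sum.cong) auto
      also have "\<dots> = (if ev h u = ev h v then f u * f v else 0)"
        using fin ev[OF that \<open>u \<in> X\<close>] by (simp add: sum.delta')
      finally show "(\<Sum>y\<in>Y. (if ev h u = y then f u else 0) * (if ev h v = y then f v else 0))
        = (if ev h u = ev h v then f u * f v else 0)" .
    qed
    finally show ?thesis .
  qed
  have var: "(\<Sum>y\<in>Y. (g h y - ?M / ?c)\<^sup>2) = (\<Sum>y\<in>Y. (g h y)\<^sup>2) - ?M\<^sup>2 / ?c" if "h \<in> U" for h
  proof -
    have "(\<Sum>y\<in>Y. (g h y - ?M / ?c)\<^sup>2) = (\<Sum>y\<in>Y. (g h y)\<^sup>2 - 2 * (?M / ?c) * g h y + (?M / ?c)\<^sup>2)"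
      by (intro sum.cong) (auto simp: power2_diff algebra_simps)
    also have "\<dots> = (\<Sum>y\<in>Y. (g h y)\<^sup>2) - 2 * (?M / ?c) * ?M + ?c * (?M / ?c)\<^sup>2"
      by (simp only: sum.distrib sum_subtractf sum_g[OF that] sum_distrib_left[symmetric] sum_constant)
    also have "\<dots> = (\<Sum>y\<in>Y. (g h y)\<^sup>2) - ?M\<^sup>2 / ?c"
      using Y by (simp add: field_simps power2_eq_square)
    finally show ?thesis .
  qed
  have "(\<Sum>h\<in>U. \<Sum>y\<in>Y. (g h y)\<^sup>2) = (\<Sum>h\<in>U. \<Sum>u\<in>X. \<Sum>v\<in>X. if ev h u = ev h v then f u * f v else 0)"
    by (intro sum.cong refl sq)
  also have "\<dots> = (\<Sum>u\<in>X. \<Sum>v\<in>X. \<Sum>h\<in>U. if ev h u = ev h v then f u * f v else 0)"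
    by (subst sum.swap) (intro sum.cong refl sum.swap)
  also have "\<dots> \<le> (\<Sum>u\<in>X. \<Sum>v\<in>X. (if u = v then real (card U) * (f u * f v) else 0) + real (card U) / ?c * (f u * f v))"
  proof (intro sum_mono)
    fix u v assume uv: "u \<in> X" "v \<in> X"
    have nn: "0 \<le> f u * f v" using f uv by simp
    have "(\<Sum>h\<in>U. if ev h u = ev h v then f u * f v else 0) = real (card {h\<in>U. ev h u = ev h v}) * (f u * f v)"
      using fin by (simp flip: sum.inter_filter)
    also have "\<dots> \<le> (if u = v then real (card U) * (f u * f v) else 0) + real (card U) / ?c * (f u * f v)"
    proof (cases "u = v")
      case True
      then show ?thesis using nn by simp
    next
      case False
      have "real (card {h\<in>U. ev h u = ev h v}) * ?c = real (card U)"
        using pair[OF uv False] by (metis of_nat_mult)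
      then have "real (card {h\<in>U. ev h u = ev h v}) = real (card U) / ?c"
        using Y by (simp add: field_simps)
      with False show ?thesis by simp
    qed
    finally show "(\<Sum>h\<in>U. if ev h u = ev h v then f u * f v else 0)
      \<le> (if u = v then real (card U) * (f u * f v) else 0) + real (card U) / ?c * (f u * f v)" .
  qed
  also have "\<dots> = real (card U) * (\<Sum>u\<in>X. f u * f u) + real (card U) / ?c * ?M\<^sup>2"
  proof -
    have "(\<Sum>u\<in>X. \<Sum>v\<in>X. if u = v then real (card U) * (f u * f v) else 0) = real (card U) * (\<Sum>u\<in>X. f u * f u)"
      using fin by (simp add: sum.delta sum_distrib_left)
    moreover have "(\<Sum>u\<in>X. \<Sum>v\<in>X. real (card U) / ?c * (f u * f v)) = real (card U) / ?c * ?M\<^sup>2"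
      by (simp only: power2_eq_square sum_product) (simp only: sum_distrib_left)
    ultimately show ?thesis by (simp only: sum.distrib)
  qed
  also have "\<dots> \<le> real (card U) * (B * ?M) + real (card U) / ?c * ?M\<^sup>2"
    unfolding sum_distrib_left[of B]
    by (intro add_right_mono mult_left_mono sum_mono mult_right_mono) (use f in auto)
  finally have "(\<Sum>h\<in>U. \<Sum>y\<in>Y. (g h y)\<^sup>2) \<le> real (card U) * (B * ?M) + real (card U) / ?c * ?M\<^sup>2" .
  moreover have "(\<Sum>h\<in>U. \<Sum>y\<in>Y. (g h y - ?M / ?c)\<^sup>2) = (\<Sum>h\<in>U. \<Sum>y\<in>Y. (g h y)\<^sup>2) - real (card U) / ?c * ?M\<^sup>2"
    using var by (simp add: sum_subtractf)
  ultimately show ?thesis unfolding g_def by simp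
qed

lemma markov_count:
  fixes F :: "'x \<Rightarrow> real"
  assumes "finite X" "\<And>x. x \<in> X \<Longrightarrow> 0 \<le> F x" "0 < t" "(\<Sum>x\<in>X. F x) \<le> s * t"
  shows "real (card {x\<in>X. t \<le> F x}) \<le> s"
proof -
  have "real (card {x\<in>X. t \<le> F x}) * t = (\<Sum>x\<in>{x\<in>X. t \<le> F x}. t)" by simp
  also have "\<dots> \<le> (\<Sum>x\<in>{x\<in>X. t \<le> F x}. F x)" by (intro sum_mono) auto
  also have "\<dots> \<le> (\<Sum>x\<in>X. F x)" using assms by (intro sum_mono2) auto
  also have "\<dots> \<le> s * t" by fact
  finally show ?thesis using assms(3) by simp
qed

section \<open>Linear forms and kernels of random row tuples\<close>

definition dot :: "'a::comm_ring_1 ^ 'n \<Rightarrow> 'a ^ 'n \<Rightarrow> 'a" where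
  "dot h u = (\<Sum>i\<in>UNIV. h $ i * u $ i)"

lemma dot_simps:
  "dot (h + h') u = dot h u + dot h' u" "dot (h - h') u = dot h u - dot h' u"
  "dot h (u + v) = dot h u + dot h v" "dot h (u - v) = dot h u - dot h v"
  "dot (c *s h) u = c * dot h u" "dot h (c *s u) = c * dot h u" "dot h 0 = 0"
  by (simp_all add: dot_def sum.distrib sum_subtractf algebra_simps sum_distrib_left)

text \<open>Moving along an axis on which \<open>w\<close> is nonzero carries each fibre of the form
  onto any other, so all fibres have equal size.\<close>

lemma card_dot_eq:
  fixes w :: "'a::{field,finite} ^ 'n"
  assumes "w \<noteq> 0"
  shows "card {h. dot h w = c} * CARD('a) = CARD('a ^ 'n)"
proof -
  obtain j where j: "w $ j \<noteq> 0" using assms by (metis vec_eq_iff zero_index)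
  have ax: "dot (axis j 1) w = w $ j"
    unfolding dot_def axis_def by (subst sum.remove[of _ j]) auto
  have eq: "card {h. dot h w = c'} = card {h. dot h w = c}" for c'
  proof (rule bij_betw_same_card)
    show "bij_betw (\<lambda>h. h + ((c - c') / w $ j) *s axis j 1) {h. dot h w = c'} {h. dot h w = c}"
      by (rule bij_betwI[of _ _ _ "\<lambda>h. h - ((c - c') / w $ j) *s axis j 1"])
        (use j in \<open>auto simp: dot_simps ax\<close>)
  qed
  have "(\<Sum>c'\<in>UNIV. card {h. dot h w = c'}) = (\<Sum>c'\<in>(UNIV::'a set). card {h. dot h w = c})"
    by (intro sum.cong refl eq)
  moreover have "(\<Sum>c'\<in>UNIV. card {h. dot h w = c'}) = card (\<Union>c'\<in>UNIV. {h. dot h w = c'})"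
    by (rule card_UN_disjoint[symmetric]) auto
  moreover have "(\<Union>c'\<in>UNIV. {h. dot h w = c'}) = UNIV" by auto
  ultimately show ?thesis by simp
qed

lemma card_subspace:
  fixes S :: "('a::{field,finite} ^ 'n) set"
  assumes "vec.subspace S"
  shows "card S = CARD('a) ^ vec.dim S"
proof -
  obtain B where B: "B \<subseteq> S" "vec.independent B" "S \<subseteq> vec.span B" "card B = vec.dim S"
    by (rule vec.basis_exists)
  have fin: "finite B" by simp
  have span: "vec.span B = S" by (rule subset_antisym[OF vec.span_minimal[OF B(1) assms] B(3)])
  let ?F = "\<lambda>c. \<Sum>b\<in>B. c b *s b"
  have inj: "inj_on ?F (B \<rightarrow>\<^sub>E UNIV)"
  proof (rule inj_onI)
    fix c d assume c: "c \<in> B \<rightarrow>\<^sub>E UNIV" "d \<in> B \<rightarrow>\<^sub>E UNIV" and eq: "?F c = ?F d"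
    have "(\<Sum>b\<in>B. (c b - d b) *s b) = 0"
      using eq by (simp add: vec.scale_left_diff_distrib sum_subtractf)
    with vec.independent_explicit_finite_subsets[THEN iffD1, OF B(2), rule_format, of B "\<lambda>b. c b - d b"]
    have "c b = d b" if "b \<in> B" for b using fin that by simp
    then show "c = d" by (rule PiE_ext[OF c])
  qed
  have im: "?F ` (B \<rightarrow>\<^sub>E UNIV) = S"
  proof -
    have "?F ` (B \<rightarrow>\<^sub>E UNIV) = range ?F"
    proof (intro equalityI subsetI)
      fix x assume "x \<in> range ?F"
      then obtain c where "x = ?F c" by blast
      also have "\<dots> = ?F (restrict c B)" by (intro sum.cong) auto
      finally show "x \<in> ?F ` (B \<rightarrow>\<^sub>E UNIV)" by (intro image_eqI[where x = "restrict c B"]) auto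
    qed auto
    then show ?thesis using vec.span_finite[OF fin] span by simp
  qed
  have "card S = card (B \<rightarrow>\<^sub>E (UNIV :: 'a set))" using card_image[OF inj] unfolding im .
  then show ?thesis using B(4) fin by (simp add: card_PiE)
qed

definition ker :: "nat \<Rightarrow> (nat \<Rightarrow> 'a::comm_ring_1 ^ 'n) \<Rightarrow> ('a ^ 'n) set" where
  "ker k A = {u. \<forall>i<k. dot (A i) u = 0}"

lemma subspace_ker: "vec.subspace (ker k A)" for A :: "nat \<Rightarrow> 'a::field ^ 'n"
  unfolding ker_def by (intro vec.subspaceI) (auto simp: dot_simps)

abbreviation row_tuples :: "nat \<Rightarrow> (nat \<Rightarrow> 'a ^ 'n) set" where
  "row_tuples k \<equiv> {..<k} \<rightarrow>\<^sub>E UNIV"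

text \<open>The general linear group acts transitively on the subspaces of a given dimension.\<close>

lemma card_rows_ker_le:
  fixes S S' :: "('a::{field,finite} ^ 'n) set"
  assumes "vec.subspace S" "vec.subspace S'" "vec.dim S = vec.dim S'"
  shows "card {A \<in> row_tuples k. ker k A = S'} \<le> card {A \<in> row_tuples k. ker k A = S}"
proof -
  obtain B where B: "B \<subseteq> S" "vec.independent B" "S \<subseteq> vec.span B" "card B = vec.dim S"
    by (rule vec.basis_exists)
  obtain B' where B': "B' \<subseteq> S'" "vec.independent B'" "S' \<subseteq> vec.span B'" "card B' = vec.dim S'"
    by (rule vec.basis_exists)
  obtain f where f: "bij_betw f B B'"
    using finite_same_card_bij[of B B'] B B' assms(3) by auto
  obtain g where g: "Vector_Spaces.linear (*s) (*s) g" "inj g" "\<And>x. x \<in> B \<Longrightarrow> g x = f x"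
  proof -
    have "vec.independent (f ` B)" "inj_on f B" using f B'(2) unfolding bij_betw_def by auto
    from vec.linear_independent_extend_inj[OF B(2) this] show thesis using that by blast
  qed
  interpret g: Vector_Spaces.linear "(*s)" "(*s)" g by (rule g(1))
  have "g ` B = B'" using g(3) f unfolding bij_betw_def by auto
  then have gS: "g ` S = S'"
  proof -
    have "vec.span B = S" by (rule subset_antisym[OF vec.span_minimal[OF B(1) assms(1)] B(3)])
    moreover have "vec.span B' = S'" by (rule subset_antisym[OF vec.span_minimal[OF B'(1) assms(2)] B'(3)])
    moreover note \<open>g ` B = B'\<close>
    ultimately show ?thesis using g.span_image[of B] by simp
  qed
  have "surj g" using g(2) by (simp add: finite_UNIV_inj_surj)
  \<comment> \<open>The transpose of \<open>g\<close> with respect to \<open>dot\<close>; it is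
    injective because \<open>g\<close> is onto.\<close>
  define adj where "adj h = (\<chi> i. dot h (g (axis i 1)))" for h
  have adj: "dot (adj h) u = dot h (g u)" for h u
  proof -
    have "g (\<Sum>i\<in>UNIV. u $ i *s axis i 1) = (\<Sum>i\<in>UNIV. u $ i *s g (axis i 1))"
      by (simp only: g.sum g.scale)
    then have "g u = (\<Sum>i\<in>UNIV. u $ i *s g (axis i 1))" by (simp only: basis_expansion)
    moreover have "dot h (\<Sum>i\<in>I. x i) = (\<Sum>i\<in>I. dot h (x i))" for I :: "'n set" and x
      by (induction I rule: infinite_finite_induct) (auto simp: dot_simps)
    ultimately show ?thesis by (simp add: adj_def dot_simps) (simp add: dot_def mult.commute)
  qed
  have "inj adj"
  proof (rule injI)
    fix h h' assume "adj h = adj h'"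
    then have "dot h (g u) = dot h' (g u)" for u using adj[of h u] adj[of h' u] by simp
    then have eq: "dot h v = dot h' v" for v using surjD[OF \<open>surj g\<close>, of v] by blast
    have "h $ i = h' $ i" for i
      using eq[of "axis i 1"] by (simp add: dot_def axis_def if_distrib cong: if_cong)
    then show "h = h'" by (simp add: vec_eq_iff)
  qed
  define F where "F A = (\<lambda>i\<in>{..<k}. adj (A i))" for A
  have kerF: "ker k (F A) = g -` ker k A" for A
    unfolding F_def ker_def by (auto simp: adj)
  show ?thesis
  proof (rule card_inj_on_le)
    show "inj_on F {A \<in> row_tuples k. ker k A = S'}"
    proof (rule inj_onI)
      fix A A' assume AA: "A \<in> {A \<in> row_tuples k. ker k A = S'}" "A' \<in> {A \<in> row_tuples k. ker k A = S'}" "F A = F A'"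
      have "A i = A' i" if "i \<in> {..<k}" for i
        using fun_cong[OF AA(3), of i] that \<open>inj adj\<close> unfolding F_def by (simp add: inj_eq)
      moreover have "A \<in> row_tuples k" "A' \<in> row_tuples k" using AA(1,2) by blast+
      ultimately show "A = A'" by (intro PiE_ext)
    qed
    show "F ` {A \<in> row_tuples k. ker k A = S'} \<subseteq> {A \<in> row_tuples k. ker k A = S}"
    proof
      fix D assume "D \<in> F ` {A \<in> row_tuples k. ker k A = S'}"
      then obtain A where A: "D = F A" "ker k A = S'" by blast
      have "g -` S' = S" using gS g(2) by (metis inj_vimage_image_eq)
      with A kerF have "ker k D = S" by simp
      moreover have "D \<in> row_tuples k" unfolding A(1) F_def by simp
      ultimately show "D \<in> {A \<in> row_tuples k. ker k A = S}" by simp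
    qed
    show "finite {A \<in> row_tuples k. ker k A = S}"
      by (rule finite_subset[of _ "row_tuples k"]) (auto intro: finite_PiE)
  qed
qed

text \<open>Rank-nullity by counting: a fibre of the evaluation map injects into the kernel by
  translation, and there are at most q^k values.\<close>

lemma card_ker_ge:
  fixes A :: "nat \<Rightarrow> 'a::{field,finite} ^ 'n"
  shows "CARD('a) ^ CARD('n) \<le> card (ker k A) * CARD('a) ^ k"
proof -
  define ev where "ev u = (\<lambda>i\<in>{..<k}. dot (A i) u)" for u
  define Y where "Y = {..<k} \<rightarrow>\<^sub>E (UNIV :: 'a set)"
  have finY: "finite Y" unfolding Y_def by (intro finite_PiE) auto
  have fib: "card {u. ev u = y} \<le> card (ker k A)" for y
  proof (cases "\<exists>u0. ev u0 = y")
    case True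
    then obtain u0 where u0: "ev u0 = y" ..
    show ?thesis
    proof (rule card_inj_on_le[of "\<lambda>u. u - u0"])
      show "(\<lambda>u. u - u0) ` {u. ev u = y} \<subseteq> ker k A"
      proof
        fix v assume "v \<in> (\<lambda>u. u - u0) ` {u. ev u = y}"
        then obtain u where u: "v = u - u0" "ev u = y" by blast
        show "v \<in> ker k A"
          unfolding ker_def
        proof (clarify)
          fix i assume "i < k"
          have "ev u i = ev u0 i" using u(2) u0 by simp
          with \<open>i < k\<close> show "dot (A i) v = 0" unfolding ev_def u(1) by (simp add: dot_simps)
        qed
      qed
    qed (auto simp: inj_on_def)
  qed auto
  have "CARD('a ^ 'n) = card (\<Union>y\<in>Y. {u. ev u = y})"
    by (rule arg_cong[of _ _ card]) (auto simp: Y_def ev_def)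
  also have "\<dots> \<le> (\<Sum>y\<in>Y. card {u. ev u = y})" using finY by (rule card_UN_le)
  also have "\<dots> \<le> (\<Sum>y\<in>Y. card (ker k A))" by (intro sum_mono fib)
  also have "\<dots> = card (ker k A) * CARD('a) ^ k" by (simp add: Y_def card_PiE)
  finally show ?thesis by (simp add: CARD_vec)
qed

text \<open>A first moment argument. A nonzero vector lies in a random kernel with probability q^-k,
  so kernels have on average at most q^(n-k) + 1 elements. Each has at least q^(n-k), and a
  degenerate one at least twice as many. So the degenerate share is at most q^-(n-k), hence at most
  1/2.\<close>

lemma card_rows_degenerate_le:
  assumes k: "k < CARD('n)"
  shows "2 * card {A \<in> row_tuples k :: (nat \<Rightarrow> 'a::{field,finite} ^ 'n) set. vec.dim (ker k A) \<noteq> CARD('n) - k}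
    \<le> card (row_tuples k :: (nat \<Rightarrow> 'a ^ 'n) set)"
proof -
  let ?R = "row_tuples k :: (nat \<Rightarrow> 'a ^ 'n) set"
  let ?D = "{A \<in> ?R. vec.dim (ker k A) \<noteq> CARD('n) - k}"
  let ?q = "CARD('a)" and ?t = "CARD('a) ^ (CARD('n) - k)"
  have "card {0::'a, 1} \<le> ?q" by (intro card_mono) auto
  then have q: "2 \<le> ?q" by simp
  have finR: "finite ?R" by (intro finite_PiE) auto
  have Q: "?q ^ CARD('n) = ?t * ?q ^ k" using k by (simp flip: power_add)
  have t2: "2 \<le> ?t" using q k self_le_power[of ?q "CARD('n) - k"] by linarith
  have ge: "?t \<le> card (ker k A)" for A :: "nat \<Rightarrow> 'a ^ 'n"
  proof -
    have "?t * ?q ^ k \<le> card (ker k A) * ?q ^ k" using card_ker_ge[of k A] unfolding Q .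
    then show ?thesis by (rule mult_right_le_imp_le) (use q in simp)
  qed
  have big: "?t + ?t \<le> card (ker k A)" if "A \<in> ?D" for A
  proof -
    have c: "card (ker k A) = ?q ^ vec.dim (ker k A)" by (rule card_subspace[OF subspace_ker])
    have "?t \<le> ?q ^ vec.dim (ker k A)" using ge[of A] unfolding c .
    then have "CARD('n) - k \<le> vec.dim (ker k A)"
      by (rule power_le_imp_le_exp[rotated]) (use q in simp)
    moreover have "vec.dim (ker k A) \<noteq> CARD('n) - k" using that by blast
    ultimately have "Suc (CARD('n) - k) \<le> vec.dim (ker k A)" by linarith
    then have "?q ^ Suc (CARD('n) - k) \<le> card (ker k A)" unfolding c
      by (rule power_increasing) (use q in simp)
    moreover have "2 * ?t \<le> ?q * ?t" using q by (intro mult_right_mono) auto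
    ultimately show ?thesis unfolding power_Suc by linarith
  qed
  have count: "card {A \<in> ?R. u \<in> ker k A} * ?q ^ k = card ?R" if "u \<noteq> 0" for u :: "'a ^ 'n"
  proof -
    have "{A \<in> ?R. u \<in> ker k A} = {..<k} \<rightarrow>\<^sub>E {h. dot h u = 0}"
      unfolding ker_def by (auto simp: PiE_def Pi_def)
    then have "card {A \<in> ?R. u \<in> ker k A} * ?q ^ k = (card {h. dot h u = 0} * ?q) ^ k"
      by (simp add: card_PiE power_mult_distrib)
    also have "\<dots> = card ?R" unfolding card_dot_eq[OF that] by (simp add: card_PiE)
    finally show ?thesis .
  qed
  have "(\<Sum>A\<in>?R. card (ker k A)) = (\<Sum>A\<in>?R. \<Sum>u\<in>UNIV. if u \<in> ker k A then 1 else 0)"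
    by (simp flip: sum.inter_filter card_eq_sum)
  also have "\<dots> = (\<Sum>u\<in>UNIV. \<Sum>A\<in>?R. if u \<in> ker k A then 1 else 0)" by (rule sum.swap)
  also have "\<dots> = (\<Sum>u\<in>UNIV. card {A \<in> ?R. u \<in> ker k A})"
    using finR by (simp flip: sum.inter_filter card_eq_sum)
  finally have sum1: "(\<Sum>A\<in>?R. card (ker k A)) = (\<Sum>u\<in>UNIV. card {A \<in> ?R. u \<in> ker k A})" .
  have "(\<Sum>u\<in>UNIV. card {A \<in> ?R. u \<in> ker k A}) * ?q ^ k
      = card {A \<in> ?R. 0 \<in> ker k A} * ?q ^ k + (\<Sum>u\<in>UNIV - {0}. card {A \<in> ?R. u \<in> ker k A} * ?q ^ k)"
    by (subst sum.remove[of _ "0::'a ^ 'n"]) (simp_all add: distrib_right sum_distrib_right)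
  moreover have "(\<Sum>u\<in>UNIV - {0}. card {A \<in> ?R. u \<in> ker k A} * ?q ^ k) = (\<Sum>u\<in>UNIV - {0::'a ^ 'n}. card ?R)"
    by (intro sum.cong refl count) simp
  moreover have "(\<Sum>u\<in>UNIV - {0::'a ^ 'n}. card ?R) \<le> card ?R * (?t * ?q ^ k)"
  proof -
    have "card (UNIV - {0::'a ^ 'n}) \<le> ?t * ?q ^ k"
      using card_Diff1_le[of UNIV "0::'a ^ 'n"] unfolding Q[symmetric] by (simp add: CARD_vec)
    then have "card (UNIV - {0::'a ^ 'n}) * card ?R \<le> ?t * ?q ^ k * card ?R" by (rule mult_right_mono) simp
    then show ?thesis by (simp only: sum_constant of_nat_id mult.commute)
  qed
  moreover have "card {A \<in> ?R. 0 \<in> ker k A} * ?q ^ k \<le> card ?R * ?q ^ k"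
    by (intro mult_right_mono card_mono finR) auto
  ultimately have "(\<Sum>u\<in>UNIV. card {A \<in> ?R. u \<in> ker k A}) * ?q ^ k \<le> card ?R * ?q ^ k + card ?R * (?t * ?q ^ k)"
    by linarith
  then have "(\<Sum>A\<in>?R. card (ker k A)) * ?q ^ k \<le> (card ?R + card ?R * ?t) * ?q ^ k"
    by (simp only: sum1 distrib_right mult.assoc)
  then have up: "(\<Sum>A\<in>?R. card (ker k A)) \<le> card ?R + card ?R * ?t"
    by (rule mult_right_le_imp_le) (use q in simp)
  have "card ?R * ?t + card ?D * ?t = (\<Sum>A\<in>?R. ?t + (if A \<in> ?D then ?t else 0))"
    using finR by (simp add: sum.distrib flip: sum.inter_filter)
  also have "\<dots> \<le> (\<Sum>A\<in>?R. card (ker k A))" using ge big by (intro sum_mono) auto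
  finally have "card ?D * ?t \<le> card ?R" using up by simp
  moreover have "card ?D * 2 \<le> card ?D * ?t" using t2 by (intro mult_left_mono) auto
  ultimately show ?thesis by linarith
qed

section \<open>Linear hashing with a uniform guarantee\<close>

text \<open>The rows \<open>A\<close> label the cosets of the subspace they cut out, and
  \<open>h\<close>, \<open>h'\<close> refine these labels. In the space of labels, of dimension
  \<open>k + 2\<close>, a coset of \<open>ker k A\<close> becomes a plane on which only the last two
  entries vary.\<close>

definition hash :: "nat \<Rightarrow> (nat \<Rightarrow> 'a::comm_ring_1 ^ 'n) \<Rightarrow> 'a ^ 'n \<Rightarrow> 'a ^ 'n \<Rightarrow> 'a ^ 'n \<Rightarrow> nat \<Rightarrow> 'a" where
  "hash k A h h' u =
    (\<lambda>i\<in>{..<k+2}. if i < k then dot (A i) u else if i = k then dot h u else dot h' u)"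

definition bucket :: "nat \<Rightarrow> ('a ^ 'n \<Rightarrow> real) \<Rightarrow> (nat \<Rightarrow> 'a::{field,finite} ^ 'n) \<Rightarrow> 'a ^ 'n \<Rightarrow> 'a ^ 'n \<Rightarrow> (nat \<Rightarrow> 'a) \<Rightarrow> real" where
  "bucket k f A h h' y = (\<Sum>u | hash k A h h' u = y. f u)"

definition exceptional :: "nat \<Rightarrow> ('a ^ 'n \<Rightarrow> real) \<Rightarrow> real \<Rightarrow> real \<Rightarrow> (nat \<Rightarrow> 'a::{field,finite} ^ 'n) \<Rightarrow> 'a ^ 'n \<Rightarrow> 'a ^ 'n \<Rightarrow> (nat \<Rightarrow> 'a) set" where
  "exceptional k f \<mu> t A h h' = {y \<in> {..<k+2} \<rightarrow>\<^sub>E UNIV. t \<le> \<bar>bucket k f A h h' y - \<mu>\<bar>}"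

lemma finite_exceptional: "finite (exceptional k f \<mu> t A h h')"
  unfolding exceptional_def by (rule finite_subset[of _ "{..<k+2} \<rightarrow>\<^sub>E UNIV"]) (auto intro: finite_PiE)

text \<open>Vectors collide exactly when all \<open>k + 2\<close> forms annihilate their difference.
  The forms are independent and uniform, with degenerate tuples included, which makes the count an
  exact power.\<close>

lemma hash_collision:
  fixes u v :: "'a::{field,finite} ^ 'n"
  assumes "u \<noteq> v"
  shows "card {\<omega> \<in> row_tuples k \<times> UNIV \<times> UNIV. (case \<omega> of (A, h, h') \<Rightarrow> hash k A h h') u = (case \<omega> of (A, h, h') \<Rightarrow> hash k A h h') v}
      * card ({..<k+2} \<rightarrow>\<^sub>E (UNIV :: 'a set))
    = card ((row_tuples k :: (nat \<Rightarrow> 'a ^ 'n) set) \<times> (UNIV :: ('a ^ 'n) set) \<times> (UNIV :: ('a ^ 'n) set))"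
proof -
  define K where "K = {h. dot h (u - v) = 0}"
  have K: "card K * CARD('a) = CARD('a ^ 'n)" unfolding K_def using assms by (intro card_dot_eq) simp
  have eq: "hash k A h h' u = hash k A h h' v \<longleftrightarrow> (\<forall>i<k. A i \<in> K) \<and> h \<in> K \<and> h' \<in> K" for A h h'
  proof
    assume e: "hash k A h h' u = hash k A h h' v"
    have "hash k A h h' u i = hash k A h h' v i" for i using e by simp
    note * = this[unfolded hash_def]
    have "A i \<in> K" if "i < k" for i using *[of i] that unfolding K_def by (simp add: dot_simps)
    moreover have "h \<in> K" using *[of k] unfolding K_def by (simp add: dot_simps)
    moreover have "h' \<in> K" using *[of "Suc k"] unfolding K_def by (simp add: dot_simps)
    ultimately show "(\<forall>i<k. A i \<in> K) \<and> h \<in> K \<and> h' \<in> K" by blast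
  next
    assume "(\<forall>i<k. A i \<in> K) \<and> h \<in> K \<and> h' \<in> K"
    then show "hash k A h h' u = hash k A h h' v"
      unfolding hash_def K_def by (intro restrict_ext) (simp add: dot_simps)
  qed
  have "{\<omega> \<in> row_tuples k \<times> UNIV \<times> UNIV. (case \<omega> of (A, h, h') \<Rightarrow> hash k A h h') u = (case \<omega> of (A, h, h') \<Rightarrow> hash k A h h') v}
      = ({..<k} \<rightarrow>\<^sub>E K) \<times> K \<times> K"
    by (auto simp: eq PiE_def Pi_def)
  then have "card {\<omega> \<in> row_tuples k \<times> UNIV \<times> UNIV. (case \<omega> of (A, h, h') \<Rightarrow> hash k A h h') u = (case \<omega> of (A, h, h') \<Rightarrow> hash k A h h') v}
      = card K ^ (k + 2)"
    by (simp add: card_cartesian_product card_PiE power2_eq_square mult_ac)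
  moreover have "card ({..<k+2} \<rightarrow>\<^sub>E (UNIV :: 'a set)) = CARD('a) ^ (k + 2)" by (simp only: card_PiE finite_lessThan prod_constant card_lessThan)
  moreover have "card ((row_tuples k :: (nat \<Rightarrow> 'a ^ 'n) set) \<times> (UNIV :: ('a ^ 'n) set) \<times> (UNIV :: ('a ^ 'n) set)) = CARD('a ^ 'n) ^ (k + 2)"
    by (simp add: card_cartesian_product card_PiE power2_eq_square mult_ac del: CARD_vec)
  moreover have "card K ^ (k + 2) * CARD('a) ^ (k + 2) = CARD('a ^ 'n) ^ (k + 2)"
    unfolding power_mult_distrib[symmetric] K ..
  ultimately show ?thesis by (simp only:)
qed

text \<open>Chebyshev, averaged over the hash functions: each exceptional bucket contributes at
  least the square of \<open>t\<close> to the second moment.\<close>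

lemma sum_card_exceptional_le:
  fixes f :: "'a::{field,finite} ^ 'n \<Rightarrow> real" and k :: nat
  defines "\<mu> \<equiv> sum f UNIV / real CARD('a) ^ (k + 2)"
  assumes f: "\<And>u. 0 \<le> f u \<and> f u \<le> B" and t: "0 \<le> t"
  shows "(\<Sum>(A, h, h')\<in>(row_tuples k :: (nat \<Rightarrow> 'a ^ 'n) set) \<times> UNIV \<times> UNIV. real (card (exceptional k f \<mu> t A h h'))) * t\<^sup>2
    \<le> real (card ((row_tuples k :: (nat \<Rightarrow> 'a ^ 'n) set) \<times> (UNIV :: ('a ^ 'n) set) \<times> (UNIV :: ('a ^ 'n) set))) * B * sum f UNIV"
proof -
  let ?\<Omega> = "(row_tuples k :: (nat \<Rightarrow> 'a ^ 'n) set) \<times> (UNIV :: ('a ^ 'n) set) \<times> (UNIV :: ('a ^ 'n) set)"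
  let ?Y = "{..<k+2} \<rightarrow>\<^sub>E (UNIV :: 'a set)"
  let ?ev = "\<lambda>\<omega> :: (nat \<Rightarrow> 'a ^ 'n) \<times> ('a ^ 'n) \<times> ('a ^ 'n). case \<omega> of (A, h, h') \<Rightarrow> hash k A h h'"
  have finY: "finite ?Y" by (intro finite_PiE) auto
  have cY: "card ?Y = CARD('a) ^ (k + 2)" by (simp only: card_PiE finite_lessThan prod_constant card_lessThan)
  have fin\<Omega>: "finite ?\<Omega>" by (intro finite_cartesian_product finite_PiE) auto
  have "(\<Sum>\<omega>\<in>?\<Omega>. \<Sum>y\<in>?Y. ((\<Sum>u | u \<in> UNIV \<and> ?ev \<omega> u = y. f u) - sum f UNIV / real (card ?Y))\<^sup>2)
      \<le> real (card ?\<Omega>) * B * sum f UNIV"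
  proof (rule pairwise_independent_variance)
    show "?ev \<omega> u \<in> ?Y" for \<omega> u by (cases \<omega>) (simp add: hash_def)
    show "card {\<omega> \<in> ?\<Omega>. ?ev \<omega> u = ?ev \<omega> v} * card ?Y = card ?\<Omega>" if "u \<noteq> v" for u v
      by (rule hash_collision[OF that])
  qed (use f finY fin\<Omega> cY in auto)
  moreover have "real (card (exceptional k f \<mu> t A h h')) * t\<^sup>2
     \<le> (\<Sum>y\<in>?Y. ((\<Sum>u | u \<in> UNIV \<and> ?ev (A, h, h') u = y. f u) - sum f UNIV / real (card ?Y))\<^sup>2)" for A h h'
  proof -
    have "real (card (exceptional k f \<mu> t A h h')) * t\<^sup>2 = (\<Sum>y\<in>exceptional k f \<mu> t A h h'. t\<^sup>2)" by simp
    also have "\<dots> \<le> (\<Sum>y\<in>exceptional k f \<mu> t A h h'. (bucket k f A h h' y - \<mu>)\<^sup>2)"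
    proof (rule sum_mono)
      fix y assume "y \<in> exceptional k f \<mu> t A h h'"
      then have "t \<le> \<bar>bucket k f A h h' y - \<mu>\<bar>" unfolding exceptional_def by simp
      then have "t\<^sup>2 \<le> \<bar>bucket k f A h h' y - \<mu>\<bar>\<^sup>2" using t by (rule power_mono)
      then show "t\<^sup>2 \<le> (bucket k f A h h' y - \<mu>)\<^sup>2" by simp
    qed
    also have "\<dots> \<le> (\<Sum>y\<in>?Y. (bucket k f A h h' y - \<mu>)\<^sup>2)"
      using finY by (intro sum_mono2) (auto simp: exceptional_def)
    also have "\<dots> = (\<Sum>y\<in>?Y. ((\<Sum>u | u \<in> UNIV \<and> ?ev (A, h, h') u = y. f u) - sum f UNIV / real (card ?Y))\<^sup>2)"
      unfolding \<mu>_def bucket_def cY by simp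
    finally show ?thesis .
  qed
  then have "(\<Sum>\<omega>\<in>?\<Omega>. (case \<omega> of (A, h, h') \<Rightarrow> real (card (exceptional k f \<mu> t A h h'))) * t\<^sup>2)
     \<le> (\<Sum>\<omega>\<in>?\<Omega>. \<Sum>y\<in>?Y. ((\<Sum>u | u \<in> UNIV \<and> ?ev \<omega> u = y. f u) - sum f UNIV / real (card ?Y))\<^sup>2)"
    by (intro sum_mono) (auto split: prod.splits)
  ultimately show ?thesis unfolding sum_distrib_right by linarith
qed

text \<open>Inside an unbalanced coset \<open>C\<close> the buckets concentrate around their own
  mean \<open>m\<close>, whose distance \<open>dev\<close> from \<mu> is at least (\<epsilon>/2)
  \<mu>. A bucket that is not exceptional is at least \<open>dev / 2\<close> away from
  \<open>m\<close>, and the second moment inside \<open>C\<close> makes such buckets rare.\<close>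

lemma unbalanced_fibre:
  fixes f :: "'a::{field,finite} ^ 'n \<Rightarrow> real" and x :: "nat \<Rightarrow> 'a" and k :: nat and A :: "nat \<Rightarrow> 'a ^ 'n"
  defines "q \<equiv> real CARD('a)"
  defines "C \<equiv> {u. \<forall>i<k. dot (A i) u = x i}"
  assumes f: "\<And>u. 0 \<le> f u \<and> f u \<le> B" and B: "2 * q * B \<le> \<mu>" "0 < \<mu>"
    and \<epsilon>: "0 < \<epsilon>" "\<epsilon> < 1" and q: "1024 * n \<le> \<epsilon>\<^sup>2 * q" "0 < n"
    and unbalanced: "\<epsilon> / 2 * (\<mu> * q\<^sup>2) \<le> \<bar>sum f C - \<mu> * q\<^sup>2\<bar>"
  shows "real (card (UNIV :: (('a ^ 'n) \<times> ('a ^ 'n)) set)) / 2 \<le>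
    real (card {(h, h'). (1 - 1 / (32 * n)) * q\<^sup>2 \<le>
      real (card {(y, z). plane_point k x (\<lambda>_. 0) (\<lambda>_. 0) y z \<in> exceptional k f \<mu> (\<epsilon> / 4 * \<mu>) A h h'})})"
proof -
  let ?E = "\<lambda>\<omega> :: ('a ^ 'n) \<times> ('a ^ 'n). {(y, z). plane_point k x (\<lambda>_. 0) (\<lambda>_. 0) y z \<in> exceptional k f \<mu> (\<epsilon> / 4 * \<mu>) A (fst \<omega>) (snd \<omega>)}"
  let ?W = "UNIV :: (('a ^ 'n) \<times> ('a ^ 'n)) set"
  let ?ev = "\<lambda>\<omega> u. (dot (fst \<omega>) u, dot (snd \<omega>) u)"
  have q0: "0 < q" unfolding q_def by simp
  define m where "m = sum f C / q\<^sup>2"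
  define dev where "dev = \<bar>m - \<mu>\<bar>"
  have cY: "real (card (UNIV :: ('a \<times> 'a) set)) = q\<^sup>2"
    unfolding q_def by (simp add: power2_eq_square)
  have dev: "\<epsilon> / 2 * \<mu> \<le> dev"
  proof -
    have "\<bar>sum f C - \<mu> * q\<^sup>2\<bar> = dev * q\<^sup>2"
    proof -
      have "sum f C - \<mu> * q\<^sup>2 = (m - \<mu>) * q\<^sup>2" unfolding m_def using q0 by (simp add: left_diff_distrib)
      then show ?thesis unfolding dev_def by (simp add: abs_mult)
    qed
    with unbalanced have "\<epsilon> / 2 * \<mu> * q\<^sup>2 \<le> dev * q\<^sup>2" by simp
    then show ?thesis using q0 by (simp add: mult_le_cancel_right_pos)
  qed
  have dev0: "0 < dev" using dev \<epsilon> B(2) by (smt (verit) divide_pos_pos mult_pos_pos)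
  have var: "(\<Sum>\<omega>\<in>?W. \<Sum>y\<in>UNIV. ((\<Sum>u | u \<in> C \<and> ?ev \<omega> u = y. f u) - sum f C / real (card (UNIV :: ('a \<times> 'a) set)))\<^sup>2)
      \<le> real (card ?W) * B * sum f C"
  proof (rule pairwise_independent_variance)
    fix u v :: "'a ^ 'n" assume "u \<noteq> v"
    define K where "K = {h. dot h (u - v) = 0}"
    have K: "card K * CARD('a) = CARD('a ^ 'n)" unfolding K_def using \<open>u \<noteq> v\<close> by (intro card_dot_eq) simp
    have "{\<omega>\<in>?W. ?ev \<omega> u = ?ev \<omega> v} = K \<times> K" unfolding K_def by (auto simp: dot_simps)
    then have "card {\<omega>\<in>?W. ?ev \<omega> u = ?ev \<omega> v} * card (UNIV :: ('a \<times> 'a) set) = (card K * CARD('a)) * (card K * CARD('a))"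
      by (simp add: card_cartesian_product)
    also have "\<dots> = card ?W" unfolding K by (simp del: CARD_vec)
    finally show "card {\<omega>\<in>?W. ?ev \<omega> u = ?ev \<omega> v} * card (UNIV :: ('a \<times> 'a) set) = card ?W" .
  qed (use f in auto)
  have bucket: "bucket k f A (fst \<omega>) (snd \<omega>) (plane_point k x (\<lambda>_. 0) (\<lambda>_. 0) y z) = (\<Sum>u | u \<in> C \<and> ?ev \<omega> u = (y, z). f u)"
    for \<omega> y z
    unfolding bucket_def
  proof (intro sum.cong refl Collect_cong)
    fix u
    show "hash k A (fst \<omega>) (snd \<omega>) u = plane_point k x (\<lambda>_. 0) (\<lambda>_. 0) y z \<longleftrightarrow> u \<in> C \<and> ?ev \<omega> u = (y, z)"
    proof
      assume e: "hash k A (fst \<omega>) (snd \<omega>) u = plane_point k x (\<lambda>_. 0) (\<lambda>_. 0) y z"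
      have "hash k A (fst \<omega>) (snd \<omega>) u i = plane_point k x (\<lambda>_. 0) (\<lambda>_. 0) y z i" for i using e by simp
      note * = this[unfolded hash_def plane_point_def]
      have "dot (A i) u = x i" if "i < k" for i using *[of i] that by simp
      moreover have "dot (fst \<omega>) u = y" "dot (snd \<omega>) u = z" using *[of k] *[of "Suc k"] by simp_all
      ultimately show "u \<in> C \<and> ?ev \<omega> u = (y, z)" unfolding C_def by simp
    next
      assume "u \<in> C \<and> ?ev \<omega> u = (y, z)"
      then show "hash k A (fst \<omega>) (snd \<omega>) u = plane_point k x (\<lambda>_. 0) (\<lambda>_. 0) y z"
        unfolding hash_def plane_point_def C_def by (intro restrict_ext) auto
    qed
  qed
  have each: "real (card (- ?E \<omega>)) * (dev / 2)\<^sup>2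
      \<le> (\<Sum>y\<in>UNIV. ((\<Sum>u | u \<in> C \<and> ?ev \<omega> u = y. f u) - sum f C / real (card (UNIV :: ('a \<times> 'a) set)))\<^sup>2)" for \<omega>
  proof -
    have "real (card (- ?E \<omega>)) * (dev / 2)\<^sup>2 = (\<Sum>y\<in>- ?E \<omega>. (dev / 2)\<^sup>2)" by simp
    also have "\<dots> \<le> (\<Sum>y\<in>- ?E \<omega>. ((\<Sum>u | u \<in> C \<and> ?ev \<omega> u = y. f u) - m)\<^sup>2)"
    proof (rule sum_mono)
      fix p assume p: "p \<in> - ?E \<omega>"
      obtain y z where yz: "p = (y, z)" by (cases p)
      have "plane_point k x (\<lambda>_. 0) (\<lambda>_. 0) y z \<in> {..<k+2} \<rightarrow>\<^sub>E UNIV" unfolding plane_point_def by simp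
      with p have "\<bar>(\<Sum>u | u \<in> C \<and> ?ev \<omega> u = p. f u) - \<mu>\<bar> < \<epsilon> / 4 * \<mu>"
        unfolding yz exceptional_def by (simp add: bucket)
      then have "dev / 2 \<le> \<bar>(\<Sum>u | u \<in> C \<and> ?ev \<omega> u = p. f u) - m\<bar>"
      proof -
        define S where "S = (\<Sum>u | u \<in> C \<and> ?ev \<omega> u = p. f u)"
        have "dev \<le> \<bar>S - m\<bar> + \<bar>S - \<mu>\<bar>" unfolding dev_def by (simp add: abs_if)
        moreover have "\<bar>S - \<mu>\<bar> < \<epsilon> / 2 * \<mu> / 2"
          using \<open>\<bar>(\<Sum>u | u \<in> C \<and> ?ev \<omega> u = p. f u) - \<mu>\<bar> < \<epsilon> / 4 * \<mu>\<close> unfolding S_def by simp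
        ultimately show ?thesis using dev unfolding S_def[symmetric] by linarith
      qed
      then have "(dev / 2)\<^sup>2 \<le> \<bar>(\<Sum>u | u \<in> C \<and> ?ev \<omega> u = p. f u) - m\<bar>\<^sup>2"
        using dev0 by (intro power_mono) auto
      then show "(dev / 2)\<^sup>2 \<le> ((\<Sum>u | u \<in> C \<and> ?ev \<omega> u = p. f u) - m)\<^sup>2" by simp
    qed
    also have "\<dots> \<le> (\<Sum>y\<in>UNIV. ((\<Sum>u | u \<in> C \<and> ?ev \<omega> u = y. f u) - m)\<^sup>2)" by (intro sum_mono2) auto
    finally show ?thesis unfolding m_def cY .
  qed
  have sumE: "(\<Sum>\<omega>\<in>?W. real (card (- ?E \<omega>))) * (dev / 2)\<^sup>2 \<le> real (card ?W) * B * sum f C"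
    unfolding sum_distrib_right using sum_mono[of ?W, OF each] var by (rule order_trans)
  have B0: "0 \<le> B" using f[of 0] by simp
  \<comment> \<open>There is no upper bound on \<open>dev\<close>, so the weight of \<open>C\<close>
    may be large. The factor \<mu> + \<open>dev\<close> is absorbed into the square of
    \<open>dev\<close> by means of \<epsilon> \<mu> \<le> 2 \<open>dev\<close>.\<close>
  have "B * sum f C * (2 * q * (\<epsilon>\<^sup>2 * 4)) \<le> (dev / 2)\<^sup>2 * q\<^sup>2 * (4 * 24)"
  proof -
    have "sum f C = m * q\<^sup>2" unfolding m_def using q0 by simp
    also have "\<dots> \<le> (\<mu> + dev) * q\<^sup>2" unfolding dev_def by (intro mult_right_mono) auto
    finally have s: "sum f C \<le> (\<mu> + dev) * q\<^sup>2" .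
    have sf: "0 \<le> sum f C" using f by (simp add: sum_nonneg)
    have e\<mu>: "\<epsilon> * \<mu> \<le> 2 * dev" using dev by simp
    have "B * sum f C * (2 * q * (\<epsilon>\<^sup>2 * 4)) = (2 * q * B) * (sum f C * (\<epsilon>\<^sup>2 * 4))" by (simp add: mult_ac)
    also have "\<dots> \<le> \<mu> * (sum f C * (\<epsilon>\<^sup>2 * 4))" by (intro mult_right_mono B) (use sf in auto)
    also have "\<dots> \<le> \<mu> * (((\<mu> + dev) * q\<^sup>2) * (\<epsilon>\<^sup>2 * 4))"
      by (intro mult_left_mono mult_right_mono s) (use B in auto)
    also have "\<dots> = ((\<epsilon> * \<mu>) * (\<epsilon> * \<mu>) + (\<epsilon> * \<mu>) * (\<epsilon> * dev)) * q\<^sup>2 * 4"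
      by (simp add: algebra_simps power2_eq_square)
    also have "\<dots> \<le> ((2 * dev) * (2 * dev) + (2 * dev) * (1 * dev)) * q\<^sup>2 * 4"
    proof (rule mult_right_mono, rule mult_right_mono)
      define a e d where "a = \<epsilon> * \<mu>" and "e = \<epsilon> * dev" and "d = 2 * dev"
      have "0 \<le> a" "a \<le> d" "0 \<le> e" "e \<le> 1 * dev" "0 \<le> d"
        using \<epsilon> B(2) dev0 e\<mu> unfolding a_def e_def d_def by (simp_all add: mult_le_cancel_right1)
      then have "a * a \<le> d * d" "a * e \<le> d * (1 * dev)" by (simp_all only: mult_mono)
      then show "(\<epsilon> * \<mu>) * (\<epsilon> * \<mu>) + (\<epsilon> * \<mu>) * (\<epsilon> * dev) \<le> (2 * dev) * (2 * dev) + (2 * dev) * (1 * dev)"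
        unfolding a_def e_def d_def by (rule add_mono)
    qed simp_all
    also have "\<dots> = (dev / 2)\<^sup>2 * q\<^sup>2 * (4 * 24)" by (simp add: power2_eq_square)
    finally show ?thesis .
  qed
  then have key: "B * sum f C * (q * \<epsilon>\<^sup>2) \<le> (dev / 2)\<^sup>2 * q\<^sup>2 * 12" by (simp add: mult_ac)
  have sf: "0 \<le> B * sum f C" using B0 f by (simp add: sum_nonneg)
  have "B * sum f C * (1024 * n) \<le> B * sum f C * (q * \<epsilon>\<^sup>2)"
    using q(1) sf by (intro mult_left_mono) (auto simp: mult.commute)
  with key have "B * sum f C * (1024 * n) \<le> (dev / 2)\<^sup>2 * q\<^sup>2 * 12" by linarith
  then have "B * sum f C \<le> (dev / 2)\<^sup>2 * (q\<^sup>2 * (12 / (1024 * n)))"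
  proof -
    assume *: "B * sum f C * (1024 * n) \<le> (dev / 2)\<^sup>2 * q\<^sup>2 * 12"
    have "0 < 1024 * n" using q(2) by simp
    then have "B * sum f C \<le> (dev / 2)\<^sup>2 * q\<^sup>2 * 12 / (1024 * n)" using * by (simp only: pos_le_divide_eq)
    then show ?thesis by (simp only: times_divide_eq_right mult.assoc)
  qed
  then have "real (card ?W) * (B * sum f C) \<le> real (card ?W) * ((dev / 2)\<^sup>2 * (q\<^sup>2 * (12 / (1024 * n))))"
    by (intro mult_left_mono) auto
  with sumE have "(\<Sum>\<omega>\<in>?W. real (card (- ?E \<omega>))) * (dev / 2)\<^sup>2
      \<le> (real (card ?W) * (q\<^sup>2 * (12 / (1024 * n)))) * (dev / 2)\<^sup>2" by (simp add: mult_ac)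
  then have "(\<Sum>\<omega>\<in>?W. real (card (- ?E \<omega>))) \<le> real (card ?W) * (q\<^sup>2 * (12 / (1024 * n)))"
    by (rule mult_right_le_imp_le) (use dev0 in simp)
  \<comment> \<open>On average a share of at most 12/(1024 n) = (3/8)/(32 n) of the plane is not
    exceptional. By Markov at least 5/8 of the pairs, hence more than half, have less than 1/(32 n)
    missing.\<close>
  also have "\<dots> = (real (card ?W) * (3 / 8)) * (q\<^sup>2 / (32 * n))" using q(2) by (simp add: field_simps)
  finally have "real (card {\<omega>\<in>?W. q\<^sup>2 / (32 * n) \<le> real (card (- ?E \<omega>))}) \<le> real (card ?W) * (3 / 8)"
    by (intro markov_count[where t = "q\<^sup>2 / (32 * n)"]) (use q q0 in auto)
  moreover have "real (card ?W) = real (card {\<omega>\<in>?W. q\<^sup>2 / (32 * n) \<le> real (card (- ?E \<omega>))})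
      + real (card {\<omega>\<in>?W. \<not> q\<^sup>2 / (32 * n) \<le> real (card (- ?E \<omega>))})"
  proof -
    have "?W = {\<omega>\<in>?W. q\<^sup>2 / (32 * n) \<le> real (card (- ?E \<omega>))} \<union> {\<omega>\<in>?W. \<not> q\<^sup>2 / (32 * n) \<le> real (card (- ?E \<omega>))}"
      by blast
    from arg_cong[OF this, of card] show ?thesis by (subst (asm) card_Un_disjoint) auto
  qed
  ultimately have "real (card ?W) / 2 \<le> real (card {\<omega>\<in>?W. \<not> q\<^sup>2 / (32 * n) \<le> real (card (- ?E \<omega>))})"
    by linarith
  also have "\<dots> \<le> real (card {(h, h'). (1 - 1 / (32 * n)) * q\<^sup>2 \<le>
      real (card {(y, z). plane_point k x (\<lambda>_. 0) (\<lambda>_. 0) y z \<in> exceptional k f \<mu> (\<epsilon> / 4 * \<mu>) A h h'})})"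
  proof (intro of_nat_mono card_mono subsetI)
    fix \<omega> assume \<omega>: "\<omega> \<in> {\<omega>\<in>?W. \<not> q\<^sup>2 / (32 * n) \<le> real (card (- ?E \<omega>))}"
    have "card (?E \<omega>) \<le> card (UNIV :: ('a \<times> 'a) set)" by (intro card_mono) auto
    then have "real (card (- ?E \<omega>)) = q\<^sup>2 - real (card (?E \<omega>))"
      using card_Diff_subset[of "?E \<omega>" UNIV] cY unfolding Compl_eq_Diff_UNIV[symmetric]
      by (simp only: of_nat_diff finite subset_UNIV simp_thms)
    with \<omega> have "(1 - 1 / (32 * n)) * q\<^sup>2 \<le> real (card (?E \<omega>))"
      by (simp add: left_diff_distrib)
    then show "\<omega> \<in> {(h, h'). (1 - 1 / (32 * n)) * q\<^sup>2 \<le>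
      real (card {(y, z). plane_point k x (\<lambda>_. 0) (\<lambda>_. 0) y z \<in> exceptional k f \<mu> (\<epsilon> / 4 * \<mu>) A h h'})}"
      by (simp add: case_prod_unfold)
  qed auto
  finally show ?thesis .
qed

text \<open>Shears preserve the uniform distribution of the rows; they turn the one coordinate plane of
  \<open>unbalanced_fibre\<close> into planes in \<open>q ^ (2 * k)\<close> directions.\<close>

definition shear :: "nat \<Rightarrow> (nat \<Rightarrow> 'a) \<Rightarrow> (nat \<Rightarrow> 'a) \<Rightarrow> (nat \<Rightarrow> 'a::comm_ring_1 ^ 'n) \<Rightarrow> 'a ^ 'n \<Rightarrow> 'a ^ 'n \<Rightarrow> nat \<Rightarrow> 'a ^ 'n" where
  "shear k a b A h h' = (\<lambda>i\<in>{..<k}. A i - a i *s h - b i *s h')"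

text \<open>Where \<open>h\<close> and \<open>h'\<close> take the values y and z, shearing changes
  the i-th label by y a_i + z b_i. So the untilted plane of the sheared labels is a tilted plane of
  the original ones.\<close>

lemma exceptional_shear:
  "plane_point k x (\<lambda>_. 0) (\<lambda>_. 0) y z \<in> exceptional k f \<mu> t (shear k a b A h h') h h' \<longleftrightarrow>
   plane_point k x a b y z \<in> exceptional k f \<mu> t A h h'"
proof -
  have "hash k (shear k a b A h h') h h' u = plane_point k x (\<lambda>_. 0) (\<lambda>_. 0) y z \<longleftrightarrow>
      hash k A h h' u = plane_point k x a b y z" for u
  proof -
    have ext: "\<phi> = \<psi> \<longleftrightarrow> (\<forall>i<k. \<phi> i = \<psi> i) \<and> \<phi> k = \<psi> k \<and> \<phi> (Suc k) = \<psi> (Suc k)"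
      if "\<phi> \<in> {..<k+2} \<rightarrow>\<^sub>E UNIV" "\<psi> \<in> {..<k+2} \<rightarrow>\<^sub>E UNIV" for \<phi> \<psi> :: "nat \<Rightarrow> 'a"
    proof
      assume *: "(\<forall>i<k. \<phi> i = \<psi> i) \<and> \<phi> k = \<psi> k \<and> \<phi> (Suc k) = \<psi> (Suc k)"
      show "\<phi> = \<psi>"
      proof (rule PiE_ext[OF that])
        fix i assume "i \<in> {..<k+2}"
        then have "i < k \<or> i = k \<or> i = Suc k" by auto
        with * show "\<phi> i = \<psi> i" by blast
      qed
    qed simp
    have mem: "hash k A' h h' u \<in> {..<k+2} \<rightarrow>\<^sub>E UNIV" "plane_point k x a' b' y z \<in> {..<k+2} \<rightarrow>\<^sub>E UNIV" for A' a' b'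
      unfolding hash_def plane_point_def by simp_all
    show ?thesis
      unfolding ext[OF mem(1) mem(2)]
      by (auto simp: hash_def plane_point_def shear_def dot_simps algebra_simps)
  qed
  then have "bucket k f (shear k a b A h h') h h' (plane_point k x (\<lambda>_. 0) (\<lambda>_. 0) y z) = bucket k f A h h' (plane_point k x a b y z)"
    unfolding bucket_def by simp
  then show ?thesis unfolding exceptional_def by (simp add: plane_point_def)
qed

lemma card_subspaces_with_ker:
  fixes \<S> :: "('a::{field,finite} ^ 'n) set set"
  assumes r: "\<And>S. S \<in> \<S> \<Longrightarrow> vec.subspace S \<and> vec.dim S = r" and "S0 \<in> \<S>"
    and sub: "\<T> \<subseteq> \<S>"
  shows "card {A \<in> row_tuples k. ker k A \<in> \<T>} = card {A \<in> row_tuples k. ker k A = S0} * card \<T>"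
proof -
  have eq: "card {A \<in> row_tuples k. ker k A = S} = card {A \<in> row_tuples k. ker k A = S0}" if "S \<in> \<T>" for S
  proof -
    have S: "vec.subspace S" "vec.dim S = r" "vec.subspace S0" "vec.dim S0 = r" using that assms by auto
    then show ?thesis
      using card_rows_ker_le[of S S0 k] card_rows_ker_le[of S0 S k] by simp
  qed
  have fin: "finite (row_tuples k :: (nat \<Rightarrow> 'a ^ 'n) set)" by (intro finite_PiE) auto
  have "{A \<in> row_tuples k. ker k A \<in> \<T>} = (\<Union>S\<in>\<T>. {A \<in> row_tuples k. ker k A = S})" by blast
  then have "card {A \<in> row_tuples k. ker k A \<in> \<T>} = card (\<Union>S\<in>\<T>. {A \<in> row_tuples k. ker k A = S})" by simp
  also have "\<dots> = (\<Sum>S\<in>\<T>. card {A \<in> row_tuples k. ker k A = S})"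
    by (rule card_UN_disjoint) (use fin in auto)
  also have "\<dots> = (\<Sum>S\<in>\<T>. card {A \<in> row_tuples k. ker k A = S0})" by (intro sum.cong refl eq)
  finally show ?thesis by simp
qed

text \<open>Passage from uniform subspaces to uniform rows: every subspace of the right dimension is
  the kernel of equally many tuples, and the factor 1/2 pays for the degenerate tuples.\<close>

lemma card_unbalanced_ker_ge:
  fixes \<T> :: "('a::{field,finite} ^ 'n) set set" and k :: nat
  defines "Sub \<equiv> {S :: ('a ^ 'n) set. vec.subspace S \<and> vec.dim S = CARD('n) - k}"
  assumes k: "k < CARD('n)" and \<T>: "\<T> \<subseteq> Sub" and d: "0 \<le> d" "d * real (card Sub) \<le> real (card \<T>)"
  shows "d / 2 * real (card (row_tuples k :: (nat \<Rightarrow> 'a ^ 'n) set)) \<le> real (card {A \<in> row_tuples k. ker k A \<in> \<T>})"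
proof -
  let ?R = "row_tuples k :: (nat \<Rightarrow> 'a ^ 'n) set"
  have finR: "finite ?R" by (intro finite_PiE) auto
  have R0: "0 < card ?R" using finR by (simp add: card_gt_0_iff PiE_eq_empty_iff)
  have "card ?R = card {A \<in> ?R. ker k A \<in> Sub} + card {A \<in> ?R. vec.dim (ker k A) \<noteq> CARD('n) - k}"
  proof -
    have "?R = {A \<in> ?R. ker k A \<in> Sub} \<union> {A \<in> ?R. vec.dim (ker k A) \<noteq> CARD('n) - k}"
      unfolding Sub_def using subspace_ker by blast
    from arg_cong[OF this, of card] show ?thesis
      by (subst (asm) card_Un_disjoint) (use finR in \<open>auto simp: Sub_def\<close>)
  qed
  with card_rows_degenerate_le[OF k, where 'a = 'a] have half: "card ?R \<le> 2 * card {A \<in> ?R. ker k A \<in> Sub}" by linarith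
  with R0 have "{A \<in> ?R. ker k A \<in> Sub} \<noteq> {}" by (metis card.empty mult_0_right not_less0 le_0_eq neq0_conv)
  then obtain S0 where S0: "S0 \<in> Sub" by blast
  let ?c = "real (card {A \<in> ?R. ker k A = S0})"
  have "real (card {A \<in> ?R. ker k A \<in> Sub}) = ?c * real (card Sub)"
    using card_subspaces_with_ker[of Sub "CARD('n) - k" S0 Sub k] S0 unfolding Sub_def by simp
  moreover have "real (card {A \<in> ?R. ker k A \<in> \<T>}) = ?c * real (card \<T>)"
    using card_subspaces_with_ker[of Sub "CARD('n) - k" S0 \<T> k] S0 \<T> unfolding Sub_def by simp
  moreover have "?c * (d * real (card Sub)) \<le> ?c * real (card \<T>)" using d(2) by (intro mult_left_mono) auto
  moreover have "d * (real (card ?R) / 2) \<le> d * real (card {A \<in> ?R. ker k A \<in> Sub})"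
    using half d(1) by (intro mult_left_mono) linarith+
  ultimately show ?thesis by (simp add: mult_ac)
qed

lemma card_bij_preimage:
  assumes "bij_betw F X X"
  shows "card {x \<in> X. Q (F x)} = card {x \<in> X. Q x}"
proof (rule bij_betw_same_card)
  have im: "F ` X = X" and inj: "inj_on F X" using assms by (simp_all add: bij_betw_def)
  show "bij_betw F {x \<in> X. Q (F x)} {x \<in> X. Q x}"
    unfolding bij_betw_def
  proof
    show "inj_on F {x \<in> X. Q (F x)}" using inj by (rule inj_on_subset) blast
    show "F ` {x \<in> X. Q (F x)} = {x \<in> X. Q x}"
    proof (intro equalityI subsetI)
      fix y assume y: "y \<in> {x \<in> X. Q x}"
      then have "y \<in> F ` X" unfolding im by simp
      then obtain x where "x \<in> X" "y = F x" by blast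
      with y show "y \<in> F ` {x \<in> X. Q (F x)}" by simp
    next
      fix y assume "y \<in> F ` {x \<in> X. Q (F x)}"
      then obtain x where x: "x \<in> X" "Q (F x)" "y = F x" by blast
      have "F x \<in> F ` X" using x(1) by (rule imageI)
      then have "F x \<in> X" unfolding im .
      with x show "y \<in> {x \<in> X. Q x}" by simp
    qed
  qed
qed

lemma bij_shear:
  fixes a b :: "nat \<Rightarrow> 'a::comm_ring_1"
  shows "bij_betw (\<lambda>\<omega>. (shear k a b (fst \<omega>) (fst (snd \<omega>)) (snd (snd \<omega>)), snd \<omega>))
    ((row_tuples k :: (nat \<Rightarrow> 'a ^ 'n) set) \<times> UNIV) ((row_tuples k :: (nat \<Rightarrow> 'a ^ 'n) set) \<times> UNIV)"
    (is "bij_betw (?F a b) ?X ?X")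
proof (rule bij_betw_byWitness[where f' = "?F (\<lambda>i. - a i) (\<lambda>i. - b i)"])
  have mem: "shear k a b A h h' \<in> row_tuples k" for a b and A :: "nat \<Rightarrow> 'a ^ 'n" and h h'
    unfolding shear_def by (rule restrict_PiE_iff[THEN iffD2]) simp
  have inv: "?F (\<lambda>i. - a i) (\<lambda>i. - b i) (?F a b \<omega>) = \<omega>" if "\<omega> \<in> ?X" for a b \<omega>
  proof (rule prod_eqI)
    from that have "fst \<omega> \<in> row_tuples k" by (simp only: mem_Times_iff)
    show "fst (?F (\<lambda>i. - a i) (\<lambda>i. - b i) (?F a b \<omega>)) = fst \<omega>"
      unfolding fst_conv snd_conv
    proof (rule PiE_ext[OF mem \<open>fst \<omega> \<in> row_tuples k\<close>])
      fix i assume "i \<in> {..<k}"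
      then show "shear k (\<lambda>i. - a i) (\<lambda>i. - b i) (shear k a b (fst \<omega>) (fst (snd \<omega>)) (snd (snd \<omega>)))
          (fst (snd \<omega>)) (snd (snd \<omega>)) i = fst \<omega> i"
        unfolding shear_def by (simp add: vec_eq_iff)
    qed
  qed simp
  then show "\<forall>\<omega>\<in>?X. ?F (\<lambda>i. - a i) (\<lambda>i. - b i) (?F a b \<omega>) = \<omega>" by blast
  show "\<forall>\<omega>\<in>?X. ?F a b (?F (\<lambda>i. - a i) (\<lambda>i. - b i) \<omega>) = \<omega>"
  proof
    fix \<omega> :: "(nat \<Rightarrow> 'a ^ 'n) \<times> ('a ^ 'n) \<times> ('a ^ 'n)" assume "\<omega> \<in> ?X"
    from inv[OF this, of "\<lambda>i. - a i" "\<lambda>i. - b i"]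
    show "?F a b (?F (\<lambda>i. - a i) (\<lambda>i. - b i) \<omega>) = \<omega>" unfolding minus_minus .
  qed
  show "?F a b ` ?X \<subseteq> ?X" "?F (\<lambda>i. - a i) (\<lambda>i. - b i) ` ?X \<subseteq> ?X"
    by (intro image_subsetI SigmaI mem UNIV_I)+
qed

text \<open>Chebyshev yields X \<le> 8 c Q / (\<epsilon>^2 q), and the lower bound on
  \<open>q\<close> turns this into 8 c Q \<delta>^2 / (1024 n). One factor \<delta> is given away,
  and 1024 = 8 * 16 * 8.\<close>

lemma exceptional_mean_bound:
  fixes X c B Q \<mu> \<epsilon> \<delta> q n :: real
  assumes X: "X * (\<epsilon> / 4 * \<mu>)\<^sup>2 \<le> c * B * (\<mu> * Q)" and \<epsilon>: "0 < \<epsilon>" and \<delta>: "0 < \<delta>" "\<delta> < 1"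
    and \<mu>: "0 < \<mu>" "2 * q * B \<le> \<mu>" and q: "1024 * n \<le> (\<epsilon> * \<delta>)\<^sup>2 * q" "0 < q"
    and n: "0 < n" and nn: "0 \<le> c" "0 \<le> Q" "0 \<le> X"
  shows "X \<le> c * (\<delta> / 16) * (Q / (8 * n))"
proof -
  have "X * (\<epsilon> / 4 * \<mu>)\<^sup>2 * (16 * q) \<le> c * B * (\<mu> * Q) * (16 * q)"
    by (rule mult_right_mono[OF X]) (use q in simp)
  moreover have "X * (\<epsilon> / 4 * \<mu>)\<^sup>2 * (16 * q) = X * (\<epsilon>\<^sup>2 * q) * (\<mu> * \<mu>)"
    by (simp add: power2_eq_square)
  moreover have "c * B * (\<mu> * Q) * (16 * q) = (c * Q * \<mu>) * (8 * (2 * q * B))" by simp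
  moreover have "(c * Q * \<mu>) * (8 * (2 * q * B)) \<le> (c * Q * \<mu>) * (8 * \<mu>)"
  proof (rule mult_left_mono)
    show "8 * (2 * q * B) \<le> 8 * \<mu>" using \<mu>(2) by linarith
    show "0 \<le> c * Q * \<mu>" using nn \<mu> by simp
  qed
  moreover have "(c * Q * \<mu>) * (8 * \<mu>) = c * Q * 8 * (\<mu> * \<mu>)" by simp
  ultimately have "X * (\<epsilon>\<^sup>2 * q) * (\<mu> * \<mu>) \<le> c * Q * 8 * (\<mu> * \<mu>)" by linarith
  then have "X * (\<epsilon>\<^sup>2 * q) \<le> c * Q * 8"
    by (rule mult_right_le_imp_le) (use \<mu> in simp)
  then have "X * (\<epsilon>\<^sup>2 * q) * \<delta>\<^sup>2 \<le> c * Q * 8 * \<delta>\<^sup>2" by (rule mult_right_mono) simp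
  moreover have "X * (\<epsilon>\<^sup>2 * q) * \<delta>\<^sup>2 = X * ((\<epsilon> * \<delta>)\<^sup>2 * q)" by (simp add: power_mult_distrib)
  moreover have "X * (1024 * n) \<le> X * ((\<epsilon> * \<delta>)\<^sup>2 * q)" by (rule mult_left_mono[OF q(1) nn(3)])
  moreover have "c * Q * 8 * \<delta>\<^sup>2 \<le> c * Q * 8 * \<delta>"
  proof (rule mult_left_mono)
    show "\<delta>\<^sup>2 \<le> \<delta>" using \<delta> unfolding power2_eq_square by (intro mult_left_le) auto
  qed (use nn in simp)
  ultimately have "X * (1024 * n) \<le> c * Q * 8 * \<delta>" by linarith
  then have "X \<le> c * Q * 8 * \<delta> / (1024 * n)" using n by (simp add: pos_le_divide_eq)
  also have "\<dots> = c * (\<delta> / 16) * (Q / (8 * n))" by simp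
  finally show ?thesis .
qed

text \<open>Count the pairs of a direction pair (a, b) and a hash function that is rich after the
  shear by (a, b) and has few exceptional buckets. Shears preserve the uniform distribution, so
  every (a, b) occurs with a share \<delta>/16 of the hash functions. By the estimate on planes
  every hash function occurs with a share of at most 2 n / q of the direction pairs.\<close>

lemma linear_hashing:
  fixes f :: "'a::{field,finite} ^ 'n \<Rightarrow> real" and r :: nat
  defines "q \<equiv> real CARD('a)" and "n \<equiv> real CARD('n)"
  defines "Sub \<equiv> {S :: ('a ^ 'n) set. vec.subspace S \<and> vec.dim S = r}"
  defines "l \<equiv> sum f UNIV * q ^ r / q ^ CARD('n)"
  assumes n: "26 \<le> CARD('n)" and r: "2 \<le> r" "r \<le> CARD('n)"
    and f: "\<And>u. 0 \<le> f u \<and> f u \<le> B" and B: "0 < B" "2 * q ^ 3 * B \<le> l"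
    and \<epsilon>: "0 < \<epsilon>" "\<epsilon> < 1" and \<delta>: "0 < \<delta>" "\<delta> < 1"
    and q: "1024 * n \<le> (\<epsilon> * \<delta>)\<^sup>2 * q"
  shows "real (card {S \<in> Sub. \<exists>x. \<epsilon> / 2 * l \<le> \<bar>sum f ((+) x ` S) - l\<bar>}) < \<delta> / 2 * real (card Sub)"
proof (rule ccontr)
  assume "\<not> ?thesis"
  then have many: "\<delta> / 2 * real (card Sub) \<le> real (card {S \<in> Sub. \<exists>x. \<epsilon> / 2 * l \<le> \<bar>sum f ((+) x ` S) - l\<bar>})"
    by simp
  let ?T = "{S \<in> Sub. \<exists>x. \<epsilon> / 2 * l \<le> \<bar>sum f ((+) x ` S) - l\<bar>}"
  define k where "k = CARD('n) - r"
  have kr: "k + r = CARD('n)" "CARD('n) - k = r" using r unfolding k_def by auto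
  let ?R = "row_tuples k :: (nat \<Rightarrow> 'a ^ 'n) set"
  let ?W = "UNIV :: (('a ^ 'n) \<times> ('a ^ 'n)) set"
  let ?\<Omega> = "?R \<times> (UNIV :: ('a ^ 'n) set) \<times> (UNIV :: ('a ^ 'n) set)"
  have finR: "finite ?R" by (intro finite_PiE) auto
  have n0: "26 \<le> n" unfolding n_def using n by simp
  have q0: "0 < q" unfolding q_def by simp
  have ed: "(\<epsilon> * \<delta>)\<^sup>2 \<le> \<epsilon>\<^sup>2" "(\<epsilon> * \<delta>)\<^sup>2 \<le> \<delta>" "(\<epsilon> * \<delta>)\<^sup>2 \<le> 1"
  proof -
    have e1: "\<epsilon>\<^sup>2 \<le> 1" "\<delta>\<^sup>2 \<le> 1" using \<epsilon> \<delta> by (simp_all add: power_le_one)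
    show "(\<epsilon> * \<delta>)\<^sup>2 \<le> \<epsilon>\<^sup>2" unfolding power_mult_distrib using e1 by (intro mult_left_le) auto
    have "(\<epsilon> * \<delta>)\<^sup>2 \<le> \<delta>\<^sup>2" unfolding power_mult_distrib using e1 by (intro mult_left_le_one_le) auto
    also have "\<delta>\<^sup>2 \<le> \<delta>" using \<delta> by (simp add: power2_eq_square mult_left_le)
    finally show "(\<epsilon> * \<delta>)\<^sup>2 \<le> \<delta>" .
    then show "(\<epsilon> * \<delta>)\<^sup>2 \<le> 1" using \<delta> by simp
  qed
  have q\<epsilon>: "1024 * n \<le> \<epsilon>\<^sup>2 * q" using q mult_right_mono[OF ed(1), of q] q0 by linarith
  have q\<delta>: "1024 * n \<le> \<delta> * q" using q mult_right_mono[OF ed(2), of q] q0 by linarith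
  have qn: "1024 * n \<le> q" using q mult_right_mono[OF ed(3), of q] q0 by linarith
  \<comment> \<open>The mean weight of a bucket, smaller than \<open>l\<close> by the factor q^2.
    The cubic margin in the hypothesis on \<open>B\<close> is therefore still linear in
    \<open>q\<close> here.\<close>
  define \<mu> where "\<mu> = sum f UNIV / q ^ (k + 2)"
  have l\<mu>: "l = \<mu> * q\<^sup>2"
    unfolding l_def \<mu>_def kr(1)[symmetric] using q0 by (simp add: power_add field_simps power2_eq_square)
  have B\<mu>: "2 * q * B \<le> \<mu>"
  proof -
    have "(2 * q * B) * q\<^sup>2 \<le> \<mu> * q\<^sup>2" using B(2) unfolding l\<mu> by (simp add: power2_eq_square power3_eq_cube mult_ac)
    then show ?thesis by (rule mult_right_le_imp_le) (use q0 in simp)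
  qed
  have "0 < 2 * q * B" using q0 B(1) by simp
  with B\<mu> have \<mu>0: "0 < \<mu>" by linarith
  define N where "N = nat \<lceil>(1 - 1 / (32 * n)) * q\<^sup>2\<rceil>"
  have N_le: "N \<le> m" if "(1 - 1 / (32 * n)) * q\<^sup>2 \<le> real m" for m
    unfolding N_def using that by (simp add: nat_le_iff ceiling_le_iff)
  have N_ge: "(1 - 1 / (32 * n)) * q\<^sup>2 \<le> real N" unfolding N_def by linarith
  define Ex where "Ex A h h' = exceptional k f \<mu> (\<epsilon> / 4 * \<mu>) A h h'" for A h h'
  \<comment> \<open>Stated for the untilted plane over some \<open>x\<close>. Tilted planes enter
    only through shears, so one predicate serves all directions.\<close>
  define rich where "rich A h h' \<longleftrightarrow> (\<exists>x. N \<le> card {(y, z). plane_point k x (\<lambda>_. 0) (\<lambda>_. 0) y z \<in> Ex A h h'})"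
    for A h h'
  have cW: "real (card ?\<Omega>) = real (card ?R) * real (card ?W)" by (simp add: card_cartesian_product)
  define bad where "bad = {A \<in> ?R. ker k A \<in> ?T}"
  have finbad: "finite bad" unfolding bad_def using finR by simp
  have "k < CARD('n)" using kr r by linarith
  then have cbad: "\<delta> / 2 / 2 * real (card ?R) \<le> real (card bad)"
  proof (unfold bad_def, intro card_unbalanced_ker_ge)
    show "?T \<subseteq> {S. vec.subspace S \<and> vec.dim S = CARD('n) - k}" unfolding kr Sub_def by blast
    show "\<delta> / 2 * real (card {S :: ('a ^ 'n) set. vec.subspace S \<and> vec.dim S = CARD('n) - k}) \<le> real (card ?T)"
      using many unfolding kr Sub_def .
  qed (use \<delta> in simp_all)
  have fib: "real (card ?W) / 2 \<le> real (card {(h, h'). rich A h h'})" if "A \<in> bad" for A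
  proof -
    from that obtain x0 where x0: "\<epsilon> / 2 * l \<le> \<bar>sum f ((+) x0 ` ker k A) - l\<bar>" unfolding bad_def by blast
    have C: "(+) x0 ` ker k A = {u. \<forall>i<k. dot (A i) u = dot (A i) x0}"
    proof (intro equalityI subsetI)
      fix u assume "u \<in> {u. \<forall>i<k. dot (A i) u = dot (A i) x0}"
      then have "u - x0 \<in> ker k A" unfolding ker_def by (simp add: dot_simps)
      then show "u \<in> (+) x0 ` ker k A" by (intro image_eqI[where x = "u - x0"]) auto
    qed (auto simp: ker_def dot_simps)
    have "real (card ?W) / 2 \<le> real (card {(h, h'). (1 - 1 / (32 * n)) * q\<^sup>2 \<le>
      real (card {(y, z). plane_point k (\<lambda>i. dot (A i) x0) (\<lambda>_. 0) (\<lambda>_. 0) y z \<in> exceptional k f \<mu> (\<epsilon> / 4 * \<mu>) A h h'})})"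
      unfolding q_def
    proof (rule unbalanced_fibre[where B = B])
      show "\<epsilon> / 2 * (\<mu> * (real CARD('a))\<^sup>2) \<le> \<bar>sum f {u. \<forall>i<k. dot (A i) u = dot (A i) x0} - \<mu> * (real CARD('a))\<^sup>2\<bar>"
        using x0 unfolding l\<mu> C q_def .
    qed (use f B\<mu> \<mu>0 \<epsilon> q\<epsilon> n0 in \<open>auto simp: q_def\<close>)
    also have "\<dots> \<le> real (card {(h, h'). rich A h h'})"
    proof (intro of_nat_mono card_mono)
      show "{(h, h'). (1 - 1 / (32 * n)) * q\<^sup>2 \<le>
        real (card {(y, z). plane_point k (\<lambda>i. dot (A i) x0) (\<lambda>_. 0) (\<lambda>_. 0) y z \<in> exceptional k f \<mu> (\<epsilon> / 4 * \<mu>) A h h'})}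
        \<subseteq> {(h, h'). rich A h h'}"
        unfolding rich_def Ex_def using N_le by blast
    qed simp
    finally show ?thesis .
  qed
  define Rich where "Rich = {(A, h, h'). A \<in> ?R \<and> rich A h h'}"
  have cRich: "\<delta> / 8 * real (card ?\<Omega>) \<le> real (card Rich)"
  proof -
    have "\<delta> / 8 * real (card ?\<Omega>) = (\<delta> / 2 / 2 * real (card ?R)) * (real (card ?W) / 2)" unfolding cW by simp
    also have "\<dots> \<le> real (card bad) * (real (card ?W) / 2)" by (intro mult_right_mono cbad) simp
    also have "\<dots> = (\<Sum>A\<in>bad. real (card ?W) / 2)" by simp
    also have "\<dots> \<le> (\<Sum>A\<in>bad. real (card {(h, h'). rich A h h'}))" by (intro sum_mono fib)
    also have "\<dots> = real (card (Sigma bad (\<lambda>A. {(h, h'). rich A h h'})))"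
      using finbad by (subst card_SigmaI) auto
    also have "\<dots> \<le> real (card Rich)"
    proof (intro of_nat_mono card_mono)
      show "finite Rich" unfolding Rich_def by (rule finite_subset[of _ ?\<Omega>]) (use finR in auto)
      show "Sigma bad (\<lambda>A. {(h, h'). rich A h h'}) \<subseteq> Rich" unfolding Rich_def bad_def by auto
    qed
    finally show ?thesis .
  qed
  \<comment> \<open>The hash functions whose exceptional set is too dense for
    \<open>kakeya_planes_dense\<close>. They cost at most half of the guaranteed share \<delta>/8 of
    rich ones.\<close>
  define Large where "Large = {\<omega> \<in> ?\<Omega>. q ^ (k + 2) / (8 * n) \<le> (case \<omega> of (A, h, h') \<Rightarrow> real (card (Ex A h h')))}"
  have fin\<Omega>: "finite ?\<Omega>" by (intro finite_cartesian_product finR) auto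
  have cLarge: "real (card Large) \<le> real (card ?\<Omega>) * (\<delta> / 16)"
    unfolding Large_def
  proof (rule markov_count)
    show "(\<Sum>\<omega>\<in>?\<Omega>. case \<omega> of (A, h, h') \<Rightarrow> real (card (Ex A h h'))) \<le> real (card ?\<Omega>) * (\<delta> / 16) * (q ^ (k + 2) / (8 * n))"
    proof (rule exceptional_mean_bound[OF _ \<epsilon>(1) \<delta> \<mu>0 B\<mu> q])
      have sf: "\<mu> * q ^ (k + 2) = sum f UNIV" unfolding \<mu>_def using q0 by simp
      have \<mu>': "\<mu> = sum f UNIV / real CARD('a) ^ (k + 2)" unfolding \<mu>_def q_def ..
      have "0 \<le> \<epsilon> / 4 * \<mu>" using \<epsilon> \<mu>0 by simp
      from sum_card_exceptional_le[where f = f and k = k, OF f this]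
      show "(\<Sum>\<omega>\<in>?\<Omega>. case \<omega> of (A, h, h') \<Rightarrow> real (card (Ex A h h'))) * (\<epsilon> / 4 * \<mu>)\<^sup>2
          \<le> real (card ?\<Omega>) * B * (\<mu> * q ^ (k + 2))"
        unfolding sf Ex_def \<mu>'[symmetric] .
    qed (use q0 n0 in \<open>simp_all add: sum_nonneg case_prod_unfold\<close>)
    show "finite ?\<Omega>" by (rule fin\<Omega>)
    show "0 < q ^ (k + 2) / (8 * n)" using q0 n0 by simp
  qed (simp add: case_prod_unfold)
  let ?F = "{..<k} \<rightarrow>\<^sub>E (UNIV :: 'a set)"
  have finF: "finite ?F" by (intro finite_PiE) auto
  have cF: "real (card (?F \<times> ?F)) = q ^ (2 * k)"
    unfolding q_def by (simp add: card_cartesian_product card_PiE mult_2 power_add)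
  define G where "G \<omega> = {(a, b) \<in> ?F \<times> ?F. case \<omega> of (A, h, h') \<Rightarrow> rich (shear k a b A h h') h h'}" for \<omega>
  have small_G: "real (card (G \<omega>)) * q \<le> 2 * n * q ^ (2 * k)" if "\<omega> \<in> ?\<Omega> - Large" for \<omega>
  proof -
    obtain A h h' where \<omega>: "\<omega> = (A, h, h')" by (cases \<omega>)
    show ?thesis
      unfolding q_def n_def
    proof (rule kakeya_planes_dense[where E = "Ex A h h'" and N = N])
      show "finite (Ex A h h')" unfolding Ex_def by (rule finite_exceptional)
      show "k + 2 \<le> CARD('n)" using kr r by simp
      show "real CARD('n) \<le> real CARD('a)" using qn n0 unfolding q_def n_def by linarith
      show "real (card (Ex A h h')) \<le> real CARD('a) ^ (k + 2) / (8 * real CARD('n))"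
      proof -
        have "\<not> q ^ (k + 2) / (8 * n) \<le> real (card (Ex A h h'))"
        proof
          assume "q ^ (k + 2) / (8 * n) \<le> real (card (Ex A h h'))"
          then have "\<omega> \<in> Large" using that unfolding Large_def \<omega> by (simp only: mem_Collect_eq Diff_iff prod.case simp_thms)
          with that show False by (simp only: Diff_iff simp_thms)
        qed
        then show ?thesis unfolding q_def n_def by linarith
      qed
      show "(1 - 1 / (32 * real CARD('n))) * (real CARD('a))\<^sup>2 \<le> real N" using N_ge unfolding q_def n_def .
      show "G \<omega> \<subseteq> {(a, b). a \<in> ?F \<and> b \<in> ?F \<and> (\<exists>x. N \<le> card {(y, z). plane_point k x a b y z \<in> Ex A h h'})}"
      proof
        fix p assume pG: "p \<in> G \<omega>"
        obtain a b where p: "p = (a, b)" by (cases p)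
        have ab: "a \<in> ?F" "b \<in> ?F" "rich (shear k a b A h h') h h'"
          using pG unfolding G_def \<omega> p by (simp_all only: mem_Collect_eq prod.case mem_Times_iff fst_conv snd_conv)
        then have "\<exists>x. N \<le> card {(y, z). plane_point k x a b y z \<in> Ex A h h'}"
          unfolding rich_def Ex_def exceptional_shear by simp
        with ab show "p \<in> {(a, b). a \<in> ?F \<and> b \<in> ?F \<and> (\<exists>x. N \<le> card {(y, z). plane_point k x a b y z \<in> Ex A h h'})}"
          unfolding p by (simp only: mem_Collect_eq prod.case simp_thms)
      qed
    qed (rule n)
  qed
  define Z where "Z p = {\<omega> \<in> ?\<Omega>. case (p, \<omega>) of ((a, b), (A, h, h')) \<Rightarrow> rich (shear k a b A h h') h h'}" for p
  have cZ: "card (Z p) = card Rich" for p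
  proof -
    obtain a b where p: "p = (a, b)" by (cases p)
    have "card {\<omega> \<in> ?R \<times> UNIV. (\<lambda>\<omega>. rich (fst \<omega>) (fst (snd \<omega>)) (snd (snd \<omega>)))
        (shear k a b (fst \<omega>) (fst (snd \<omega>)) (snd (snd \<omega>)), snd \<omega>)}
      = card {\<omega> \<in> ?R \<times> UNIV. rich (fst \<omega>) (fst (snd \<omega>)) (snd (snd \<omega>))}"
      by (rule card_bij_preimage[OF bij_shear])
    moreover have "Z p = {\<omega> \<in> ?R \<times> UNIV. (\<lambda>\<omega>. rich (fst \<omega>) (fst (snd \<omega>)) (snd (snd \<omega>)))
        (shear k a b (fst \<omega>) (fst (snd \<omega>)) (snd (snd \<omega>)), snd \<omega>)}"
      unfolding Z_def p by (simp add: case_prod_unfold)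
    moreover have "Rich = {\<omega> \<in> ?R \<times> UNIV. rich (fst \<omega>) (fst (snd \<omega>)) (snd (snd \<omega>))}"
      unfolding Rich_def by (simp add: case_prod_unfold mem_Times_iff)
    ultimately show ?thesis by simp
  qed
  have "q ^ (2 * k) * (\<delta> / 16 * real (card ?\<Omega>)) \<le> (\<Sum>p\<in>?F \<times> ?F. real (card (Z p - Large)))"
  proof -
    have "\<delta> / 16 * real (card ?\<Omega>) \<le> real (card (Z p - Large))" for p
    proof -
      have "finite Large" unfolding Large_def using fin\<Omega> by simp
      have "card (Z p) - card Large \<le> card (Z p - Large)" by (rule diff_card_le_card_Diff[OF \<open>finite Large\<close>])
      then have "real (card Rich) \<le> real (card (Z p - Large)) + real (card Large)" unfolding cZ by linarith
      moreover have "\<delta> / 8 * real (card ?\<Omega>) = real (card ?\<Omega>) * (\<delta> / 16) + \<delta> / 16 * real (card ?\<Omega>)" by simp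
      ultimately show ?thesis using cRich cLarge by linarith
    qed
    then have "(\<Sum>p\<in>?F \<times> ?F. \<delta> / 16 * real (card ?\<Omega>)) \<le> (\<Sum>p\<in>?F \<times> ?F. real (card (Z p - Large)))"
      by (intro sum_mono)
    then show ?thesis unfolding sum_constant cF .
  qed
  also have "(\<Sum>p\<in>?F \<times> ?F. real (card (Z p - Large))) = (\<Sum>\<omega>\<in>?\<Omega> - Large. real (card (G \<omega>)))"
  proof -
    have "(\<Sum>p\<in>?F \<times> ?F. real (card (Z p - Large))) = (\<Sum>p\<in>?F \<times> ?F. \<Sum>\<omega>\<in>?\<Omega> - Large. if \<omega> \<in> Z p then 1 else 0)"
    proof (intro sum.cong refl)
      fix p
      have "Z p - Large = {\<omega> \<in> ?\<Omega> - Large. \<omega> \<in> Z p}" unfolding Z_def by blast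
      then show "real (card (Z p - Large)) = (\<Sum>\<omega>\<in>?\<Omega> - Large. if \<omega> \<in> Z p then 1 else 0)"
        using fin\<Omega> by (simp add: sum.If_cases Int_def)
    qed
    also have "\<dots> = (\<Sum>\<omega>\<in>?\<Omega> - Large. \<Sum>p\<in>?F \<times> ?F. if \<omega> \<in> Z p then 1 else 0)" by (rule sum.swap)
    also have "\<dots> = (\<Sum>\<omega>\<in>?\<Omega> - Large. real (card (G \<omega>)))"
    proof (intro sum.cong refl)
      fix \<omega> assume "\<omega> \<in> ?\<Omega> - Large"
      then have "G \<omega> = {p \<in> ?F \<times> ?F. \<omega> \<in> Z p}" unfolding G_def Z_def by (cases \<omega>) auto
      then show "(\<Sum>p\<in>?F \<times> ?F. if \<omega> \<in> Z p then 1 else 0) = real (card (G \<omega>))"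
        using finF by (simp add: sum.If_cases Int_def)
    qed
    finally show ?thesis .
  qed
  finally have "q ^ (2 * k) * (\<delta> / 16 * real (card ?\<Omega>)) * q \<le> (\<Sum>\<omega>\<in>?\<Omega> - Large. real (card (G \<omega>))) * q"
    using q0 by (intro mult_right_mono) auto
  also have "\<dots> = (\<Sum>\<omega>\<in>?\<Omega> - Large. real (card (G \<omega>)) * q)" by (rule sum_distrib_right)
  also have "\<dots> \<le> (\<Sum>\<omega>\<in>?\<Omega> - Large. 2 * n * q ^ (2 * k))" by (intro sum_mono small_G)
  also have "\<dots> = real (card (?\<Omega> - Large)) * (2 * n * q ^ (2 * k))" by simp
  also have "\<dots> \<le> real (card ?\<Omega>) * (2 * n * q ^ (2 * k))"
    using n0 q0 fin\<Omega> by (intro mult_right_mono of_nat_mono card_mono) auto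
  finally have "(\<delta> * q / 16) * (real (card ?\<Omega>) * q ^ (2 * k)) \<le> (2 * n) * (real (card ?\<Omega>) * q ^ (2 * k))"
    by (simp only: mult_ac times_divide_eq_right times_divide_eq_left)
  moreover have "0 < real (card ?\<Omega>) * q ^ (2 * k)"
  proof -
    have "?\<Omega> \<noteq> {}" by (simp add: PiE_eq_empty_iff)
    then have "0 < card ?\<Omega>" using fin\<Omega> by (simp only: card_gt_0_iff) simp
    then show ?thesis using q0 by simp
  qed
  ultimately have "\<delta> * q / 16 \<le> 2 * n" by (simp only: mult_le_cancel_right_pos)
  with q\<delta> n0 show False by linarith
qed

section \<open>Covolumes\<close>

lemma int_lattice_iff: "x \<in> int_lattice \<longleftrightarrow> (\<forall>i. x $ i \<in> \<int>)"
proof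
  assume "x \<in> int_lattice"
  then show "\<forall>i. x $ i \<in> \<int>" unfolding int_lattice_def real_vec_def by auto
next
  assume *: "\<forall>i. x $ i \<in> \<int>"
  have "x = real_vec (\<chi> i. \<lfloor>x $ i\<rfloor>)"
    unfolding real_vec_def vec_eq_iff using * by simp
  then show "x \<in> int_lattice" unfolding int_lattice_def by (rule range_eqI)
qed

lemma det_Ints:
  fixes U :: "real ^ 'n ^ 'n"
  assumes "\<And>i j. U $ i $ j \<in> \<int>"
  shows "det U \<in> \<int>"
  unfolding det_def by (intro Ints_sum Ints_mult Ints_prod assms) simp

text \<open>The columns of \<open>B\<close> are lattice vectors of \<open>A\<close>, so the change
  of basis is an integral matrix.\<close>

lemma det_dvd_det_of_sublattice:
  fixes A B :: "real ^ 'n ^ 'n"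
  assumes A: "invertible A" and sub: "(*v) B ` int_lattice \<subseteq> (*v) A ` int_lattice"
  obtains z where "z \<in> \<int>" "det B = det A * z"
proof -
  obtain A' where AA: "A ** A' = mat 1" "A' ** A = mat 1" using A unfolding invertible_def by blast
  define U where "U = A' ** B"
  have "U $ i $ j \<in> \<int>" for i j
  proof -
    have ax: "axis j 1 \<in> int_lattice" unfolding int_lattice_iff axis_def by auto
    then obtain y where y: "y \<in> int_lattice" "B *v axis j 1 = A *v y" using sub by blast
    have "U *v axis j 1 = A' *v (B *v axis j 1)" unfolding U_def by (simp add: matrix_vector_mul_assoc)
    also have "\<dots> = y" unfolding y(2) by (simp add: matrix_vector_mul_assoc AA)
    finally have "U *v axis j 1 = y" .
    moreover have "(U *v axis j 1) $ i = U $ i $ j"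
      unfolding matrix_vector_mult_def axis_def by (simp add: if_distrib cong: if_cong)
    moreover have "y $ i \<in> \<int>" using y(1) unfolding int_lattice_iff by blast
    ultimately show ?thesis by (simp only:)
  qed
  then have "det U \<in> \<int>" by (rule det_Ints)
  moreover have "A ** U = B" unfolding U_def by (simp add: matrix_mul_assoc AA)
  then have "det B = det A * det U" by (metis det_mul)
  ultimately show thesis using that by blast
qed

text \<open>\<open>covol\<close> is a definite description, so any other basis must give the same
  value: the two determinants divide each other and hence agree up to sign.\<close>

lemma covol_matrix_image:
  fixes A :: "real ^ 'n ^ 'n"
  assumes "invertible A"
  shows "covol ((*v) A ` int_lattice) = \<bar>det A\<bar>"
  unfolding covol_def
proof (rule the_equality)
  show "\<exists>A'::real ^ 'n ^ 'n. invertible A' \<and> (*v) A ` int_lattice = (*v) A' ` int_lattice \<and> \<bar>det A\<bar> = \<bar>det A'\<bar>"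
    using assms by blast
next
  fix d assume "\<exists>A'::real ^ 'n ^ 'n. invertible A' \<and> (*v) A ` int_lattice = (*v) A' ` int_lattice \<and> d = \<bar>det A'\<bar>"
  then obtain B :: "real ^ 'n ^ 'n" where B: "invertible B" "(*v) A ` int_lattice = (*v) B ` int_lattice" "d = \<bar>det B\<bar>"
    by blast
  obtain z where z: "z \<in> \<int>" "det B = det A * z"
    by (rule det_dvd_det_of_sublattice[OF assms, of B]) (use B in auto)
  obtain w where w: "w \<in> \<int>" "det A = det B * w"
    by (rule det_dvd_det_of_sublattice[OF B(1), of A]) (use B in auto)
  have A0: "det A \<noteq> 0" using assms by (simp add: invertible_det_nz)
  have "det A = det A * z * w" using w(2) unfolding z(2) .
  then have zw: "z * w = 1" using A0 by simp
  then have "\<bar>z\<bar> * \<bar>w\<bar> = 1" by (metis abs_mult abs_one)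
  moreover have "1 \<le> \<bar>z\<bar>" "1 \<le> \<bar>w\<bar>"
    using Ints_nonzero_abs_ge1[OF z(1)] Ints_nonzero_abs_ge1[OF w(1)] zw by fastforce+
  ultimately have "\<bar>z\<bar> = 1" by (smt (verit) mult_le_cancel_left1)
  then show "d = \<bar>det A\<bar>" unfolding B(3) z(2) abs_mult by simp
qed

text \<open>A permutation with nonzero product moves indices only from \<open>I\<close> into the
  complement and fixes the complement. Injectivity then forces the identity.\<close>

lemma det_block_triangular:
  fixes C :: "real ^ 'n ^ 'n"
  assumes "\<And>i j. i \<noteq> j \<Longrightarrow> \<not> (i \<in> I \<and> j \<notin> I) \<Longrightarrow> C $ i $ j = 0"
  shows "det C = (\<Prod>i\<in>UNIV. C $ i $ i)"
proof -
  have "of_int (sign p) * (\<Prod>i\<in>UNIV. C $ i $ p i) = 0" if p: "p permutes (UNIV :: 'n set)" "p \<noteq> id" for p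
  proof (rule ccontr)
    assume "\<not> ?thesis"
    then have nz: "C $ i $ p i \<noteq> 0" for i by (auto simp: prod_zero_iff)
    then have *: "p i = i \<or> (i \<in> I \<and> p i \<notin> I)" for i using assms[of i "p i"] by metis
    have "p i = i" for i
    proof (rule ccontr)
      assume ne: "p i \<noteq> i"
      with * have "p i \<notin> I" by blast
      then have "p (p i) = p i" using *[of "p i"] by blast
      then show False using ne permutes_inj[OF p(1)] by (simp add: inj_eq)
    qed
    with p(2) show False by (auto simp: fun_eq_iff)
  qed
  then have "det C = (\<Sum>p\<in>{id}. of_int (sign p) * (\<Prod>i\<in>UNIV. C $ i $ p i))"
    unfolding det_def by (intro sum.mono_neutral_right) (auto simp: permutes_id)
  then show ?thesis by simp
qed

section \<open>Counting lattice points in convex sets\<close>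

definition affine_copy :: "real \<Rightarrow> 'a::real_vector \<Rightarrow> 'a set \<Rightarrow> 'a set" where
  "affine_copy c x K = (\<lambda>k. x + c *\<^sub>R k) ` K"

lemma affine_copy_measurable:
  fixes K :: "(real ^ 'n) set"
  assumes "convex K" "bounded K"
  shows "affine_copy c x K \<in> lmeasurable" "bounded (affine_copy c x K)"
proof -
  have eq: "affine_copy c x K = (+) x ` ((*\<^sub>R) c ` K)" unfolding affine_copy_def image_image ..
  show b: "bounded (affine_copy c x K)" unfolding eq using assms
    by (intro bounded_translation bounded_scaling)
  have "convex (affine_copy c x K)" unfolding eq using assms
    by (intro convex_translation convex_scaling)
  then show "affine_copy c x K \<in> lmeasurable" using b by (rule measurable_convex)
qed

lemma measure_affine_copy:
  fixes K :: "(real ^ 'n) set"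
  shows "measure lebesgue (affine_copy c x K) = \<bar>c\<bar> ^ CARD('n) * measure lebesgue K"
proof -
  have "affine_copy c x K = (\<lambda>k. c *\<^sub>R k + x) ` K" unfolding affine_copy_def by (simp only: add.commute)
  then show ?thesis using measure_lebesgue_affine[of c x K] by simp
qed

text \<open>Dividing by \<open>c + d\<close> exhibits a convex combination. This is how convexity
  enters the comparison of dilates.\<close>

lemma affine_copy_add:
  assumes "convex K" "0 < c" "0 < d" "k \<in> K" "k' \<in> K"
  shows "c *\<^sub>R k + d *\<^sub>R k' \<in> (*\<^sub>R) (c + d) ` K"
proof -
  have "(c / (c + d)) *\<^sub>R k + (d / (c + d)) *\<^sub>R k' \<in> K"
    using assms by (intro convexD) (auto simp: add_divide_distrib[symmetric])
  moreover have "c *\<^sub>R k + d *\<^sub>R k' = (c + d) *\<^sub>R ((c / (c + d)) *\<^sub>R k + (d / (c + d)) *\<^sub>R k')"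
    using assms by (simp add: scaleR_add_right)
  ultimately show ?thesis by blast
qed

text \<open>Half-open, so that its integer translates tile the space without overlap.\<close>

definition unit_cell :: "(real ^ 'n) set" where
  "unit_cell = {x. \<forall>i. 0 \<le> x $ i \<and> x $ i < 1}"

lemma unit_cell_volume: "(unit_cell :: (real ^ 'n) set) \<in> lmeasurable" "measure lebesgue (unit_cell :: (real ^ 'n) set) = 1"
proof -
  let ?Q = "unit_cell :: (real ^ 'n) set"
  have "?Q = (\<Inter>i\<in>UNIV. {x. 0 \<le> x $ i} \<inter> {x. x $ i < 1})" unfolding unit_cell_def by auto
  also have "\<dots> \<in> sets borel"
  proof (intro sets.countable_INT'' sets.Int)
    show "{x :: real ^ 'n. 0 \<le> x $ i} \<in> sets borel" for i
      by (intro borel_closed closed_Collect_le continuous_intros)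
    show "{x :: real ^ 'n. x $ i < 1} \<in> sets borel" for i
      by (intro borel_open open_Collect_less continuous_intros)
  qed auto
  finally have sets: "?Q \<in> sets lebesgue" by (simp add: sets_completionI_sets)
  have sub: "?Q \<subseteq> cbox 0 1" unfolding unit_cell_def by (auto simp: mem_box_cart less_imp_le)
  then have "bounded ?Q" using bounded_cbox bounded_subset by blast
  with sets show m: "?Q \<in> lmeasurable" by (rule bounded_set_imp_lmeasurable[rotated])
  have inner_one: "(1 :: real ^ 'n) \<bullet> b = 1" if "b \<in> Basis" for b
    using that by (auto simp: Basis_vec_def inner_axis)
  have one: "measure lebesgue (cbox 0 (1 :: real ^ 'n)) = 1" "measure lebesgue (box 0 (1 :: real ^ 'n)) = 1"
    by (simp_all add: measure_lborel_cbox_eq measure_lborel_box_eq inner_one)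
  have "box 0 1 \<subseteq> ?Q" unfolding unit_cell_def by (auto simp: mem_box_cart less_imp_le)
  then have "1 \<le> measure lebesgue ?Q" unfolding one(2)[symmetric]
    using m by (intro measure_mono_fmeasurable) auto
  moreover have "measure lebesgue ?Q \<le> 1" unfolding one(1)[symmetric]
    using sub m by (intro measure_mono_fmeasurable) auto
  ultimately show "measure lebesgue ?Q = 1" by simp
qed

lemma finite_bounded_int_lattice:
  fixes B :: "(real ^ 'n) set"
  assumes "bounded B"
  shows "finite {l \<in> int_lattice. l \<in> B}"
proof -
  obtain M where M: "\<And>x. x \<in> B \<Longrightarrow> norm x \<le> M" using assms unfolding bounded_iff by blast
  let ?S = "{v :: int ^ 'n. \<forall>i. v $ i \<in> {-\<lceil>M\<rceil>..\<lceil>M\<rceil>}}"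
  have "finite ?S"
  proof (rule finite_imageD)
    show "finite (vec_nth ` ?S)"
    proof (rule finite_subset)
      show "vec_nth ` ?S \<subseteq> (UNIV :: 'n set) \<rightarrow>\<^sub>E {-\<lceil>M\<rceil>..\<lceil>M\<rceil>}"
        unfolding PiE_UNIV_domain by blast
      show "finite ((UNIV :: 'n set) \<rightarrow>\<^sub>E {-\<lceil>M\<rceil>..\<lceil>M\<rceil>})" by (intro finite_PiE) simp_all
    qed
    show "inj_on vec_nth ?S" by (rule inj_onI) (simp only: vec_nth_inject)
  qed
  moreover have "{l \<in> int_lattice. l \<in> B} \<subseteq> real_vec ` ?S"
  proof
    fix l assume "l \<in> {l \<in> int_lattice. l \<in> B}"
    then obtain v where v: "l = real_vec v" "l \<in> B" unfolding int_lattice_def by blast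
    have "v $ i \<in> {-\<lceil>M\<rceil>..\<lceil>M\<rceil>}" for i
    proof -
      have "\<bar>l $ i\<bar> \<le> M" using component_le_norm_cart[of l i] M[OF v(2)] by linarith
      then have "\<bar>real_of_int (v $ i)\<bar> \<le> M" unfolding v(1) real_vec_def by simp
      then have "v $ i \<le> \<lceil>M\<rceil>" "- v $ i \<le> \<lceil>M\<rceil>" by linarith+
      then show ?thesis by simp
    qed
    then show "l \<in> real_vec ` ?S" unfolding v(1) by (intro imageI CollectI allI)
  qed
  ultimately show ?thesis by (rule finite_subset[OF _ finite_imageI, rotated])
qed

text \<open>Cutting \<open>B\<close> along the integer translates of the unit cell and moving the
  pieces into one cell shows that the volume is the average number of lattice points in a translate.
  \<open>F\<close> holds the finitely many lattice points that matter for some \<open>y\<close> in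
  the cell, so the integrand is a finite sum.\<close>

lemma measure_eq_integral_count:
  fixes B :: "(real ^ 'n) set"
  assumes "B \<in> lmeasurable" "bounded B"
  obtains F where "finite F" "F \<subseteq> int_lattice"
    "\<And>y. y \<in> unit_cell \<Longrightarrow> {l \<in> int_lattice. l + y \<in> B} = {l \<in> F. l + y \<in> B}"
    "integrable lebesgue (\<lambda>y. \<Sum>l\<in>F. indicat_real (unit_cell \<inter> {y. l + y \<in> B}) y)"
    "measure lebesgue B = (\<integral>y. (\<Sum>l\<in>F. indicat_real (unit_cell \<inter> {y. l + y \<in> B}) y) \<partial>lebesgue)"
proof -
  let ?Q = "unit_cell :: (real ^ 'n) set"
  have bQ: "bounded ?Q" using bounded_cbox bounded_subset[of "cbox 0 (1 :: real ^ 'n)" ?Q]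
    unfolding unit_cell_def by (auto simp: mem_box_cart less_imp_le subset_iff)
  define F where "F = {l \<in> int_lattice. l \<in> (\<lambda>(b, y). b - y) ` (B \<times> ?Q)}"
  have "bounded ((\<lambda>(b, y). b - y) ` (B \<times> ?Q))"
    using bounded_minus[OF assms(2) bQ] by (rule bounded_subset) auto
  then have fin: "finite F" unfolding F_def by (rule finite_bounded_int_lattice)
  have eqF: "{l \<in> int_lattice. l + y \<in> B} = {l \<in> F. l + y \<in> B}" if "y \<in> ?Q" for y
    unfolding F_def using that by (force intro: image_eqI[where x = "(_ + y, y)"])
  define E where "E l = ?Q \<inter> {y. l + y \<in> B}" for l
  have El: "E l = (\<lambda>x. x - l) ` (B \<inter> (+) l ` ?Q)" for l
    unfolding E_def by (force simp: algebra_simps)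
  have tQ: "(+) l ` ?Q \<in> lmeasurable" for l by (intro measurable_translation unit_cell_volume)
  have Em: "E l \<in> lmeasurable" for l
    unfolding El by (intro measurable_translation_subtract fmeasurable.Int assms tQ)
  have mE: "measure lebesgue (E l) = measure lebesgue (B \<inter> (+) l ` ?Q)" for l
    unfolding El by (rule measure_translation_subtract)
  have cover: "B = (\<Union>l\<in>F. B \<inter> (+) l ` ?Q)"
  proof (intro equalityI subsetI)
    fix b assume b: "b \<in> B"
    define l where "l = (\<chi> i. of_int \<lfloor>b $ i\<rfloor> :: real ^ 'n)"
    have "l \<in> int_lattice" unfolding int_lattice_iff l_def by simp
    moreover have "b - l \<in> ?Q" unfolding unit_cell_def l_def by (auto simp: floor_le_iff less_floor_iff) linarith+
    moreover have "l = (\<lambda>(b, y). b - y) (b, b - l)" by simp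
    ultimately have "l \<in> F" "b \<in> (+) l ` ?Q"
      unfolding F_def using b by (blast, intro image_eqI[where x = "b - l"]) auto
    with b show "b \<in> (\<Union>l\<in>F. B \<inter> (+) l ` ?Q)" by blast
  qed auto
  have disj: "disjnt (B \<inter> (+) l ` ?Q) (B \<inter> (+) l' ` ?Q)" if "l \<in> F" "l' \<in> F" "l \<noteq> l'" for l l'
  proof (rule ccontr)
    assume "\<not> ?thesis"
    then obtain y y' where y: "y \<in> ?Q" "y' \<in> ?Q" "l + y = l' + y'" unfolding disjnt_def by auto
    have "l $ i = l' $ i" for i
    proof -
      have "l $ i \<in> \<int>" "l' $ i \<in> \<int>" using that unfolding F_def int_lattice_iff by auto
      then obtain a a' where a: "l $ i = of_int a" "l' $ i = of_int a'" unfolding Ints_def by blast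
      have "l $ i + y $ i = l' $ i + y' $ i" using y(3) by (metis vector_add_component)
      moreover have "0 \<le> y $ i" "y $ i < 1" "0 \<le> y' $ i" "y' $ i < 1" using y unfolding unit_cell_def by auto
      ultimately have "a = a'" unfolding a by linarith
      then show ?thesis unfolding a by simp
    qed
    with that(3) show False by (simp add: vec_eq_iff)
  qed
  have "measure lebesgue B = measure lebesgue (\<Union>l\<in>F. B \<inter> (+) l ` ?Q)" using cover by (rule arg_cong)
  also have "\<dots> = (\<Sum>l\<in>F. measure lebesgue (B \<inter> (+) l ` ?Q))"
    by (rule measure_UNION'[OF fin]) (use disj assms tQ in \<open>auto simp: pairwise_def\<close>)
  also have "\<dots> = (\<Sum>l\<in>F. measure lebesgue (E l))" by (simp only: mE)
  also have "\<dots> = (\<Sum>l\<in>F. \<integral>y. indicat_real (E l) y \<partial>lebesgue)" using Em by simp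
  also have "\<dots> = (\<integral>y. (\<Sum>l\<in>F. indicat_real (E l) y) \<partial>lebesgue)"
    using Em by (intro Bochner_Integration.integral_sum[symmetric]) (simp add: lmeasurable_iff_integrable[symmetric])
  finally have meq: "measure lebesgue B = (\<integral>y. (\<Sum>l\<in>F. indicat_real (E l) y) \<partial>lebesgue)" .
  have int: "integrable lebesgue (\<lambda>y. \<Sum>l\<in>F. indicat_real (E l) y)"
    using Em by (intro Bochner_Integration.integrable_sum) (simp add: lmeasurable_iff_integrable[symmetric])
  have "F \<subseteq> int_lattice" unfolding F_def by blast
  from that[OF fin this eqF int[unfolded E_def] meq[unfolded E_def]] show thesis .
qed

lemma count_sum_indicator:
  assumes "finite F" "y \<in> Q"
  shows "(\<Sum>l\<in>F. indicat_real (Q \<inter> {y. P l y}) y) = real (card {l \<in> F. P l y})"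
  using assms by (simp add: indicator_def sum.If_cases Int_def)

lemma count_le_imp_le_measure:
  fixes B :: "(real ^ 'n) set"
  assumes B: "B \<in> lmeasurable" "bounded B"
    and N: "\<And>y. N \<le> real (card {l \<in> int_lattice. l + y \<in> B})"
  shows "N \<le> measure lebesgue B"
proof -
  obtain F where F: "finite F" "F \<subseteq> int_lattice"
    "\<And>y. y \<in> unit_cell \<Longrightarrow> {l \<in> int_lattice. l + y \<in> B} = {l \<in> F. l + y \<in> B}"
    "integrable lebesgue (\<lambda>y. \<Sum>l\<in>F. indicat_real (unit_cell \<inter> {y. l + y \<in> B}) y)"
    "measure lebesgue B = (\<integral>y. (\<Sum>l\<in>F. indicat_real (unit_cell \<inter> {y. l + y \<in> B}) y) \<partial>lebesgue)"
    by (rule measure_eq_integral_count[OF B]) (rule that)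
  have "N = (\<integral>y. N * indicat_real (unit_cell :: (real ^ 'n) set) y \<partial>lebesgue)"
    using unit_cell_volume[where 'n = 'n] by simp
  also have "\<dots> \<le> measure lebesgue B"
    unfolding F(5)
  proof (rule integral_mono)
    show "integrable lebesgue (\<lambda>y. N * indicat_real (unit_cell :: (real ^ 'n) set) y)"
      using unit_cell_volume[where 'n = 'n] by (simp add: lmeasurable_iff_integrable[symmetric])
    show "N * indicat_real unit_cell y \<le> (\<Sum>l\<in>F. indicat_real (unit_cell \<inter> {y. l + y \<in> B}) y)" for y
    proof (cases "y \<in> unit_cell")
      case True
      with N[of y] show ?thesis unfolding F(3)[OF True] count_sum_indicator[OF F(1) True] by simp
    next
      case False
      then show ?thesis by (simp add: sum_nonneg)
    qed
  qed (rule F(4))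
  finally show ?thesis .
qed

lemma measure_le_of_count_le:
  fixes B :: "(real ^ 'n) set"
  assumes B: "B \<in> lmeasurable" "bounded B"
    and N: "\<And>y. real (card {l \<in> int_lattice. l + y \<in> B}) \<le> N"
  shows "measure lebesgue B \<le> N"
proof -
  obtain F where F: "finite F" "F \<subseteq> int_lattice"
    "\<And>y. y \<in> unit_cell \<Longrightarrow> {l \<in> int_lattice. l + y \<in> B} = {l \<in> F. l + y \<in> B}"
    "integrable lebesgue (\<lambda>y. \<Sum>l\<in>F. indicat_real (unit_cell \<inter> {y. l + y \<in> B}) y)"
    "measure lebesgue B = (\<integral>y. (\<Sum>l\<in>F. indicat_real (unit_cell \<inter> {y. l + y \<in> B}) y) \<partial>lebesgue)"
    by (rule measure_eq_integral_count[OF B]) (rule that)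
  have "measure lebesgue B \<le> (\<integral>y. N * indicat_real (unit_cell :: (real ^ 'n) set) y \<partial>lebesgue)"
    unfolding F(5)
  proof (rule integral_mono)
    show "integrable lebesgue (\<lambda>y. N * indicat_real (unit_cell :: (real ^ 'n) set) y)"
      using unit_cell_volume[where 'n = 'n] by (simp add: lmeasurable_iff_integrable[symmetric])
    show "(\<Sum>l\<in>F. indicat_real (unit_cell \<inter> {y. l + y \<in> B}) y) \<le> N * indicat_real unit_cell y" for y
    proof (cases "y \<in> unit_cell")
      case True
      with N[of y] show ?thesis unfolding F(3)[OF True] count_sum_indicator[OF F(1) True] by simp
    next
      case False
      then show ?thesis by simp
    qed
  qed (rule F(4))
  also have "\<dots> = N" using unit_cell_volume[where 'n = 'n] by simp
  finally show ?thesis .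
qed

lemma int_lattice_uminus: "x \<in> int_lattice \<Longrightarrow> - x \<in> int_lattice"
  and int_lattice_diff: "x \<in> int_lattice \<Longrightarrow> y \<in> int_lattice \<Longrightarrow> x - y \<in> int_lattice"
  unfolding int_lattice_iff by simp_all

section \<open>Lattice point counts in dilates\<close>

definition lattice_count :: "real \<Rightarrow> real ^ 'n \<Rightarrow> (real ^ 'n) set \<Rightarrow> nat" where
  "lattice_count c x K = card {l \<in> int_lattice. l \<in> affine_copy c x K}"

lemma coveringE:
  fixes y :: "real ^ 'n"
  assumes "is_covering int_lattice (dilate \<alpha> K)"
  obtains l k where "l \<in> int_lattice" "k \<in> K" "y = l + \<alpha> *\<^sub>R k"
proof -
  have "y \<in> (\<Union>l\<in>int_lattice. (\<lambda>y. l + y) ` dilate \<alpha> K)" using assms unfolding is_covering_def by simp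
  then show thesis using that unfolding dilate_def by blast
qed

text \<open>The covering writes every \<open>y\<close> as a lattice point plus a vector of
  \<alpha>K, so the lattice points of x + cK inject into those of every translate of (c +
  \<alpha>)K. Averaging over the translates gives the volume.\<close>

lemma lattice_count_le:
  fixes K :: "(real ^ 'n) set"
  assumes K: "convex K" "bounded K" and cov: "is_covering int_lattice (dilate \<alpha> K)" and pos: "0 < \<alpha>" "0 < c"
  shows "real (lattice_count c x K) \<le> (c + \<alpha>) ^ CARD('n) * measure lebesgue K"
proof -
  have "real (lattice_count c x K) \<le> measure lebesgue (affine_copy (c + \<alpha>) x K)"
  proof (rule count_le_imp_le_measure[OF affine_copy_measurable[OF K]])
    fix y
    obtain l0 k0 where y: "l0 \<in> int_lattice" "k0 \<in> K" "y = l0 + \<alpha> *\<^sub>R k0" using coveringE[OF cov] .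
    have "bounded ((\<lambda>x. x - y) ` affine_copy (c + \<alpha>) x K)"
      by (intro bounded_translation_minus affine_copy_measurable K)
    then have fin: "finite {l \<in> int_lattice. l \<in> (\<lambda>x. x - y) ` affine_copy (c + \<alpha>) x K}"
      by (rule finite_bounded_int_lattice)
    have "card {l \<in> int_lattice. l \<in> affine_copy c x K} \<le> card {l \<in> int_lattice. l + y \<in> affine_copy (c + \<alpha>) x K}"
    proof (rule card_inj_on_le[of "\<lambda>l. l - l0"])
      show "(\<lambda>l. l - l0) ` {l \<in> int_lattice. l \<in> affine_copy c x K} \<subseteq> {l \<in> int_lattice. l + y \<in> affine_copy (c + \<alpha>) x K}"
      proof (rule image_subsetI)
        fix l assume l: "l \<in> {l \<in> int_lattice. l \<in> affine_copy c x K}"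
        then obtain k where k: "k \<in> K" "l = x + c *\<^sub>R k" unfolding affine_copy_def by blast
        have "c *\<^sub>R k + \<alpha> *\<^sub>R k0 \<in> (*\<^sub>R) (c + \<alpha>) ` K" using affine_copy_add K pos k y by blast
        then obtain k' where "k' \<in> K" "c *\<^sub>R k + \<alpha> *\<^sub>R k0 = (c + \<alpha>) *\<^sub>R k'" by blast
        then have "l - l0 + y = x + (c + \<alpha>) *\<^sub>R k'" unfolding k(2) y(3) by (simp add: algebra_simps)
        then show "l - l0 \<in> {l \<in> int_lattice. l + y \<in> affine_copy (c + \<alpha>) x K}"
          using l y(1) \<open>k' \<in> K\<close> int_lattice_diff unfolding affine_copy_def by blast
      qed
      show "finite {l \<in> int_lattice. l + y \<in> affine_copy (c + \<alpha>) x K}"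
        by (rule finite_subset[OF _ fin]) force
    qed simp
    then show "real (lattice_count c x K) \<le> real (card {l \<in> int_lattice. l + y \<in> affine_copy (c + \<alpha>) x K})"
      unfolding lattice_count_def by simp
  qed
  then show ?thesis unfolding measure_affine_copy using pos by simp
qed

text \<open>The mirrored injection, from every translate of the smaller body into x + cK. It
  decomposes \<open>- y\<close> because \<open>K\<close> need not be symmetric.\<close>

lemma lattice_count_ge:
  fixes K :: "(real ^ 'n) set"
  assumes K: "convex K" "bounded K" and cov: "is_covering int_lattice (dilate \<alpha> K)" and pos: "0 < \<alpha>" "\<alpha> < c"
  shows "(c - \<alpha>) ^ CARD('n) * measure lebesgue K \<le> real (lattice_count c x K)"
proof -
  have "measure lebesgue (affine_copy (c - \<alpha>) x K) \<le> real (lattice_count c x K)"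
  proof (rule measure_le_of_count_le[OF affine_copy_measurable[OF K]])
    fix y
    obtain l0 k0 where y: "l0 \<in> int_lattice" "k0 \<in> K" "- y = l0 + \<alpha> *\<^sub>R k0" using coveringE[OF cov] .
    have "card {l \<in> int_lattice. l + y \<in> affine_copy (c - \<alpha>) x K} \<le> card {l \<in> int_lattice. l \<in> affine_copy c x K}"
    proof (rule card_inj_on_le[of "\<lambda>l. l - l0"])
      show "(\<lambda>l. l - l0) ` {l \<in> int_lattice. l + y \<in> affine_copy (c - \<alpha>) x K} \<subseteq> {l \<in> int_lattice. l \<in> affine_copy c x K}"
      proof (rule image_subsetI)
        fix l assume l: "l \<in> {l \<in> int_lattice. l + y \<in> affine_copy (c - \<alpha>) x K}"
        then obtain k where k: "k \<in> K" "l + y = x + (c - \<alpha>) *\<^sub>R k" unfolding affine_copy_def by blast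
        have "(c - \<alpha>) *\<^sub>R k + \<alpha> *\<^sub>R k0 \<in> (*\<^sub>R) (c - \<alpha> + \<alpha>) ` K"
          using K(1) pos k(1) y(2) by (intro affine_copy_add) auto
        then obtain k' where k': "k' \<in> K" "(c - \<alpha>) *\<^sub>R k + \<alpha> *\<^sub>R k0 = c *\<^sub>R k'" by auto
        have "y = - (l0 + \<alpha> *\<^sub>R k0)" using y(3) by (metis minus_minus)
        then have "l - l0 = (l + y) + \<alpha> *\<^sub>R k0" by simp
        also have "\<dots> = x + c *\<^sub>R k'" unfolding k(2) k'(2)[symmetric] by simp
        finally show "l - l0 \<in> {l \<in> int_lattice. l \<in> affine_copy c x K}"
          using l y(1) \<open>k' \<in> K\<close> int_lattice_diff unfolding affine_copy_def by blast
      qed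
      show "finite {l \<in> int_lattice. l \<in> affine_copy c x K}"
        by (intro finite_bounded_int_lattice affine_copy_measurable K)
    qed simp
    then show "real (card {l \<in> int_lattice. l + y \<in> affine_copy (c - \<alpha>) x K}) \<le> real (lattice_count c x K)"
      unfolding lattice_count_def by simp
  qed
  then show ?thesis unfolding measure_affine_copy using pos by simp
qed

lemma affine_copy_subset_sum:
  assumes "convex K" "0 < c" "0 < d" "l \<in> affine_copy c x K"
  shows "(\<lambda>y. l + y) ` dilate d K \<subseteq> affine_copy (c + d) x K"
proof
  fix z assume "z \<in> (\<lambda>y. l + y) ` dilate d K"
  then obtain k' where k': "k' \<in> K" "z = l + d *\<^sub>R k'" unfolding dilate_def by blast
  obtain k where k: "k \<in> K" "l = x + c *\<^sub>R k" using assms(4) unfolding affine_copy_def by blast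
  have "c *\<^sub>R k + d *\<^sub>R k' \<in> (*\<^sub>R) (c + d) ` K" using affine_copy_add assms k k' by blast
  then obtain k'' where "k'' \<in> K" "c *\<^sub>R k + d *\<^sub>R k' = (c + d) *\<^sub>R k''" by blast
  then have "z = x + (c + d) *\<^sub>R k''" unfolding k'(2) k(2) by (simp add: add.assoc)
  with \<open>k'' \<in> K\<close> show "z \<in> affine_copy (c + d) x K" unfolding affine_copy_def by blast
qed

text \<open>The copies of \<beta>K at the counted lattice points are disjoint and fit into one
  translate of (c + \<beta>)K; compare volumes.\<close>

lemma lattice_count_packing_le:
  fixes K :: "(real ^ 'n) set"
  assumes K: "convex K" "bounded K" and pack: "is_packing int_lattice (dilate \<beta> K)"
    and pos: "0 < \<beta>" "0 < c" and V: "0 < measure lebesgue K"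
  shows "real (lattice_count c x K) \<le> ((c + \<beta>) / \<beta>) ^ CARD('n)"
proof -
  let ?L = "{l \<in> int_lattice. l \<in> affine_copy c x K}"
  let ?D = "\<lambda>l. (\<lambda>y. l + y) ` dilate \<beta> K"
  have fin: "finite ?L" by (intro finite_bounded_int_lattice affine_copy_measurable K)
  have D: "?D l = affine_copy \<beta> l K" for l unfolding affine_copy_def dilate_def image_image ..
  have "real (card ?L) * (\<beta> ^ CARD('n) * measure lebesgue K) = (\<Sum>l\<in>?L. measure lebesgue (?D l))"
    unfolding D measure_affine_copy using pos by simp
  also have "\<dots> = measure lebesgue (\<Union>l\<in>?L. ?D l)"
  proof (rule measure_UNION'[symmetric, OF fin])
    show "?D l \<in> lmeasurable" for l unfolding D by (intro affine_copy_measurable K)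
    show "pairwise (\<lambda>i j. disjnt (?D i) (?D j)) ?L"
      using pack unfolding is_packing_def disjoint_family_on_def pairwise_def disjnt_def by blast
  qed
  also have "\<dots> \<le> measure lebesgue (affine_copy (c + \<beta>) x K)"
  proof (rule measure_mono_fmeasurable)
    show "(\<Union>l\<in>?L. ?D l) \<subseteq> affine_copy (c + \<beta>) x K"
      using affine_copy_subset_sum[OF K(1) pos(2,1)] by blast
    show "(\<Union>l\<in>?L. ?D l) \<in> sets lebesgue"
      using fin unfolding D by (intro sets.finite_UN fmeasurableD affine_copy_measurable K)
    show "affine_copy (c + \<beta>) x K \<in> lmeasurable" by (intro affine_copy_measurable K)
  qed
  also have "\<dots> = (c + \<beta>) ^ CARD('n) * measure lebesgue K" unfolding measure_affine_copy using pos by simp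
  finally have "(real (card ?L) * \<beta> ^ CARD('n)) * measure lebesgue K \<le> (c + \<beta>) ^ CARD('n) * measure lebesgue K"
    by (simp only: mult.assoc)
  then have "real (card ?L) * \<beta> ^ CARD('n) \<le> (c + \<beta>) ^ CARD('n)"
    by (rule mult_right_le_imp_le) (rule V)
  then show ?thesis using pos unfolding lattice_count_def power_divide by (simp add: pos_le_divide_eq)
qed

text \<open>\<open>K\<close> need not contain the origin, so a larger dilate contains a smaller one
  only up to a translation.\<close>

lemma affine_copy_mono:
  assumes "convex K" "0 < c" "c \<le> d" "k0 \<in> K"
  shows "affine_copy c x K \<subseteq> affine_copy d (x - (d - c) *\<^sub>R k0) K"
proof
  fix z assume "z \<in> affine_copy c x K"
  then obtain k where k: "k \<in> K" "z = x + c *\<^sub>R k" unfolding affine_copy_def by blast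
  show "z \<in> affine_copy d (x - (d - c) *\<^sub>R k0) K"
  proof (cases "c = d")
    case True
    then show ?thesis using k unfolding affine_copy_def by auto
  next
    case False
    then have "c *\<^sub>R k + (d - c) *\<^sub>R k0 \<in> (*\<^sub>R) (c + (d - c)) ` K"
      using assms k(1) by (intro affine_copy_add) auto
    then obtain k' where "k' \<in> K" "c *\<^sub>R k + (d - c) *\<^sub>R k0 = d *\<^sub>R k'" by auto
    then have "z = (x - (d - c) *\<^sub>R k0) + d *\<^sub>R k'" unfolding k(2) by (simp add: algebra_simps)
    with \<open>k' \<in> K\<close> show ?thesis unfolding affine_copy_def by blast
  qed
qed

text \<open>Lattice points l and l' in one translate of \<beta>K, given by k and k', would make
  their copies of \<beta>K meet in l + \<beta>k' = l' + \<beta>k.\<close>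

lemma lattice_count_packing_le_1:
  fixes K :: "(real ^ 'n) set"
  assumes K: "convex K" "bounded K" and pack: "is_packing int_lattice (dilate \<beta> K)"
    and pos: "0 < c" "c \<le> \<beta>"
  shows "lattice_count c x K \<le> 1"
proof -
  have "l = l'" if l: "l \<in> {l \<in> int_lattice. l \<in> affine_copy c x K}" "l' \<in> {l \<in> int_lattice. l \<in> affine_copy c x K}" for l l'
  proof -
    obtain k0 where "k0 \<in> K" using l unfolding affine_copy_def by blast
    have "l \<in> affine_copy \<beta> (x - (\<beta> - c) *\<^sub>R k0) K" "l' \<in> affine_copy \<beta> (x - (\<beta> - c) *\<^sub>R k0) K"
      using affine_copy_mono[OF K(1) pos \<open>k0 \<in> K\<close>] l by blast+
    then obtain k k' where k: "k \<in> K" "k' \<in> K" "l = (x - (\<beta> - c) *\<^sub>R k0) + \<beta> *\<^sub>R k" "l' = (x - (\<beta> - c) *\<^sub>R k0) + \<beta> *\<^sub>R k'"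
      unfolding affine_copy_def by blast
    have "l + \<beta> *\<^sub>R k' = l' + \<beta> *\<^sub>R k" unfolding k(3,4) by simp
    then have "(\<lambda>y. l + y) ` dilate \<beta> K \<inter> (\<lambda>y. l' + y) ` dilate \<beta> K \<noteq> {}"
      using k(1,2) unfolding dilate_def by blast
    then show "l = l'" using pack l unfolding is_packing_def disjoint_family_on_def by blast
  qed
  then have "card {l \<in> int_lattice. l \<in> affine_copy c x K} \<le> Suc 0"
    using finite_bounded_int_lattice[OF affine_copy_measurable(2)[OF K, of c x]] by (simp only: card_le_Suc0_iff_eq) blast
  then show ?thesis unfolding lattice_count_def by simp
qed

text \<open>The volume is the average count over the translates, and each translate of \<beta>K has
  at most one lattice point.\<close>

lemma packing_volume_le:
  fixes K :: "(real ^ 'n) set"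
  assumes K: "convex K" "bounded K" and pack: "is_packing int_lattice (dilate \<beta> K)" and pos: "0 < \<beta>"
  shows "\<beta> ^ CARD('n) * measure lebesgue K \<le> 1"
proof -
  have "measure lebesgue (affine_copy \<beta> 0 K) \<le> 1"
  proof (rule measure_le_of_count_le[OF affine_copy_measurable[OF K]])
    fix y :: "real ^ 'n"
    have "{l \<in> int_lattice. l + y \<in> affine_copy \<beta> 0 K} = {l \<in> int_lattice. l \<in> affine_copy \<beta> (- y) K}"
      unfolding affine_copy_def by (force simp: algebra_simps)
    then show "real (card {l \<in> int_lattice. l + y \<in> affine_copy \<beta> 0 K}) \<le> 1"
      using lattice_count_packing_le_1[OF K pack pos order_refl, of "- y"] unfolding lattice_count_def by simp
  qed
  then show ?thesis unfolding measure_affine_copy using pos by simp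
qed

lemma covering_volume_ge:
  fixes K :: "(real ^ 'n) set"
  assumes K: "convex K" "bounded K" and cov: "is_covering int_lattice (dilate \<alpha> K)" and pos: "0 < \<alpha>"
  shows "1 \<le> \<alpha> ^ CARD('n) * measure lebesgue K"
proof -
  have "1 \<le> measure lebesgue (affine_copy \<alpha> 0 K)"
  proof (rule count_le_imp_le_measure[OF affine_copy_measurable[OF K]])
    fix y :: "real ^ 'n"
    obtain l k where lk: "l \<in> int_lattice" "k \<in> K" "y = l + \<alpha> *\<^sub>R k" using coveringE[OF cov] .
    have "{l \<in> int_lattice. l + y \<in> affine_copy \<alpha> 0 K} \<subseteq> {l \<in> int_lattice. l \<in> affine_copy \<alpha> (- y) K}"
    proof
      fix l assume l: "l \<in> {l \<in> int_lattice. l + y \<in> affine_copy \<alpha> 0 K}"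
      then obtain k where "k \<in> K" "l + y = 0 + \<alpha> *\<^sub>R k" unfolding affine_copy_def by blast
      then have "l = - y + \<alpha> *\<^sub>R k" by (simp add: eq_neg_iff_add_eq_0 algebra_simps)
      with \<open>k \<in> K\<close> l show "l \<in> {l \<in> int_lattice. l \<in> affine_copy \<alpha> (- y) K}"
        unfolding affine_copy_def by blast
    qed
    then have "finite {l \<in> int_lattice. l + y \<in> affine_copy \<alpha> 0 K}"
      by (rule finite_subset) (intro finite_bounded_int_lattice affine_copy_measurable K)
    moreover have "- l \<in> {l \<in> int_lattice. l + y \<in> affine_copy \<alpha> 0 K}"
    proof -
      have "- l + y = 0 + \<alpha> *\<^sub>R k" unfolding lk(3) by simp
      then show ?thesis using lk(2) int_lattice_uminus[OF lk(1)] unfolding affine_copy_def by blast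
    qed
    ultimately have "0 < card {l \<in> int_lattice. l + y \<in> affine_copy \<alpha> 0 K}"
      unfolding card_gt_0_iff by blast
    then show "1 \<le> real (card {l \<in> int_lattice. l + y \<in> affine_copy \<alpha> 0 K})" by simp
  qed
  then show ?thesis unfolding measure_affine_copy using pos by simp
qed

section \<open>From covering and packing radii to actual dilates\<close>

lemma covering_exists:
  fixes K :: "(real ^ 'n) set"
  assumes "interior K \<noteq> {}"
  shows "\<exists>\<alpha>>0. is_covering int_lattice (dilate \<alpha> K)"
proof -
  obtain c e where e: "0 < e" "ball c e \<subseteq> K"
    using assms by (metis all_not_in_conv mem_interior)
  \<comment> \<open>The error of coordinatewise rounding has norm at most n, and the dilated
    inscribed ball has radius n + 1.\<close>
  define \<alpha> where "\<alpha> = (real CARD('n) + 1) / e"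
  have \<alpha>: "0 < \<alpha>" unfolding \<alpha>_def using e by simp
  have "y \<in> (\<Union>l\<in>int_lattice. (\<lambda>y. l + y) ` dilate \<alpha> K)" for y :: "real ^ 'n"
  proof -
    define w where "w = y - \<alpha> *\<^sub>R c"
    define l where "l = (\<chi> i. of_int \<lfloor>w $ i\<rfloor> :: real ^ 'n)"
    have l: "l \<in> int_lattice" unfolding int_lattice_iff l_def by simp
    have "norm (w - l) \<le> (\<Sum>i\<in>UNIV. \<bar>(w - l) $ i\<bar>)" by (rule norm_le_l1_cart)
    also have "\<dots> \<le> (\<Sum>i\<in>(UNIV::'n set). 1)"
    proof (rule sum_mono)
      fix i
      have "0 \<le> w $ i - of_int \<lfloor>w $ i\<rfloor>" "w $ i - of_int \<lfloor>w $ i\<rfloor> \<le> 1" by linarith+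
      then show "\<bar>(w - l) $ i\<bar> \<le> 1" unfolding l_def by simp
    qed
    also have "\<dots> < real CARD('n) + 1" by simp
    finally have nw: "norm (w - l) < real CARD('n) + 1" .
    define k where "k = c + (1 / \<alpha>) *\<^sub>R (w - l)"
    have "norm ((1 / \<alpha>) *\<^sub>R (w - l)) = norm (w - l) / \<alpha>" using \<alpha> by simp
    also have "\<dots> < (real CARD('n) + 1) / \<alpha>" by (rule divide_strict_right_mono[OF nw \<alpha>])
    also have "\<dots> = e" unfolding \<alpha>_def using e by simp
    finally have "norm ((1 / \<alpha>) *\<^sub>R (w - l)) < e" .
    then have "k \<in> K" using e(2) unfolding k_def by (auto simp: dist_norm subset_iff)
    moreover have "y = l + \<alpha> *\<^sub>R k" unfolding k_def w_def using \<alpha> by (simp add: scaleR_add_right)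
    ultimately show ?thesis using l unfolding dilate_def by blast
  qed
  then show ?thesis using \<alpha> unfolding is_covering_def by blast
qed

lemma packing_exists:
  fixes K :: "(real ^ 'n) set"
  assumes "bounded K"
  shows "\<exists>\<beta>>0. is_packing int_lattice (dilate \<beta> K)"
proof -
  obtain M where M: "0 < M" "\<And>x. x \<in> K \<Longrightarrow> norm x \<le> M" using assms by (metis bounded_pos)
  define \<beta> where "\<beta> = 1 / (4 * M)"
  have \<beta>: "0 < \<beta>" unfolding \<beta>_def using M by simp
  have "l = l'" if l: "l \<in> int_lattice" "l' \<in> int_lattice" "k \<in> K" "k' \<in> K" "l + \<beta> *\<^sub>R k = l' + \<beta> *\<^sub>R k'" for l l' :: "real ^ 'n" and k k'
  proof -
    have "l $ i = l' $ i" for i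
    proof -
      have "l $ i - l' $ i = \<beta> * (k' $ i - k $ i)"
        using arg_cong[OF l(5), of "\<lambda>v. v $ i"] by (simp add: algebra_simps)
      moreover have "\<bar>k' $ i - k $ i\<bar> \<le> 2 * M"
        using component_le_norm_cart[of k i] component_le_norm_cart[of k' i] M(2)[OF l(3)] M(2)[OF l(4)] by linarith
      ultimately have "\<bar>l $ i - l' $ i\<bar> \<le> \<beta> * (2 * M)" using \<beta> by (simp add: abs_mult mult_left_mono)
      also have "\<dots> < 1" unfolding \<beta>_def using M by simp
      finally have "\<bar>l $ i - l' $ i\<bar> < 1" .
      moreover obtain a a' where "l $ i = of_int a" "l' $ i = of_int a'"
        using l(1,2) unfolding int_lattice_iff Ints_def by blast
      ultimately have "\<bar>real_of_int (a - a')\<bar> < 1" by simp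
      then have "a = a'" by linarith
      then show ?thesis using \<open>l $ i = of_int a\<close> \<open>l' $ i = of_int a'\<close> by simp
    qed
    then show ?thesis by (simp add: vec_eq_iff)
  qed
  then have "is_packing int_lattice (dilate \<beta> K)"
    unfolding is_packing_def disjoint_family_on_def dilate_def by blast
  with \<beta> show ?thesis by blast
qed

text \<open>The radii need not be attained, so the strict bound on \<open>rho\<close> is spent on
  admissible dilates near them. \<open>Inf\<close> and \<open>Sup\<close> behave as intended because
  both sets are nonempty and the volume bounds the packing dilates; a positive \<open>Sup\<close>
  makes the quotient genuine.\<close>

lemma covering_packing_pair:
  fixes K :: "(real ^ 'n) set"
  assumes K: "convex K" "bounded K" "interior K \<noteq> {}" and V: "0 < measure lebesgue K"
    and rho: "rho K int_lattice < t"
  obtains \<alpha> \<beta> where "0 < \<alpha>" "0 < \<beta>" "is_covering int_lattice (dilate \<alpha> K)"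
    "is_packing int_lattice (dilate \<beta> K)" "\<alpha> < t * \<beta>"
proof -
  let ?C = "{\<alpha>. 0 < \<alpha> \<and> is_covering int_lattice (dilate \<alpha> K)}"
  let ?P = "{\<beta>. 0 < \<beta> \<and> is_packing int_lattice (dilate \<beta> K)}"
  obtain \<beta>0 where \<beta>0: "\<beta>0 \<in> ?P" using packing_exists[OF K(2)] by blast
  obtain \<alpha>0 where \<alpha>0: "\<alpha>0 \<in> ?C" using covering_exists[OF K(3)] by blast
  have "bdd_above ?P"
  proof (rule bdd_aboveI)
    fix \<beta> assume "\<beta> \<in> ?P"
    then have b: "0 < \<beta>" "is_packing int_lattice (dilate \<beta> K)" by simp_all
    have bV: "\<beta> ^ CARD('n) * measure lebesgue K \<le> 1" by (rule packing_volume_le[OF K(1,2) b(2,1)])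
    show "\<beta> \<le> max 1 (1 / measure lebesgue K)"
    proof (cases "\<beta> \<le> 1")
      case False
      then have "\<beta> \<le> \<beta> ^ CARD('n)" by (intro self_le_power) auto
      then have "\<beta> * measure lebesgue K \<le> \<beta> ^ CARD('n) * measure lebesgue K" using V by (intro mult_right_mono) auto
      with bV have "\<beta> * measure lebesgue K \<le> 1" by linarith
      with V have "\<beta> \<le> 1 / measure lebesgue K" by (simp only: pos_le_divide_eq)
      then show ?thesis by simp
    qed simp
  qed
  then have "\<beta>0 \<le> Sup ?P" using \<beta>0 by (intro cSup_upper)
  moreover have "0 < \<beta>0" using \<beta>0 by simp
  ultimately have Sup0: "0 < Sup ?P" by linarith
  have "Inf ?C / Sup ?P < t" using rho unfolding rho_def r_cov_def r_pack_def by simp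
  then have "Inf ?C < t * Sup ?P" using Sup0 by (simp add: pos_divide_less_eq)
  moreover have "?C \<noteq> {}" using \<alpha>0 by blast
  ultimately have "\<exists>\<alpha>\<in>?C. \<alpha> < t * Sup ?P" by (intro cInf_lessD)
  then obtain \<alpha> where \<alpha>: "\<alpha> \<in> ?C" "\<alpha> < t * Sup ?P" ..
  then have \<alpha>': "0 < \<alpha>" "is_covering int_lattice (dilate \<alpha> K)" by simp_all
  have t: "0 < t"
  proof (rule ccontr)
    assume "\<not> 0 < t"
    then have "t * Sup ?P \<le> 0" using Sup0 by (simp add: mult_nonpos_nonneg)
    with \<alpha>(2) \<alpha>'(1) show False by linarith
  qed
  then have "\<alpha> / t < Sup ?P" using \<alpha>(2) by (simp add: pos_divide_less_eq mult.commute)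
  moreover have "?P \<noteq> {}" using \<beta>0 by blast
  ultimately have "\<exists>\<beta>\<in>?P. \<alpha> / t < \<beta>" by (intro less_cSupD)
  then obtain \<beta> where \<beta>: "\<beta> \<in> ?P" "\<alpha> / t < \<beta>" ..
  then have \<beta>': "0 < \<beta>" "is_packing int_lattice (dilate \<beta> K)" by simp_all
  have "\<alpha> < t * \<beta>" using \<beta>(2) t by (simp only: pos_divide_less_eq mult.commute)
  from that[OF \<alpha>'(1) \<beta>'(1) \<alpha>'(2) \<beta>'(2) this] show thesis .
qed

section \<open>A lattice basis for construction A\<close>

lemma mod_ring_of_int_surj: "\<exists>z::int. of_int z = (a :: 'p::prime_card mod_ring)"
  by (rule exI[of _ "to_int_mod_ring a"]) (simp add: of_int_of_int_mod_ring)

lemma of_int_mod_ring_eq_0_iff: "of_int z = (0 :: 'p::prime_card mod_ring) \<longleftrightarrow> int CARD('p) dvd z"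
  by (simp add: of_int_eq_0_iff_char_dvd)

text \<open>Extend a basis of \<open>S\<close> by axis vectors and let \<open>I\<close> index the
  added ones. Then \<open>S\<close> and the coordinate space \<open>W\<close> over \<open>I\<close>
  together span everything, and counting shows that the sum is direct. So the coordinates outside
  \<open>I\<close> can be prescribed freely on \<open>S\<close> and determine its elements.\<close>

lemma coordinate_complement:
  fixes S :: "('p::prime_card mod_ring ^ 'n) set"
  assumes S: "vec.subspace S"
  obtains I where "card I = CARD('n) - vec.dim S"
    "\<And>x. \<exists>s\<in>S. \<forall>i. i \<notin> I \<longrightarrow> s $ i = x $ i"
    "\<And>x. x \<in> S \<Longrightarrow> (\<And>i. i \<notin> I \<Longrightarrow> x $ i = 0) \<Longrightarrow> x = 0"
proof -
  let ?q = "CARD('p mod_ring)"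
  have "card {0::'p mod_ring, 1} \<le> ?q" by (rule card_mono) simp_all
  then have q: "1 < ?q" by simp
  let ?ax = "\<lambda>i::'n. axis i (1::'p mod_ring)"
  obtain B where B: "B \<subseteq> S" "vec.independent B" "S \<subseteq> vec.span B" "card B = vec.dim S"
    by (rule vec.basis_exists)
  have spanB: "vec.span B = S" by (rule subset_antisym[OF vec.span_minimal[OF B(1) S] B(3)])
  obtain B' where B': "B \<subseteq> B'" "B' \<subseteq> B \<union> range ?ax" "vec.independent B'" "B \<union> range ?ax \<subseteq> vec.span B'"
    by (rule vec.maximal_independent_subset_extend[of B "B \<union> range ?ax"]) (use B(2) in auto)
  have spanB': "vec.span B' = UNIV"
  proof -
    have "x \<in> vec.span B'" for x
    proof -
      have "(\<Sum>i\<in>UNIV. x $ i *s ?ax i) \<in> vec.span B'"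
        using B'(4) by (intro vec.span_sum vec.span_scale) blast
      then show ?thesis by (simp only: basis_expansion)
    qed
    then show ?thesis by blast
  qed
  define E where "E = B' - B"
  define I where "I = {i. ?ax i \<in> E}"
  have EI: "E = ?ax ` I" using B'(2) unfolding I_def E_def by blast
  have inj: "inj ?ax" by (rule injI) (simp add: axis_eq_axis)
  have cI: "card I = card E" unfolding EI by (rule card_image[symmetric]) (rule inj_on_subset[OF inj subset_UNIV])
  have dimU: "card B' = CARD('n)"
  proof -
    have "card (UNIV :: ('p mod_ring ^ 'n) set) = ?q ^ vec.dim (UNIV :: ('p mod_ring ^ 'n) set)"
      by (rule card_subspace[OF vec.subspace_UNIV])
    moreover have "card (UNIV :: ('p mod_ring ^ 'n) set) = ?q ^ CARD('n)" by (rule CARD_vec)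
    ultimately have "vec.dim (UNIV :: ('p mod_ring ^ 'n) set) = CARD('n)"
      using power_inject_exp[OF q] by metis
    moreover have "card B' = vec.dim (UNIV :: ('p mod_ring ^ 'n) set)"
      by (rule vec.basis_card_eq_dim) (use B' spanB' in auto)
    ultimately show ?thesis by simp
  qed
  have cE: "card E = CARD('n) - vec.dim S"
    unfolding E_def dimU[symmetric] B(4)[symmetric] by (rule card_Diff_subset[OF _ B'(1)]) simp
  have le: "vec.dim S \<le> CARD('n)" unfolding dimU[symmetric] B(4)[symmetric] by (rule card_mono[OF _ B'(1)]) simp
  define W where "W = {x :: 'p mod_ring ^ 'n. \<forall>i. i \<notin> I \<longrightarrow> x $ i = 0}"
  have subW: "vec.subspace W" unfolding W_def by (rule vec.subspaceI) simp_all
  have spanE: "vec.span E = W"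
  proof (rule subset_antisym)
    have "E \<subseteq> W" unfolding EI W_def axis_def by auto
    then show "vec.span E \<subseteq> W" by (rule vec.span_minimal[OF _ subW])
    show "W \<subseteq> vec.span E"
    proof
      fix x assume x: "x \<in> W"
      have "(\<Sum>i\<in>UNIV. x $ i *s ?ax i) \<in> vec.span E"
      proof (rule vec.span_sum)
        fix i
        show "x $ i *s ?ax i \<in> vec.span E"
        proof (cases "i \<in> I")
          case True
          then show ?thesis unfolding EI by (intro vec.span_scale vec.span_base imageI)
        next
          case False
          with x have "x $ i = 0" unfolding W_def by blast
          then show ?thesis by (simp add: vec.span_zero)
        qed
      qed
      then show "x \<in> vec.span E" by (simp only: basis_expansion)
    qed
  qed
  have "vec.independent E" unfolding E_def using B'(3) by (rule vec.independent_mono) blast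
  then have dimW: "vec.dim W = CARD('n) - vec.dim S"
    unfolding spanE[symmetric] cE[symmetric] by (rule vec.dim_span_eq_card_independent)
  let ?add = "\<lambda>(x, y). x + y :: 'p mod_ring ^ 'n"
  have surj: "?add ` (S \<times> W) = UNIV"
  proof -
    have "B \<union> E = B'" using B'(1) unfolding E_def by blast
    then have "vec.span (B \<union> E) = UNIV" using spanB' by simp
    then have eq: "UNIV = {x + y |x y. x \<in> S \<and> y \<in> W}" unfolding vec.span_Un spanB spanE ..
    show ?thesis
    proof (rule UNIV_eq_I[symmetric])
      fix z
      have "z \<in> {x + y |x y. x \<in> S \<and> y \<in> W}" unfolding eq[symmetric] by simp
      then obtain x y where "x \<in> S" "y \<in> W" "z = x + y" by blast
      then show "z \<in> ?add ` (S \<times> W)" by (intro image_eqI[of _ _ "(x, y)"]) simp_all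
    qed
  qed
  have "card (S \<times> W) = ?q ^ vec.dim S * ?q ^ (CARD('n) - vec.dim S)"
    unfolding card_cartesian_product card_subspace[OF S] card_subspace[OF subW] dimW ..
  also have "\<dots> = ?q ^ CARD('n)" using le by (simp only: power_add[symmetric]) simp
  also have "\<dots> = card (?add ` (S \<times> W))" unfolding surj by (rule CARD_vec[symmetric])
  finally have injadd: "inj_on ?add (S \<times> W)" by (intro eq_card_imp_inj_on) simp_all
  have one: "\<exists>s\<in>S. \<forall>i. i \<notin> I \<longrightarrow> s $ i = x $ i" for x
  proof -
    have "x \<in> ?add ` (S \<times> W)" unfolding surj by simp
    then obtain s w where sw: "s \<in> S" "w \<in> W" "x = s + w" by auto
    have "s $ i = x $ i" if "i \<notin> I" for i using sw(2,3) that unfolding W_def by simp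
    with sw(1) show ?thesis by blast
  qed
  have two: "x = 0" if x: "x \<in> S" "\<And>i. i \<notin> I \<Longrightarrow> x $ i = 0" for x
  proof -
    have "- x \<in> W" unfolding W_def using x(2) by simp
    moreover have "0 \<in> S" "0 \<in> W" using S subW by (simp_all add: vec.subspace_0)
    ultimately have "(x, - x) = (0, 0)"
      using x(1) by (intro inj_onD[OF injadd]) simp_all
    then show ?thesis by simp
  qed
  show thesis by (rule that[OF cI[unfolded cE] one two])
qed

lemma reduce_mod_simps:
  "reduce_mod (v + w) = reduce_mod v + reduce_mod w"
  "reduce_mod (v - w) = reduce_mod v - reduce_mod w"
  "reduce_mod (- v) = - reduce_mod v"
  by (simp_all add: reduce_mod_def vec_eq_iff)

text \<open>After a permutation of coordinates the basis matrix is lower triangular: unit columns for the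
  coordinates outside \<open>I\<close>, and \<open>p\<close> times a unit vector for those in \<open>I\<close>.\<close>

lemma covol_dilate_construction_A:
  fixes S :: "('p::prime_card mod_ring ^ 'n) set"
  assumes S: "vec.subspace S" and t: "0 < t"
  shows "covol (dilate t (construction_A S)) = t ^ CARD('n) / real CARD('p) ^ vec.dim S"
proof -
  let ?p = "real CARD('p)"
  define s where "s = t / ?p"
  have p0: "0 < ?p" by simp
  have s0: "0 < s" unfolding s_def using t by simp
  obtain I where I: "card I = CARD('n) - vec.dim S"
    "\<And>x. \<exists>s\<in>S. \<forall>i. i \<notin> I \<longrightarrow> s $ i = x $ i"
    "\<And>x. x \<in> S \<Longrightarrow> (\<And>i. i \<notin> I \<Longrightarrow> x $ i = 0) \<Longrightarrow> x = 0"
    using coordinate_complement[OF S] by blast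
  have "\<forall>j. \<exists>b. b \<in> S \<and> (\<forall>i. i \<notin> I \<longrightarrow> b $ i = (axis j 1 :: 'p mod_ring ^ 'n) $ i)"
  proof
    fix j
    show "\<exists>b. b \<in> S \<and> (\<forall>i. i \<notin> I \<longrightarrow> b $ i = (axis j 1 :: 'p mod_ring ^ 'n) $ i)"
      using I(2)[of "axis j 1"] by blast
  qed
  from choice[OF this] obtain b where
    b': "\<forall>j. b j \<in> S \<and> (\<forall>i. i \<notin> I \<longrightarrow> b j $ i = (axis j 1 :: 'p mod_ring ^ 'n) $ i)" ..
  then have b: "\<And>j. b j \<in> S" "\<And>j i. i \<notin> I \<Longrightarrow> b j $ i = (axis j 1 :: 'p mod_ring ^ 'n) $ i" by blast+
  have "\<forall>ij. \<exists>z. of_int z = b (snd ij) $ fst ij" using mod_ring_of_int_surj by blast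
  from choice[OF this] obtain g where g: "\<forall>ij. of_int (g ij) = b (snd ij) $ fst ij" ..
  define \<gamma> where "\<gamma> i j = g (i, j)" for i j
  have \<gamma>: "of_int (\<gamma> i j) = b j $ i" for i j using g unfolding \<gamma>_def by simp
  define c where "c i j = (if j \<in> I then (if i = j then int CARD('p) else 0)
    else if i = j then 1 else if i \<in> I then \<gamma> i j else 0)" for i j
  define lift where "lift k = (\<chi> i. \<Sum>j\<in>UNIV. c i j * k $ j)" for k :: "int ^ 'n"
  have comb: "reduce_mod (lift k) = (\<Sum>j\<in>- I. of_int (k $ j) *s b j)" for k
  proof -
    have "of_int (\<Sum>j\<in>UNIV. c i j * k $ j) = (\<Sum>j\<in>- I. of_int (k $ j) * b j $ i)" for i
    proof -
      have e: "of_int (c i j * k $ j) = (if j \<in> - I then of_int (k $ j) * b j $ i else 0)" for j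
        unfolding c_def using b(2)[of i j] \<gamma>[of i j]
        by (auto simp: axis_def of_int_mod_ring_eq_0_iff mult.commute)
      show ?thesis unfolding of_int_sum e by (simp add: sum.If_cases Compl_eq)
    qed
    then show ?thesis unfolding reduce_mod_def lift_def by (simp add: vec_eq_iff)
  qed
  have in_S: "reduce_mod (lift k) \<in> S" for k
    unfolding comb using S b(1) by (intro vec.subspace_sum vec.subspace_scale)
  have onto: "\<exists>k. v = lift k" if v: "reduce_mod v \<in> S" for v
  proof -
    \<comment> \<open>\<open>k0\<close> reproduces \<open>v\<close> outside \<open>I\<close>. The
      remainder reduces to an element of \<open>S\<close> that is zero outside \<open>I\<close>,
      hence to 0, so the columns that are p times a unit vector absorb it.\<close>
    define k0 where "k0 = (\<chi> j. if j \<in> I then 0 else v $ j)"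
    have lift0: "lift k0 $ i = v $ i" if "i \<notin> I" for i
    proof -
      have "lift k0 $ i = (\<Sum>j\<in>{i}. c i j * k0 $ j)"
        unfolding lift_def vec_lambda_beta using that
        by (intro sum.mono_neutral_right) (auto simp: c_def)
      then show ?thesis using that by (simp add: c_def k0_def)
    qed
    have red0: "(reduce_mod (v - lift k0) :: 'p mod_ring ^ 'n) = 0"
    proof (rule I(3))
      show "reduce_mod (v - lift k0) \<in> S"
        unfolding reduce_mod_simps using S v in_S by (rule vec.subspace_diff)
      show "reduce_mod (v - lift k0) $ i = (0 :: 'p mod_ring)" if "i \<notin> I" for i
        unfolding reduce_mod_def using lift0[OF that] by simp
    qed
    have "(of_int (v $ i - lift k0 $ i) :: 'p mod_ring) = 0" for i
      using arg_cong[OF red0, of "\<lambda>x. x $ i"] unfolding reduce_mod_def by simp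
    then have dv: "int CARD('p) dvd v $ i - lift k0 $ i" for i unfolding of_int_mod_ring_eq_0_iff .
    define k where "k = (\<chi> j. if j \<in> I then (v $ j - lift k0 $ j) div int CARD('p) else v $ j)"
    have "lift k $ i = v $ i" for i
    proof -
      have kk: "k $ j = k0 $ j + (if j \<in> I then (v $ j - lift k0 $ j) div int CARD('p) else 0)" for j
        unfolding k_def k0_def by simp
      have "lift k $ i = lift k0 $ i + (\<Sum>j\<in>UNIV. c i j * (if j \<in> I then (v $ j - lift k0 $ j) div int CARD('p) else 0))"
        unfolding lift_def vec_lambda_beta kk distrib_left sum.distrib ..
      also have "(\<Sum>j\<in>UNIV. c i j * (if j \<in> I then (v $ j - lift k0 $ j) div int CARD('p) else 0))
          = (\<Sum>j\<in>UNIV. if j = i then (if i \<in> I then v $ i - lift k0 $ i else 0) else 0)"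
        by (intro sum.cong refl) (use dv in \<open>auto simp: c_def\<close>)
      also have "\<dots> = v $ i - lift k0 $ i" using lift0[of i] by simp
      finally show ?thesis by simp
    qed
    then show ?thesis by (intro exI[of _ k]) (simp add: vec_eq_iff)
  qed
  define D :: "real ^ 'n ^ 'n" where "D = (\<chi> i j. s * of_int (c i j))"
  have Dlift: "D *v real_vec k = s *\<^sub>R real_vec (lift k)" for k
    unfolding D_def real_vec_def lift_def matrix_vector_mult_def
    by (simp add: vec_eq_iff sum_distrib_left mult.assoc)
  have pre: "reduce_mod -` S = range lift" using onto in_S by (auto simp: vimage_def)
  have lat: "dilate t (construction_A S) = (*v) D ` int_lattice"
  proof -
    have "dilate t (construction_A S) = (\<lambda>k. s *\<^sub>R real_vec (lift k)) ` UNIV"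
      unfolding construction_A_def pre dilate_def image_image s_def by simp
    also have "\<dots> = (*v) D ` int_lattice" unfolding int_lattice_def image_image Dlift ..
    finally show ?thesis .
  qed
  have "det D = (\<Prod>i\<in>UNIV. D $ i $ i)"
    by (rule det_block_triangular[where I = I]) (auto simp: D_def c_def)
  also have "\<dots> = (\<Prod>i\<in>UNIV. s * (if i \<in> I then ?p else 1))"
    by (intro prod.cong refl) (simp add: D_def c_def)
  also have "\<dots> = s ^ CARD('n) * ?p ^ card I" by (simp add: prod.distrib prod.If_cases)
  finally have det: "det D = s ^ CARD('n) * ?p ^ card I" .
  then have "det D \<noteq> 0" using s0 p0 by simp
  then have "invertible D" by (simp add: invertible_det_nz)
  then have "covol (dilate t (construction_A S)) = \<bar>det D\<bar>" unfolding lat by (rule covol_matrix_image)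
  also have "\<dots> = det D" unfolding det using s0 by simp
  also have "\<dots> = t ^ CARD('n) / ?p ^ CARD('n) * ?p ^ card I" unfolding det by (simp add: s_def power_divide)
  also have "\<dots> = t ^ CARD('n) / ?p ^ vec.dim S"
  proof -
    have le: "vec.dim S \<le> CARD('n)"
    proof -
      have "CARD('p mod_ring) ^ vec.dim S \<le> CARD('p mod_ring) ^ CARD('n)"
        unfolding card_subspace[OF S, symmetric] CARD_vec[symmetric] by (rule card_mono) simp_all
      moreover have "1 < CARD('p mod_ring)" using prime_card[where 'a = 'p] prime_gt_1_nat by simp
      ultimately show ?thesis by (rule power_le_imp_le_exp[rotated])
    qed
    have "?p ^ CARD('n) = ?p ^ vec.dim S * ?p ^ card I" unfolding I(1) using le by (simp flip: power_add)
    then show ?thesis using p0 by simp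
  qed
  finally show ?thesis .
qed

section \<open>Construction A\<close>

lemma real_vec_simps:
  "real_vec (v + w) = real_vec v + real_vec w" "real_vec (v - w) = real_vec v - real_vec w"
  "real_vec (- v) = - real_vec v"
  by (simp_all add: real_vec_def vec_eq_iff)

lemma inj_real_vec: "inj (real_vec :: int ^ 'n \<Rightarrow> real ^ 'n)"
proof (rule injI)
  fix v w :: "int ^ 'n" assume eq: "real_vec v = real_vec w"
  have "v $ i = w $ i" for i using arg_cong[OF eq, of "\<lambda>x. x $ i"] unfolding real_vec_def by simp
  then show "v = w" unfolding vec_eq_iff by blast
qed

lemma card_real_vec: "card {v. real_vec v \<in> A} = card {l \<in> int_lattice. l \<in> A}"
proof -
  have "real_vec ` {v. real_vec v \<in> A} = {l \<in> int_lattice. l \<in> A}" unfolding int_lattice_def by blast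
  then show ?thesis using card_image[OF inj_on_subset[OF inj_real_vec subset_UNIV], of "{v. real_vec v \<in> A}"] by simp
qed

lemma finite_real_vec:
  fixes A :: "(real ^ 'n) set"
  assumes "bounded A"
  shows "finite {v. real_vec v \<in> A}"
proof (rule finite_imageD[of real_vec])
  show "finite (real_vec ` {v. real_vec v \<in> A})"
    by (rule finite_subset[OF _ finite_bounded_int_lattice[OF assms]]) (auto simp: int_lattice_def)
qed (rule inj_on_subset[OF inj_real_vec subset_UNIV])

definition residue_count :: "real \<Rightarrow> (real ^ 'n) set \<Rightarrow> 'p::prime_card mod_ring ^ 'n \<Rightarrow> real" where
  "residue_count c K u = real (card {z. real_vec z \<in> affine_copy c 0 K \<and> reduce_mod z = u})"

lemma sum_residue_count:
  fixes K :: "(real ^ 'n) set" and U :: "('p::prime_card mod_ring ^ 'n) set"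
  assumes "convex K" "bounded K"
  shows "sum (residue_count c K) U = real (card {z. real_vec z \<in> affine_copy c 0 K \<and> reduce_mod z \<in> U})"
proof -
  have fin: "finite {z. real_vec z \<in> affine_copy c 0 K}"
    by (intro finite_real_vec affine_copy_measurable assms)
  have "card (\<Union>u\<in>U. {z. real_vec z \<in> affine_copy c 0 K \<and> reduce_mod z = u})
      = (\<Sum>u\<in>U. card {z. real_vec z \<in> affine_copy c 0 K \<and> reduce_mod z = u})"
  proof (rule card_UN_disjoint)
    show "\<forall>u\<in>U. finite {z. real_vec z \<in> affine_copy c 0 K \<and> reduce_mod z = u}"
      by (intro ballI finite_subset[OF _ fin]) blast
  qed (simp, blast)
  moreover have "(\<Union>u\<in>U. {z. real_vec z \<in> affine_copy c 0 K \<and> reduce_mod z = u})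
      = {z. real_vec z \<in> affine_copy c 0 K \<and> reduce_mod z \<in> U}" by blast
  ultimately show ?thesis unfolding residue_count_def by simp
qed

lemma sum_residue_count_UNIV:
  fixes K :: "(real ^ 'n) set"
  assumes "convex K" "bounded K"
  shows "sum (residue_count c K) (UNIV :: ('p::prime_card mod_ring ^ 'n) set) = real (lattice_count c 0 K)"
  unfolding sum_residue_count[OF assms] lattice_count_def card_real_vec[symmetric] by simp

lemma reduce_mod_eqE:
  fixes z z' :: "int ^ 'n"
  assumes "(reduce_mod z :: 'p::prime_card mod_ring ^ 'n) = reduce_mod z'"
  obtains w where "z = z' + (\<chi> i. int CARD('p) * w $ i)"
proof -
  have "(of_int (z $ i - z' $ i) :: 'p mod_ring) = 0" for i
    using arg_cong[OF assms, of "\<lambda>x. x $ i"] unfolding reduce_mod_def by simp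
  then have dv: "int CARD('p) dvd z $ i - z' $ i" for i unfolding of_int_mod_ring_eq_0_iff .
  have "z = z' + (\<chi> i. int CARD('p) * (\<chi> i. (z $ i - z' $ i) div int CARD('p)) $ i)"
    using dv by (simp add: vec_eq_iff)
  then show thesis by (rule that)
qed

text \<open>A residue class is a translate of p times the integer lattice; dividing by p turns its
  points in cK into integer points of a translate of (c/p)K.\<close>

lemma residue_count_le:
  fixes K :: "(real ^ 'n) set" and u :: "'p::prime_card mod_ring ^ 'n"
  assumes K: "convex K" "bounded K" and B: "\<And>x. real (lattice_count (c / real CARD('p)) x K) \<le> B"
  shows "residue_count c K u \<le> B"
proof (cases "\<exists>z0. reduce_mod z0 = u")
  case False
  then have "residue_count c K u = 0" unfolding residue_count_def by simp
  also have "0 \<le> B" using order_trans[OF of_nat_0_le_iff B] .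
  finally show ?thesis .
next
  case True
  then obtain z0 where z0: "reduce_mod z0 = u" ..
  let ?p = "real CARD('p)"
  have p0: "0 < ?p" by simp
  define x where "x = - (1 / ?p) *\<^sub>R real_vec z0"
  let ?A = "{z. real_vec z \<in> affine_copy c 0 K \<and> reduce_mod z = u}"
  let ?L = "{v. real_vec v \<in> affine_copy (c / ?p) x K}"
  have finL: "finite ?L" by (intro finite_real_vec affine_copy_measurable K)
  have sub: "?A \<subseteq> (\<lambda>w. z0 + (\<chi> i. int CARD('p) * w $ i)) ` ?L"
  proof
    fix z assume z: "z \<in> ?A"
    then obtain k where k: "k \<in> K" "real_vec z = 0 + c *\<^sub>R k" unfolding affine_copy_def by blast
    from z z0 have "(reduce_mod z :: 'p mod_ring ^ 'n) = reduce_mod z0" by simp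
    then obtain w where w: "z = z0 + (\<chi> i. int CARD('p) * w $ i)" by (rule reduce_mod_eqE)
    have "real_vec z = real_vec z0 + ?p *\<^sub>R real_vec w"
      unfolding w by (simp add: real_vec_def vec_eq_iff)
    then have "?p *\<^sub>R real_vec w = c *\<^sub>R k - real_vec z0" unfolding k(2) by (simp add: algebra_simps)
    then have "(1 / ?p) *\<^sub>R (?p *\<^sub>R real_vec w) = (1 / ?p) *\<^sub>R (c *\<^sub>R k - real_vec z0)" by (rule arg_cong)
    then have "real_vec w = x + (c / ?p) *\<^sub>R k" unfolding x_def using p0 by (simp add: scaleR_diff_right)
    with k(1) have "w \<in> ?L" unfolding affine_copy_def by blast
    with w show "z \<in> (\<lambda>w. z0 + (\<chi> i. int CARD('p) * w $ i)) ` ?L" by blast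
  qed
  have "card ?A \<le> card ?L" by (rule surj_card_le[OF finL sub])
  also have "\<dots> = lattice_count (c / ?p) x K" unfolding lattice_count_def card_real_vec ..
  finally have "residue_count c K u \<le> real (lattice_count (c / ?p) x K)" unfolding residue_count_def by simp
  also have "\<dots> \<le> B" by (rule B)
  finally show ?thesis .
qed

lemma num_points_construction_A:
  fixes S :: "('p::prime_card mod_ring ^ 'n) set"
  assumes "0 < t"
  shows "num_points (dilate t (construction_A S)) K x
    = card {z. reduce_mod z \<in> S \<and> (t / real CARD('p)) *\<^sub>R real_vec z \<in> (\<lambda>y. y + x) ` K}"
proof -
  let ?s = "t / real CARD('p)"
  have s: "?s \<noteq> 0" using assms by simp
  have eq: "dilate t (construction_A S) \<inter> (\<lambda>y. y + x) ` K
      = (\<lambda>z. ?s *\<^sub>R real_vec z) ` {z. reduce_mod z \<in> S \<and> ?s *\<^sub>R real_vec z \<in> (\<lambda>y. y + x) ` K}"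
  proof -
    have D: "dilate t (construction_A S) = (\<lambda>z. ?s *\<^sub>R real_vec z) ` {z. reduce_mod z \<in> S}"
      unfolding construction_A_def dilate_def image_image vimage_def scaleR_scaleR times_divide_eq_right mult_1_right ..
    have gen: "f ` {z. P z} \<inter> A = f ` {z. P z \<and> f z \<in> A}" for f :: "int ^ 'n \<Rightarrow> real ^ 'n" and P A by blast
    show ?thesis unfolding D by (rule gen[of "\<lambda>z. ?s *\<^sub>R real_vec z" "\<lambda>z. reduce_mod z \<in> S" "(\<lambda>y. y + x) ` K"])
  qed
  have inj: "inj_on (\<lambda>z. ?s *\<^sub>R real_vec z) A" for A
  proof (rule inj_onI)
    fix z z' assume "?s *\<^sub>R real_vec z = ?s *\<^sub>R real_vec z'"
    then have "real_vec z = real_vec z'" by (rule scaleR_left_imp_eq[OF s])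
    then show "z = z'" by (rule injD[OF inj_real_vec])
  qed
  show ?thesis unfolding num_points_def eq by (rule card_image[OF inj])
qed

text \<open>Moving the centre to a lattice point changes the dilation factor by at most \<open>\<alpha>\<close>; hence
  all real translates are controlled by the translates by elements of the finite group.\<close>

lemma num_points_le_residue_count:
  fixes S :: "('p::prime_card mod_ring ^ 'n) set"
  assumes K: "convex K" "bounded K" and cov: "is_covering int_lattice (dilate \<alpha> K)"
    and pos: "0 < \<alpha>" "0 < t"
  shows "\<exists>u. real (num_points (dilate t (construction_A S)) K x)
    \<le> sum (residue_count (real CARD('p) / t + \<alpha>) K) ((+) u ` S)"
proof -
  let ?s = "t / real CARD('p)" and ?c = "real CARD('p) / t"
  have c0: "0 < ?c" using pos by simp
  have sc: "?c *\<^sub>R (?s *\<^sub>R v) = v" for v :: "real ^ 'n" using pos by simp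
  obtain l k0 where l: "l \<in> int_lattice" "k0 \<in> K" "?c *\<^sub>R x = l + \<alpha> *\<^sub>R k0" using coveringE[OF cov] .
  obtain z0 where z0: "l = real_vec z0" using l(1) unfolding int_lattice_def by blast
  \<comment> \<open>Recentring subtracts \<open>z0\<close> from every point, so the residues in
    \<open>S\<close> move to this coset.\<close>
  let ?U = "(+) (- reduce_mod z0 :: 'p mod_ring ^ 'n) ` S"
  let ?A = "{z. reduce_mod z \<in> S \<and> ?s *\<^sub>R real_vec z \<in> (\<lambda>y. y + x) ` K}"
  let ?A' = "{z. real_vec z \<in> affine_copy (?c + \<alpha>) 0 K \<and> (reduce_mod z :: 'p mod_ring ^ 'n) \<in> ?U}"
  have "card ?A \<le> card ?A'"
  proof (rule card_inj_on_le[of "\<lambda>z. z - z0"])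
    show "(\<lambda>z. z - z0) ` ?A \<subseteq> ?A'"
    proof (rule image_subsetI)
      fix z assume z: "z \<in> ?A"
      then obtain k where k: "k \<in> K" "?s *\<^sub>R real_vec z = k + x" by blast
      have "real_vec z = ?c *\<^sub>R (k + x)" unfolding k(2)[symmetric] sc ..
      also have "\<dots> = ?c *\<^sub>R k + (real_vec z0 + \<alpha> *\<^sub>R k0)" unfolding scaleR_add_right l(3) z0 ..
      finally have e: "real_vec (z - z0) = ?c *\<^sub>R k + \<alpha> *\<^sub>R k0" unfolding real_vec_simps by simp
      have "?c *\<^sub>R k + \<alpha> *\<^sub>R k0 \<in> (*\<^sub>R) (?c + \<alpha>) ` K" by (rule affine_copy_add[OF K(1) c0 pos(1) k(1) l(2)])
      then have "real_vec (z - z0) \<in> affine_copy (?c + \<alpha>) 0 K" unfolding e affine_copy_def by simp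
      moreover have "(reduce_mod (z - z0) :: 'p mod_ring ^ 'n) \<in> ?U"
        using z by (intro image_eqI[where x = "reduce_mod z"]) (simp_all add: reduce_mod_simps)
      ultimately show "z - z0 \<in> ?A'" by blast
    qed
    show "finite ?A'"
      by (rule finite_subset[OF _ finite_real_vec[OF affine_copy_measurable(2)[OF K]]]) blast
  qed (rule inj_onI, simp)
  then show ?thesis unfolding num_points_construction_A[OF pos(2)] sum_residue_count[OF K]
    by (intro exI[of _ "- reduce_mod z0"]) simp
qed

text \<open>Here the reflected centre is decomposed, which shrinks the body: integer points of the
  smaller copy, moved by \<open>- z0\<close>, land in the given translate.\<close>

lemma num_points_ge_residue_count:
  fixes S :: "('p::prime_card mod_ring ^ 'n) set"
  assumes K: "convex K" "bounded K" and cov: "is_covering int_lattice (dilate \<alpha> K)"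
    and pos: "0 < \<alpha>" "0 < t" "\<alpha> < real CARD('p) / t"
  shows "\<exists>u. sum (residue_count (real CARD('p) / t - \<alpha>) K) ((+) u ` S)
    \<le> real (num_points (dilate t (construction_A S)) K x)"
proof -
  let ?s = "t / real CARD('p)" and ?c = "real CARD('p) / t"
  have c0: "0 < ?c - \<alpha>" using pos by simp
  have sc: "?c *\<^sub>R (?s *\<^sub>R v) = v" "?s *\<^sub>R (?c *\<^sub>R v) = v" for v :: "real ^ 'n" using pos by simp_all
  obtain l k0 where l: "l \<in> int_lattice" "k0 \<in> K" "- (?c *\<^sub>R x) = l + \<alpha> *\<^sub>R k0" using coveringE[OF cov] .
  obtain z0 where z0: "l = real_vec z0" using l(1) unfolding int_lattice_def by blast
  let ?U = "(+) (reduce_mod z0 :: 'p mod_ring ^ 'n) ` S"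
  let ?A = "{z. reduce_mod z \<in> S \<and> ?s *\<^sub>R real_vec z \<in> (\<lambda>y. y + x) ` K}"
  let ?A' = "{z. real_vec z \<in> affine_copy (?c - \<alpha>) 0 K \<and> (reduce_mod z :: 'p mod_ring ^ 'n) \<in> ?U}"
  have "card ?A' \<le> card ?A"
  proof (rule card_inj_on_le[of "\<lambda>z. z - z0"])
    show "(\<lambda>z. z - z0) ` ?A' \<subseteq> ?A"
    proof (rule image_subsetI)
      fix z assume z: "z \<in> ?A'"
      then obtain k where k: "k \<in> K" "real_vec z = 0 + (?c - \<alpha>) *\<^sub>R k" unfolding affine_copy_def by blast
      obtain v where v: "v \<in> S" "(reduce_mod z :: 'p mod_ring ^ 'n) = reduce_mod z0 + v" using z by blast
      have "(?c - \<alpha>) *\<^sub>R k + \<alpha> *\<^sub>R k0 \<in> (*\<^sub>R) (?c - \<alpha> + \<alpha>) ` K"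
        by (rule affine_copy_add[OF K(1) c0 pos(1) k(1) l(2)])
      then obtain k' where k': "k' \<in> K" "(?c - \<alpha>) *\<^sub>R k + \<alpha> *\<^sub>R k0 = ?c *\<^sub>R k'" by auto
      have "real_vec z0 = - (?c *\<^sub>R x) - \<alpha> *\<^sub>R k0" unfolding l(3) z0 by simp
      then have "real_vec (z - z0) = (?c - \<alpha>) *\<^sub>R k + \<alpha> *\<^sub>R k0 + ?c *\<^sub>R x"
        unfolding real_vec_simps k(2) by simp
      also have "\<dots> = ?c *\<^sub>R (k' + x)" unfolding k'(2) scaleR_add_right ..
      finally have "?s *\<^sub>R real_vec (z - z0) = k' + x" by (simp only: sc)
      moreover have "(reduce_mod (z - z0) :: 'p mod_ring ^ 'n) \<in> S" using v by (simp add: reduce_mod_simps)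
      ultimately show "z - z0 \<in> ?A" using k'(1) by blast
    qed
    have "?A \<subseteq> {z. real_vec z \<in> affine_copy ?c (?c *\<^sub>R x) K}"
    proof
      fix z assume "z \<in> ?A"
      then obtain k where k: "k \<in> K" "?s *\<^sub>R real_vec z = k + x" by blast
      have "real_vec z = ?c *\<^sub>R (k + x)" unfolding k(2)[symmetric] sc ..
      then have "real_vec z = ?c *\<^sub>R x + ?c *\<^sub>R k" by (simp only: scaleR_add_right add.commute)
      with k(1) show "z \<in> {z. real_vec z \<in> affine_copy ?c (?c *\<^sub>R x) K}" unfolding affine_copy_def by blast
    qed
    then show "finite ?A" by (rule finite_subset[OF _ finite_real_vec[OF affine_copy_measurable(2)[OF K]]])
  qed (rule inj_onI, simp)
  then show ?thesis unfolding num_points_construction_A[OF pos(2)] sum_residue_count[OF K]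
    by (intro exI[of _ "reduce_mod z0"]) simp
qed

section \<open>Numerical consequences of the choice of p and r\<close>

lemma parameter_bounds:
  fixes n p r :: nat and b e :: real
  assumes n: "25 < n" and b: "0 < b" "b \<le> real n / (2 * log 2 (real n))"
    and e: "0 < e" "e < 1"
    and p_lower: "1024 / e\<^sup>2 * real n powr (1 + 2 * b) \<le> real p"
    and r_def: "r = 3 + nat \<lceil>real n / ln (real p) * (b * ln (real n) + ln 3)\<rceil>"
  defines "t \<equiv> real p powr (real r / real n)"
  shows "3 \<le> r" "r \<le> n" "1024 * real n \<le> e\<^sup>2 * real p"
    "t ^ n = real p ^ r"
    "(3 * real n powr b) ^ n * real p ^ 3 \<le> t ^ n"
    "real n powr b * (real p powr (- 3 / real n)) * t / real p \<le> e / (42 * real n)"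
proof -
  let ?n = "real n" and ?p = "real p"
  have n0: "26 \<le> ?n" using n by simp
  have e2: "0 < e\<^sup>2" "e\<^sup>2 \<le> 1" using e by (simp_all add: power_le_one)
  define N where "N = ?n powr (2 * b)"
  have N1: "1 \<le> N" unfolding N_def using n0 b by (intro ge_one_powr_ge_zero) auto
  define P where "P = 1024 / e\<^sup>2 * (?n * N)"
  have nN: "?n powr (1 + 2 * b) = ?n * N" unfolding N_def powr_add using n0 by simp
  have Pp: "P \<le> ?p" using p_lower unfolding P_def nN .
  have P_big: "1024 * (?n * N) \<le> P"
  proof -
    have "1 \<le> 1 / e\<^sup>2" using e2 by simp
    then have "1 * (1024 * (?n * N)) \<le> 1 / e\<^sup>2 * (1024 * (?n * N))"
      by (rule mult_right_mono) (use n0 N1 in simp)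
    then show ?thesis unfolding P_def by simp
  qed
  have nN0: "?n \<le> ?n * N" using n0 N1 by simp
  have P0: "0 < P" using P_big nN0 n0 by linarith
  have p1: "1 < ?p" using P_big Pp nN0 n0 by linarith
  have lnp: "0 < ln ?p" using p1 by simp
  show "1024 * ?n \<le> e\<^sup>2 * ?p"
  proof -
    have "e\<^sup>2 * P \<le> e\<^sup>2 * ?p" using Pp e2 by (intro mult_left_mono) auto
    moreover have "e\<^sup>2 * P = 1024 * (?n * N)" unfolding P_def using e2 by simp
    ultimately show ?thesis using nN0 by linarith
  qed
  define x where "x = ?n / ln ?p * (b * ln ?n + ln 3)"
  have lnn: "0 < ln ?n" using n0 by simp
  have x0: "0 < x" unfolding x_def using lnp lnn n0 b by (intro mult_pos_pos divide_pos_pos add_pos_pos) auto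
  have r_ge: "3 + x \<le> real r" and r_le: "real r \<le> 4 + x"
    unfolding r_def x_def[symmetric] using x0 by linarith+
  have xln: "x / ?n * ln ?p = b * ln ?n + ln 3" unfolding x_def using lnp n0 by simp
  show "3 \<le> r" unfolding r_def by simp
  \<comment> \<open>The lower bound on p makes ln p at least twice b ln n + ln 3, so
    \<open>r\<close> is at most n/2 + 4.\<close>
  show "r \<le> n"
  proof -
    have "ln (1024 * (?n * N)) \<le> ln ?p" using P_big Pp n0 N1 by (intro ln_mono) auto
    moreover have "ln (1024 * (?n * N)) = ln 1024 + (ln ?n + 2 * b * ln ?n)"
    proof -
      have "ln (1024 * (?n * N)) = ln 1024 + (ln ?n + ln N)" using n0 N1 by (simp add: ln_mult)
      then show ?thesis unfolding N_def using n0 by (simp add: ln_powr)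
    qed
    moreover have "2 * ln 3 \<le> ln (1024::real)"
    proof -
      have "2 * ln 3 = ln ((3::real) ^ 2)" by (subst ln_realpow) auto
      also have "\<dots> \<le> ln 1024" by simp
      finally show ?thesis .
    qed
    moreover have "2 * b * ln ?n = 2 * (b * ln ?n)" by simp
    ultimately have "2 * (b * ln ?n + ln 3) \<le> ln ?p" using lnn unfolding distrib_left by linarith
    then have "x \<le> ?n / 2" unfolding xln[symmetric] using lnp n0 by (simp add: field_simps)
    then have "real r \<le> 4 + ?n / 2" using r_le by linarith
    then have "real r \<le> ?n" using n0 by linarith
    then show ?thesis by simp
  qed
  show tn: "t ^ n = ?p ^ r"
  proof -
    have "t ^ n = t powr ?n" unfolding t_def using p1 n by (subst powr_realpow) auto
    also have "\<dots> = ?p powr (real r / ?n * ?n)" unfolding t_def by (simp add: powr_powr)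
    also have "\<dots> = ?p powr (real r)" using n0 by simp
    also have "\<dots> = ?p ^ r" using p1 by (intro powr_realpow) auto
    finally show ?thesis .
  qed
  \<comment> \<open>The unrounded exponent: p^x equals (3 n^b)^n. The summand 3 in \<open>r\<close>
    supplies the factor p^3, and rounding up costs \<open>t\<close> at most a factor
    p^(1/n).\<close>
  have px: "?p powr (x / ?n) = 3 * ?n powr b"
  proof -
    have "?p powr (x / ?n) = exp (x / ?n * ln ?p)" using p1 by (simp add: powr_def)
    also have "\<dots> = exp (b * ln ?n) * exp (ln 3)" unfolding xln exp_add ..
    also have "\<dots> = 3 * ?n powr b" using n0 by (simp add: powr_def)
    finally show ?thesis .
  qed
  have nb0: "0 < ?n powr b" using n0 by simp
  show "(3 * ?n powr b) ^ n * ?p ^ 3 \<le> t ^ n"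
  proof -
    have "(3 * ?n powr b) ^ n = (?p powr (x / ?n)) powr ?n" unfolding px using nb0 n by (subst powr_realpow) auto
    also have "\<dots> = ?p powr x" using n0 by (simp add: powr_powr)
    moreover have "?p ^ 3 = ?p powr 3" using p1 by simp
    ultimately have "(3 * ?n powr b) ^ n * ?p ^ 3 = ?p powr x * ?p powr 3" by (simp only:)
    also have "\<dots> = ?p powr (3 + x)" by (simp add: powr_add)
    also have "\<dots> \<le> ?p powr (real r)" using r_ge p1 by (intro powr_mono) auto
    also have "\<dots> = ?p ^ r" using p1 by (intro powr_realpow) auto
    finally show ?thesis unfolding tn .
  qed
  have t_le: "t \<le> ?p powr (4 / ?n) * (3 * ?n powr b)"
  proof -
    have "t \<le> ?p powr ((4 + x) / ?n)" unfolding t_def using r_le p1 n0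
      by (intro powr_mono divide_right_mono) auto
    also have "\<dots> = ?p powr (4 / ?n) * ?p powr (x / ?n)" by (simp add: add_divide_distrib powr_add)
    finally show ?thesis unfolding px .
  qed
  have N2: "N \<le> 2 ^ n"
  proof -
    have l2: "0 < log 2 ?n" using n0 by simp
    have "2 * b * log 2 ?n \<le> ?n" using b(2) l2 by (simp add: pos_le_divide_eq mult.commute mult.left_commute)
    then have "2 powr (2 * b * log 2 ?n) \<le> 2 powr ?n" by (intro powr_mono) auto
    moreover have "2 powr (2 * b * log 2 ?n) = (2 powr (log 2 ?n)) powr (2 * b)" by (simp add: powr_powr mult.commute)
    moreover have "2 powr (log 2 ?n) = ?n" using n0 by simp
    ultimately show ?thesis unfolding N_def by (simp add: powr_realpow)
  qed
  have P8: "P \<le> (8 / e) ^ n"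
  proof -
    have "(2::real) ^ 10 \<le> 2 ^ n" using n by (intro power_increasing) auto
    then have a: "1024 \<le> (2::real) ^ n" by simp
    have b': "?n \<le> 2 ^ n" using less_exp[of n] by (metis less_imp_le of_nat_le_iff of_nat_numeral of_nat_power)
    have c: "e ^ n \<le> e\<^sup>2" using e n by (intro power_decreasing) auto
    have "1024 * (?n * N) \<le> 2 ^ n * (2 ^ n * 2 ^ n)"
      using a b' N2 N1 n0 by (intro mult_mono) auto
    also have "\<dots> = 8 ^ n" by (simp flip: power_mult_distrib)
    finally have "1024 * (?n * N) / e\<^sup>2 \<le> 8 ^ n / e ^ n"
      using c e by (intro frac_le) auto
    then show ?thesis unfolding P_def power_divide by simp
  qed
  \<comment> \<open>The exponent is negative, so the lower bound \<open>P\<close> may replace p.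
    \<open>P8\<close> bounds the n-th root of \<open>P\<close>: each of 1024, n and n^(2b) is at
    most 2^n, the last by the hypothesis on \<open>b\<close>.\<close>
  have "?p powr (1 / ?n - 1) \<le> P powr (1 / ?n - 1)"
    using P0 Pp n0 by (intro powr_mono2') auto
  also have "\<dots> = P powr (1 / ?n) / P" using P0 by (simp add: powr_diff)
  also have "\<dots> \<le> (8 / e) / P"
  proof (rule divide_right_mono)
    have "P powr (1 / ?n) \<le> ((8 / e) ^ n) powr (1 / ?n)" using P8 P0 by (intro powr_mono2) auto
    also have "\<dots> = ((8 / e) powr ?n) powr (1 / ?n)" using e by (simp add: powr_realpow)
    also have "\<dots> = 8 / e" unfolding powr_powr using n0 e by simp
    finally show "P powr (1 / ?n) \<le> 8 / e" .
  qed (use P0 in simp)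
  finally have main: "?p powr (1 / ?n - 1) \<le> (8 / e) / P" .
  have "?n powr b * (?p powr (- 3 / ?n)) * t / ?p
      \<le> ?n powr b * (?p powr (- 3 / ?n)) * (?p powr (4 / ?n) * (3 * ?n powr b)) / ?p"
    using t_le p1 by (intro divide_right_mono mult_left_mono) auto
  also have "\<dots> = 3 * (?n powr b * ?n powr b) * (?p powr (- 3 / ?n) * ?p powr (4 / ?n) * ?p powr (- 1))"
    using p1 by (simp add: powr_minus_divide)
  also have "?n powr b * ?n powr b = N" unfolding N_def by (simp flip: powr_add)
  also have "?p powr (- 3 / ?n) * ?p powr (4 / ?n) * ?p powr (- 1) = ?p powr (1 / ?n - 1)"
  proof -
    have "- 3 / ?n + 4 / ?n + - 1 = 1 / ?n - 1" using n0 by (simp add: field_simps)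
    then show ?thesis by (simp only: powr_add[symmetric])
  qed
  also have "3 * N * ?p powr (1 / ?n - 1) \<le> 3 * N * ((8 / e) / P)"
    using main N1 by (intro mult_left_mono) auto
  also have "\<dots> = 24 / 1024 * (e / ?n)"
    unfolding P_def using N1 e n0 by (simp add: field_simps power2_eq_square)
  \<comment> \<open>1024/24 is slightly above 42, the constant of the conclusion.\<close>
  also have "\<dots> \<le> 1 / 42 * (e / ?n)" using e n0 by (intro mult_right_mono) auto
  finally show "?n powr b * (?p powr (- 3 / ?n)) * t / ?p \<le> e / (42 * ?n)" by simp
qed

text \<open>The exponential bound gives c/21 + (c/21)^2 \<le> 2c/21 < c/10. The 42 in
  \<open>parameter_bounds\<close> is chosen to meet the hypothesis.\<close>

lemma power_near_1:
  fixes x c :: real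
  assumes "0 \<le> x" "2 * real n * x \<le> c / 21" "0 < c" "c < 1" "1 \<le> n"
  shows "(1 + 2 * x) ^ n \<le> 1 + c / 10" "1 - c / 10 \<le> (1 - 2 * x) ^ n"
proof -
  have x2: "2 * x \<le> 1"
  proof -
    have "2 * x * 1 \<le> 2 * x * real n" using assms by (intro mult_left_mono) auto
    then show ?thesis using assms by (simp add: mult_ac)
  qed
  have "(1 + 2 * x) ^ n \<le> exp (2 * x) ^ n" using assms by (intro power_mono exp_ge_add_one_self) auto
  also have "\<dots> = exp (real n * (2 * x))" by (rule exp_of_nat_mult[symmetric])
  also have "\<dots> \<le> exp (c / 21)" using assms by (simp add: mult_ac)
  also have "\<dots> \<le> 1 + c / 21 + (c / 21)\<^sup>2" using assms by (intro exp_bound) auto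
  also have "(c / 21)\<^sup>2 \<le> c / 21"
    unfolding power2_eq_square using assms by (intro mult_left_le) auto
  finally show "(1 + 2 * x) ^ n \<le> 1 + c / 10" using assms by simp
  have "1 + real n * (- (2 * x)) \<le> (1 + - (2 * x)) ^ n" using x2 by (intro Bernoulli_inequality) simp
  then show "1 - c / 10 \<le> (1 - 2 * x) ^ n" using assms by (simp add: mult_ac)
qed

lemma residue_count_hashing:
  fixes K :: "(real ^ 'n) set" and r :: nat and c :: real
  defines "p \<equiv> real CARD('p::prime_card)"
  defines "l \<equiv> real (lattice_count c 0 K) * p ^ r / p ^ CARD('n)"
  assumes n: "26 \<le> CARD('n)" and r: "3 \<le> r" "r \<le> CARD('n)"
    and K: "convex K" "bounded K"
    and B: "0 < B" "2 * p ^ 3 * B \<le> l" "\<And>x. real (lattice_count (c / p) x K) \<le> B"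
    and \<epsilon>: "0 < \<epsilon>" "\<epsilon> < 1" and \<delta>: "0 < \<delta>" "\<delta> < 1"
    and q: "1024 * real CARD('n) \<le> (\<epsilon> * \<delta>)\<^sup>2 * p"
  shows "real (card {S \<in> (Gr r :: ('p mod_ring ^ 'n) set set). \<exists>x. \<epsilon> / 2 * l \<le> \<bar>sum (residue_count c K) ((+) x ` S) - l\<bar>})
    < \<delta> / 2 * real (card (Gr r :: ('p mod_ring ^ 'n) set set))"
proof -
  have q_eq: "real CARD('p mod_ring) = p" unfolding p_def by simp
  have l_eq: "sum (residue_count c K) (UNIV :: ('p mod_ring ^ 'n) set) * p ^ r / p ^ CARD('n) = l"
    unfolding sum_residue_count_UNIV[OF K] l_def ..
  have f: "0 \<le> residue_count c K u \<and> residue_count c K u \<le> B" for u :: "'p mod_ring ^ 'n"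
  proof
    show "0 \<le> residue_count c K u" unfolding residue_count_def by simp
    show "residue_count c K u \<le> B" by (rule residue_count_le[OF K]) (rule B(3)[unfolded p_def])
  qed
  have "2 \<le> r" using r by simp
  from linear_hashing[where f = "residue_count c K :: 'p mod_ring ^ 'n \<Rightarrow> real" and r = r and B = B and \<epsilon> = \<epsilon> and \<delta> = \<delta>,
      OF n this r(2) f B(1) _ \<epsilon> \<delta>, unfolded q_eq, unfolded l_eq, OF B(2) q]
  show ?thesis unfolding Gr_def .
qed

text \<open>If \<open>c \<le> \<beta>\<close>, packing leaves at most one point. Otherwise c +
  \<beta> \<le> 2c, and packing allows at most (2c/\<beta>)^n points. The volume of the covering
  dilate and \<alpha> < nb \<beta> bound \<beta> from below, and the 3 in the bound on
  \<open>t\<close> beats this 2.\<close>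

lemma lattice_count_multiplicity_le:
  fixes K :: "(real ^ 'n) set" and p t \<alpha> \<beta> nb c :: real
  assumes K: "convex K" "bounded K" and V: "0 < measure lebesgue K"
    and pack: "is_packing int_lattice (dilate \<beta> K)"
    and pos: "0 < \<alpha>" "0 < \<beta>" "0 < t" "0 < p" "0 < nb" "0 < c"
    and \<alpha>\<beta>: "\<alpha> < nb * \<beta>" "1 \<le> \<alpha> ^ CARD('n) * measure lebesgue K"
    and t: "(3 * nb) ^ CARD('n) * p ^ 3 \<le> t ^ CARD('n)"
    and c: "(c * t) ^ CARD('n) \<le> 2"
  shows "real (lattice_count c x K) \<le> max 1 (2 * (2 / 3) ^ CARD('n) * measure lebesgue K / p ^ 3)"
proof (cases "c \<le> \<beta>")
  case True
  have "lattice_count c x K \<le> 1" by (rule lattice_count_packing_le_1[OF K pack pos(6) True])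
  then show ?thesis by (simp add: le_max_iff_disj)
next
  case False
  let ?n = "CARD('n)" and ?V = "measure lebesgue K"
  have "real (lattice_count c x K) \<le> ((c + \<beta>) / \<beta>) ^ ?n"
    by (rule lattice_count_packing_le[OF K pack pos(2,6) V])
  also have "\<dots> \<le> (2 * c / \<beta>) ^ ?n"
    using False pos by (intro power_mono divide_right_mono) auto
  also have "\<dots> = 2 ^ ?n * c ^ ?n / \<beta> ^ ?n" by (simp add: power_mult_distrib power_divide)
  also have "\<dots> \<le> 2 * (2 / 3) ^ ?n * ?V / p ^ 3"
  proof -
    have "\<alpha> ^ ?n \<le> (nb * \<beta>) ^ ?n" using \<alpha>\<beta>(1) pos by (intro power_mono) auto
    then have "\<alpha> ^ ?n * ?V \<le> (nb * \<beta>) ^ ?n * ?V" using V by (intro mult_right_mono) auto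
    with \<alpha>\<beta>(2) have 1: "1 \<le> nb ^ ?n * \<beta> ^ ?n * ?V" unfolding power_mult_distrib by linarith
    have 2: "c ^ ?n * (3 ^ ?n * nb ^ ?n * p ^ 3) \<le> 2"
    proof -
      have "c ^ ?n * ((3 * nb) ^ ?n * p ^ 3) \<le> c ^ ?n * t ^ ?n" by (rule mult_left_mono[OF t]) (use pos in simp)
      also have "\<dots> = (c * t) ^ ?n" by (simp only: power_mult_distrib)
      finally show ?thesis using c unfolding power_mult_distrib by linarith
    qed
    have "(c ^ ?n * 3 ^ ?n * p ^ 3) * 1 \<le> (c ^ ?n * 3 ^ ?n * p ^ 3) * (nb ^ ?n * \<beta> ^ ?n * ?V)"
      by (rule mult_left_mono[OF 1]) (use pos in simp)
    also have "\<dots> = (c ^ ?n * (3 ^ ?n * nb ^ ?n * p ^ 3)) * (\<beta> ^ ?n * ?V)" by (simp only: mult_ac)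
    also have "\<dots> \<le> 2 * (\<beta> ^ ?n * ?V)" by (rule mult_right_mono[OF 2]) (use pos V in simp)
    finally have "c ^ ?n * 3 ^ ?n * p ^ 3 \<le> 2 * (\<beta> ^ ?n * ?V)" by simp
    then have "2 ^ ?n * (c ^ ?n * 3 ^ ?n * p ^ 3) \<le> 2 ^ ?n * (2 * (\<beta> ^ ?n * ?V))" by (rule mult_left_mono) simp
    then have "2 ^ ?n * c ^ ?n / \<beta> ^ ?n \<le> 2 * 2 ^ ?n * ?V / (3 ^ ?n * p ^ 3)"
      using pos by (simp add: divide_simps mult_ac)
    also have "\<dots> = 2 * (2 / 3) ^ ?n * ?V / p ^ 3" by (simp add: power_divide)
    finally show ?thesis .
  qed
  finally show ?thesis by simp
qed

theorem theorem1p4: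
  fixes K :: "(real ^ 'n) set"
    and b \<delta> \<epsilon> :: real
    and n p r :: nat
  assumes n_def: "n = CARD('n)"
    and n_gt: "n > 25"
    and K: "bounded K" "convex K" "interior K \<noteq> {}"
    and b: "0 < b" "b \<le> real n / (2 * log 2 (real n))"
    and rho: "rho K int_lattice < real n powr b"
    and \<delta>: "0 < \<delta>" "\<delta> < 1"
    and \<epsilon>: "0 < \<epsilon>" "\<epsilon> < 1"
    and vol: "measure lebesgue K
      \<ge> (exp 1 * 2 ^ 33) * (1 / (\<epsilon> * \<delta>)) ^ 6 * real n powr (3 * (1 + 2 * b))"
    and p_def: "p = CARD('p::prime_card)"
    and p_lower: "1024 / (\<epsilon> * \<delta>)\<^sup>2 * real n powr (1 + 2 * b) \<le> real p"
    and p_upper: "real p \<le> 2048 / (\<epsilon> * \<delta>)\<^sup>2 * real n powr (1 + 2 * b)"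
    and r_def: "r = 3 + nat \<lceil>real n / ln (real p) * (b * ln (real n) + ln 3)\<rceil>"
  shows "(\<forall>L \<in> set_pmf (construction_A_ensemble TYPE('p) r :: (real ^ 'n) set pmf).
            covol (dilate (real p powr (real r / real n)) L) = 1) \<and>
         measure_pmf.prob (construction_A_ensemble TYPE('p) r :: (real ^ 'n) set pmf)
           {L. eta K (dilate (real p powr (real r / real n)) L) \<ge> \<epsilon>} < \<delta>"
proof -
  let ?V = "measure lebesgue K" and ?p = "real p" and ?n = "real n"
  let ?Gr = "Gr r :: ('p mod_ring ^ 'n) set set"
  define t where "t = ?p powr (real r / ?n)"
  define e where "e = \<epsilon> * \<delta>"
  have e_le: "\<epsilon> * \<delta> \<le> \<epsilon>" using \<epsilon> \<delta> by (intro mult_left_le) simp_all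
  have "0 < \<epsilon> * \<delta>" using \<epsilon> \<delta> by simp
  with e_le \<epsilon> have e: "0 < e" "e < 1" "e \<le> \<epsilon>" unfolding e_def by linarith+
  note pb = parameter_bounds[OF n_gt b e(1,2) p_lower[folded e_def] r_def, folded t_def]
  have n0: "26 \<le> ?n" using n_gt by simp
  have p0: "0 < ?p" unfolding p_def by simp
  have t0: "0 < t" unfolding t_def using p0 by simp
  \<comment> \<open>Since 2^33 = 2048^3, the volume hypothesis is exp 1 times the cube of the upper
    bound on p.\<close>
  have V_p: "exp 1 * ?p ^ 3 \<le> ?V"
  proof -
    have "?p ^ 3 \<le> (2048 / e\<^sup>2 * ?n powr (1 + 2 * b)) ^ 3"
      using p_upper unfolding e_def by (intro power_mono) simp_all
    also have "\<dots> = 2 ^ 33 * (1 / e) ^ 6 * (?n powr (1 + 2 * b)) ^ 3"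
      by (simp add: power_mult_distrib power_divide flip: power_mult)
    also have "(?n powr (1 + 2 * b)) ^ 3 = ?n powr (3 * (1 + 2 * b))"
      using n0 by (subst powr_realpow[symmetric]) (auto simp: powr_powr mult.commute)
    finally have "exp 1 * ?p ^ 3 \<le> exp 1 * (2 ^ 33 * (1 / e) ^ 6 * ?n powr (3 * (1 + 2 * b)))"
      by (intro mult_left_mono) simp_all
    also have "\<dots> \<le> ?V" using vol unfolding e_def by (simp only: mult.assoc)
    finally show ?thesis .
  qed
  have exp1: "5 / 2 \<le> exp (1::real)" using exp_lower_Taylor_quadratic[of 1] by simp
  have V_p': "5 / 2 * ?p ^ 3 \<le> ?V" using mult_right_mono[OF exp1, of "?p ^ 3"] V_p by simp
  have p3: "0 < ?p ^ 3" using p0 by simp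
  then have V0: "0 < ?V" using V_p' by linarith
  have pV: "?p ^ 3 \<le> ?V" using V_p' p3 by linarith
  obtain \<alpha> \<beta> where ab: "0 < \<alpha>" "0 < \<beta>" "is_covering int_lattice (dilate \<alpha> K)"
    "is_packing int_lattice (dilate \<beta> K)" "\<alpha> < ?n powr b * \<beta>"
    using covering_packing_pair[OF K(2,1,3) V0 rho] .
  have \<alpha>V: "1 \<le> \<alpha> ^ CARD('n) * ?V" by (rule covering_volume_ge[OF K(2,1) ab(3,1)])
  have \<beta>V: "\<beta> ^ n * ?V \<le> 1" unfolding n_def by (rule packing_volume_le[OF K(2,1) ab(4,2)])
  have \<beta>_le: "\<beta> \<le> ?p powr (- 3 / ?n)"
  proof (rule power_le_imp_le_base)
    have "\<beta> ^ n * ?p ^ 3 \<le> \<beta> ^ n * ?V"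
      by (rule mult_left_mono[OF pV]) (use ab(2) in simp)
    then have "\<beta> ^ n * ?p ^ 3 \<le> 1" using \<beta>V by linarith
    then have "\<beta> ^ n \<le> 1 / ?p ^ 3" using p3 by (simp only: pos_le_divide_eq)
    also have "\<dots> = ?p powr (- 3)" using p0 by (simp add: powr_minus_divide)
    also have "\<dots> = (?p powr (- 3 / ?n)) powr ?n" using n0 by (simp add: powr_powr)
    also have "\<dots> = (?p powr (- 3 / ?n)) ^ n" using p0 n_gt by (subst powr_realpow) auto
    finally show "\<beta> ^ Suc (n - 1) \<le> (?p powr (- 3 / ?n)) ^ Suc (n - 1)" using n_gt by simp
  qed simp
  \<comment> \<open>The change \<alpha> of the dilation factor, relative to the factor p/t
    itself.\<close>
  define a where "a = \<alpha> * t / ?p"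
  have a0: "0 < a" unfolding a_def using ab t0 p0 by simp
  have a_le: "a \<le> e / (42 * ?n)"
  proof -
    have "a \<le> (?n powr b * ?p powr (- 3 / ?n)) * t / ?p"
      unfolding a_def
    proof (intro divide_right_mono mult_right_mono)
      have "?n powr b * \<beta> \<le> ?n powr b * ?p powr (- 3 / ?n)" by (rule mult_left_mono[OF \<beta>_le]) simp
      then show "\<alpha> \<le> ?n powr b * ?p powr (- 3 / ?n)" using ab(5) by linarith
    qed (use t0 p0 in simp_all)
    also have "\<dots> \<le> e / (42 * ?n)" by (rule pb(6))
    finally show ?thesis .
  qed
  have na: "2 * ?n * a \<le> \<epsilon> / 21"
  proof -
    have "a * (42 * ?n) \<le> e" using a_le n0 by (simp add: pos_le_divide_eq)
    moreover have "2 * ?n * a = a * (42 * ?n) / 21" by simp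
    ultimately show ?thesis using e(3) by linarith
  qed
  have a1: "2 * a < 1"
  proof -
    have "26 * a \<le> ?n * a" using n0 a0 by (intro mult_right_mono) auto
    then show ?thesis using na \<epsilon> by linarith
  qed
  note near = power_near_1[of a n \<epsilon>, OF less_imp_le[OF a0] na \<epsilon>]
  have near1: "(1 + 2 * a) ^ n \<le> 1 + \<epsilon> / 10" "1 - \<epsilon> / 10 \<le> (1 - 2 * a) ^ n"
    using near n_gt by simp_all
  define B where "B = max 1 (2 * (2 / 3) ^ CARD('n) * ?V / ?p ^ 3)"
  have B0: "0 < B" unfolding B_def by simp
  \<comment> \<open>The multiplicity condition of the hashing lemma. It asks for 9/10 of the volume
    because the shrunken body only guarantees a mean of (1 - \<epsilon>/10) \<open>?V\<close>. The
    case \<open>B = 1\<close> uses the factor exp 1 \<ge> 5/2 in the volume hypothesis.\<close>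
  have BV: "2 * ?p ^ 3 * B \<le> 9 / 10 * ?V"
  proof -
    have "2 * ?p ^ 3 * 1 \<le> 9 / 10 * ?V" using V_p' p3 by linarith
    moreover have "2 * ?p ^ 3 * (2 * (2 / 3) ^ CARD('n) * ?V / ?p ^ 3) \<le> 9 / 10 * ?V"
    proof -
      have "(2 / 3 :: real) ^ CARD('n) \<le> (2 / 3) ^ 4" using n_gt unfolding n_def by (intro power_decreasing) auto
      then have "4 * (2 / 3 :: real) ^ CARD('n) \<le> 9 / 10" by (simp add: power_divide)
      then have "4 * (2 / 3) ^ CARD('n) * ?V \<le> 9 / 10 * ?V" by (rule mult_right_mono) (use V0 in simp)
      moreover have "2 * ?p ^ 3 * (2 * (2 / 3) ^ CARD('n) * ?V / ?p ^ 3) = 4 * (2 / 3) ^ CARD('n) * ?V" using p3 by simp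
      ultimately show ?thesis by simp
    qed
    moreover have "B = 1 \<or> B = 2 * (2 / 3) ^ CARD('n) * ?V / ?p ^ 3" unfolding B_def by linarith
    ultimately show ?thesis by (elim disjE) (simp_all only:)
  qed
  \<comment> \<open>The average weight of a coset of \<open>S\<close>: all integer points of cK
    times the share p^(r-n) of the residues in one coset. As t^n = p^r, it is comparable with
    \<open>?V\<close> without further normalisation.\<close>
  define L where "L c = real (lattice_count c 0 K) * ?p ^ r / ?p ^ CARD('n)" for c
  have scale: "(y / t * ?p) ^ n * (?p ^ r / ?p ^ CARD('n)) = y ^ n" for y
    unfolding pb(4)[symmetric] n_def[symmetric] power_mult_distrib power_divide using t0 p0 by simp
  have L_up: "L c \<le> y ^ n * ?V" if "0 < c" "c + \<alpha> = y / t * ?p" for c y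
  proof -
    have "real (lattice_count c 0 K) \<le> (y / t * ?p) ^ n * ?V"
      using lattice_count_le[OF K(2,1) ab(3,1) that(1), of 0] unfolding that(2) n_def .
    then have "L c \<le> ((y / t * ?p) ^ n * ?V) * (?p ^ r / ?p ^ CARD('n))"
      unfolding L_def times_divide_eq_right[symmetric] by (rule mult_right_mono) simp
    also have "\<dots> = ((y / t * ?p) ^ n * (?p ^ r / ?p ^ CARD('n))) * ?V" by (simp only: mult_ac)
    finally show ?thesis unfolding scale .
  qed
  have L_low: "y ^ n * ?V \<le> L c" if "\<alpha> < c" "c - \<alpha> = y / t * ?p" for c y
  proof -
    have "(y / t * ?p) ^ n * ?V \<le> real (lattice_count c 0 K)"
      using lattice_count_ge[OF K(2,1) ab(3,1) that(1), of 0] unfolding that(2) n_def .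
    then have "((y / t * ?p) ^ n * ?V) * (?p ^ r / ?p ^ CARD('n)) \<le> L c"
      unfolding L_def times_divide_eq_right[symmetric] by (rule mult_right_mono) simp
    moreover have "((y / t * ?p) ^ n * ?V) * (?p ^ r / ?p ^ CARD('n)) = ((y / t * ?p) ^ n * (?p ^ r / ?p ^ CARD('n))) * ?V"
      by (simp only: mult_ac)
    ultimately show ?thesis unfolding scale by simp
  qed
  have \<alpha>a: "\<alpha> = a / t * ?p" unfolding a_def using t0 p0 by simp
  define cp where "cp = ?p / t + \<alpha>"
  define cm where "cm = ?p / t - \<alpha>"
  have cp: "cp = (1 + a) / t * ?p" and cm: "cm = (1 - a) / t * ?p"
    unfolding cp_def cm_def \<alpha>a by (simp_all add: add_divide_distrib diff_divide_distrib algebra_simps)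
  have cp0: "0 < cp" unfolding cp using a0 t0 p0 by simp
  have cm0: "0 < cm" unfolding cm using a0 a1 t0 p0 by simp
  have cp\<alpha>: "\<alpha> < cp" unfolding cp_def using t0 p0 by simp
  have cm\<alpha>: "\<alpha> < cm"
  proof -
    have "cm - \<alpha> = (1 - 2 * a) / t * ?p" unfolding cm by (subst \<alpha>a) (simp add: diff_divide_distrib algebra_simps)
    also have "0 < \<dots>" using a1 t0 p0 by simp
    finally show ?thesis by simp
  qed
  have Lp_up: "L cp \<le> (1 + \<epsilon> / 10) * ?V"
  proof -
    have "cp + \<alpha> = (1 + 2 * a) / t * ?p" unfolding cp by (subst \<alpha>a) (simp add: add_divide_distrib algebra_simps)
    from L_up[OF cp0 this] mult_right_mono[OF near1(1), of ?V] V0 show ?thesis by linarith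
  qed
  \<comment> \<open>Here \<open>cp - \<alpha>\<close> is exactly p/t, so no error factor
    arises.\<close>
  have Lp_low: "?V \<le> L cp"
  proof -
    have "cp - \<alpha> = 1 / t * ?p" unfolding cp_def by simp
    from L_low[OF cp\<alpha> this] show ?thesis by simp
  qed
  have Lm_low: "(1 - \<epsilon> / 10) * ?V \<le> L cm"
  proof -
    have "cm - \<alpha> = (1 - 2 * a) / t * ?p" unfolding cm by (subst \<alpha>a) (simp add: diff_divide_distrib algebra_simps)
    from L_low[OF cm\<alpha> this] mult_right_mono[OF near1(2), of ?V] V0 show ?thesis by linarith
  qed
  have mult_B: "real (lattice_count (c / ?p) x K) \<le> B" if c: "0 < c" "c \<le> cp" for c and x :: "real ^ 'n"
    unfolding B_def
  proof (rule lattice_count_multiplicity_le[OF K(2,1) V0 ab(4) ab(1,2) t0 p0 _ _ ab(5) \<alpha>V])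
    show "0 < ?n powr b" using n0 by simp
    show "0 < c / ?p" using c p0 by simp
    show "(3 * ?n powr b) ^ CARD('n) * ?p ^ 3 \<le> t ^ CARD('n)" using pb(5) unfolding n_def .
    have "c / ?p * t \<le> cp / ?p * t" using c p0 t0 by (intro mult_right_mono divide_right_mono) auto
    also have "\<dots> = 1 + a" unfolding cp using p0 t0 by simp
    also have "\<dots> \<le> 1 + 2 * a" using a0 by simp
    finally have "(c / ?p * t) ^ CARD('n) \<le> (1 + 2 * a) ^ CARD('n)" using c p0 t0 by (intro power_mono) auto
    then show "(c / ?p * t) ^ CARD('n) \<le> 2" using near1(1) \<epsilon> unfolding n_def by linarith
  qed
  have n26: "26 \<le> CARD('n)" using n_gt unfolding n_def by simp
  have rn: "r \<le> CARD('n)" using pb(2) unfolding n_def .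
  have q: "1024 * real CARD('n) \<le> (\<epsilon> * \<delta>)\<^sup>2 * real CARD('p)" using pb(3) unfolding e_def n_def p_def .
  define bad where "bad c = {S \<in> ?Gr. \<exists>x. \<epsilon> / 2 * L c \<le> \<bar>sum (residue_count c K) ((+) x ` S) - L c\<bar>}" for c
  have bad_p: "real (card (bad cp)) < \<delta> / 2 * real (card ?Gr)"
    unfolding bad_def L_def p_def
  proof (rule residue_count_hashing[OF n26 pb(1) rn K(2,1) B0 _ _ \<epsilon> \<delta> q])
    have "2 * ?p ^ 3 * B \<le> L cp" using BV Lp_low V0 by linarith
    then show "2 * real CARD('p) ^ 3 * B \<le> real (lattice_count cp 0 K) * real CARD('p) ^ r / real CARD('p) ^ CARD('n)"
      unfolding L_def p_def .
    show "real (lattice_count (cp / real CARD('p)) x K) \<le> B" for x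
      using mult_B[OF cp0 order_refl] unfolding p_def .
  qed
  have bad_m: "real (card (bad cm)) < \<delta> / 2 * real (card ?Gr)"
    unfolding bad_def L_def p_def
  proof (rule residue_count_hashing[OF n26 pb(1) rn K(2,1) B0 _ _ \<epsilon> \<delta> q])
    have "9 / 10 * ?V \<le> (1 - \<epsilon> / 10) * ?V" using \<epsilon> V0 by (intro mult_right_mono) auto
    then have "2 * ?p ^ 3 * B \<le> L cm" using BV Lm_low by linarith
    then show "2 * real CARD('p) ^ 3 * B \<le> real (lattice_count cm 0 K) * real CARD('p) ^ r / real CARD('p) ^ CARD('n)"
      unfolding L_def p_def .
    have cmp: "cm \<le> cp" unfolding cm_def cp_def using ab(1) by simp
    show "real (lattice_count (cm / real CARD('p)) x K) \<le> B" for x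
      using mult_B[OF cm0 cmp] unfolding p_def .
  qed
  \<comment> \<open>On an empty family the strict bound \<open>bad_p\<close> would read 0 < 0. So
    the uniform distribution on \<open>?Gr\<close> is meaningful.\<close>
  have Gr0: "?Gr \<noteq> {}"
  proof
    assume "?Gr = {}"
    with bad_p show False by simp
  qed
  have finGr: "finite ?Gr" by simp
  have covol1: "covol (dilate t (construction_A S)) = 1" if "S \<in> ?Gr" for S
  proof -
    have S: "vec.subspace S" "vec.dim S = r" using that unfolding Gr_def by auto
    show ?thesis
      unfolding covol_dilate_construction_A[OF S(1) t0] S(2) p_def[symmetric] n_def[symmetric] pb(4) using p0 by simp
  qed
  have eta_small: "eta K (dilate t (construction_A S)) < \<epsilon>" if S: "S \<in> ?Gr" "S \<notin> bad cp" "S \<notin> bad cm" for S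
  proof -
    have good: "\<bar>sum (residue_count c K) ((+) x ` S) - L c\<bar> < \<epsilon> / 2 * L c" if "c = cp \<or> c = cm" for c x
    proof (rule ccontr)
      assume "\<not> ?thesis"
      then have "\<epsilon> / 2 * L c \<le> \<bar>sum (residue_count c K) ((+) x ` S) - L c\<bar>" by (simp only: not_less)
      then have "S \<in> bad c" unfolding bad_def using S(1) by blast
      with that S(2,3) show False by blast
    qed
    \<comment> \<open>13/20 absorbs the product of 1 + \<epsilon>/2 and 1 + \<epsilon>/10. A
      constant below 1 keeps the supremum in \<open>eta\<close> strictly below \<epsilon>.\<close>
    have "\<bar>real (num_points (dilate t (construction_A S)) K x) / (?V / covol (dilate t (construction_A S))) - 1\<bar> \<le> 13 / 20 * \<epsilon>" for x
    proof -
      let ?N = "real (num_points (dilate t (construction_A S)) K x)"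
      obtain u where u: "?N \<le> sum (residue_count cp K) ((+) u ` S)"
        using num_points_le_residue_count[OF K(2,1) ab(3,1) t0, of S x] unfolding cp_def p_def by blast
      have \<alpha>c: "\<alpha> < real CARD('p) / t" using cm0 unfolding cm_def p_def by simp
      obtain v where v: "sum (residue_count cm K) ((+) v ` S) \<le> ?N"
        using num_points_ge_residue_count[OF K(2,1) ab(3,1) t0 \<alpha>c, of S x] unfolding cm_def p_def by blast
      have "?N \<le> (1 + \<epsilon> / 2) * L cp"
        using u good[of cp u, OF disjI1[OF refl]] unfolding distrib_right mult_1_left by linarith
      also have "\<dots> \<le> (1 + \<epsilon> / 2) * ((1 + \<epsilon> / 10) * ?V)" by (rule mult_left_mono[OF Lp_up]) (use \<epsilon> in simp)
      also have "\<dots> \<le> (1 + 13 / 20 * \<epsilon>) * ?V"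
      proof -
        have "(1 + \<epsilon> / 2) * (1 + \<epsilon> / 10) = 1 + 12 / 20 * \<epsilon> + \<epsilon> * \<epsilon> / 20" by (simp add: field_simps)
        moreover have "\<epsilon> * \<epsilon> \<le> \<epsilon>" using \<epsilon> by (intro mult_left_le) auto
        ultimately have "(1 + \<epsilon> / 2) * (1 + \<epsilon> / 10) \<le> 1 + 13 / 20 * \<epsilon>" by linarith
        from mult_right_mono[OF this, of ?V] V0 show ?thesis by (simp only: mult.assoc less_imp_le)
      qed
      finally have up: "?N \<le> (1 + 13 / 20 * \<epsilon>) * ?V" .
      have "(1 - 13 / 20 * \<epsilon>) * ?V \<le> (1 - \<epsilon> / 2) * ((1 - \<epsilon> / 10) * ?V)"
      proof -
        have "(1 - \<epsilon> / 2) * (1 - \<epsilon> / 10) = 1 - 12 / 20 * \<epsilon> + \<epsilon> * \<epsilon> / 20" by (simp add: field_simps)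
        moreover have "0 \<le> \<epsilon> * \<epsilon>" by simp
        ultimately have "1 - 13 / 20 * \<epsilon> \<le> (1 - \<epsilon> / 2) * (1 - \<epsilon> / 10)" using \<epsilon> by linarith
        from mult_right_mono[OF this, of ?V] V0 show ?thesis by (simp only: mult.assoc less_imp_le)
      qed
      also have "\<dots> \<le> (1 - \<epsilon> / 2) * L cm" by (rule mult_left_mono[OF Lm_low]) (use \<epsilon> in simp)
      also have "\<dots> \<le> ?N"
        using v good[of cm v, OF disjI2[OF refl]] unfolding left_diff_distrib mult_1_left by linarith
      finally have low: "(1 - 13 / 20 * \<epsilon>) * ?V \<le> ?N" .
      have "?N / ?V \<le> 1 + 13 / 20 * \<epsilon>" using up V0 by (simp only: pos_divide_le_eq)
      moreover have "1 - 13 / 20 * \<epsilon> \<le> ?N / ?V" using low V0 by (simp only: pos_le_divide_eq)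
      ultimately show ?thesis unfolding covol1[OF S(1)] div_by_1 by (intro abs_leI) linarith+
    qed
    then have "eta K (dilate t (construction_A S)) \<le> 13 / 20 * \<epsilon>" unfolding eta_def by (intro cSUP_least) simp_all
    then show ?thesis using \<epsilon> by linarith
  qed
  have ens: "construction_A_ensemble TYPE('p) r = map_pmf construction_A (pmf_of_set ?Gr)"
    unfolding construction_A_ensemble_def ..
  have "measure_pmf.prob (construction_A_ensemble TYPE('p) r :: (real ^ 'n) set pmf) {L. \<epsilon> \<le> eta K (dilate t L)}
      = measure_pmf.prob (pmf_of_set ?Gr) {S. \<epsilon> \<le> eta K (dilate t (construction_A S))}"
    unfolding ens by (simp add: vimage_def)
  also have "\<dots> = real (card (?Gr \<inter> {S. \<epsilon> \<le> eta K (dilate t (construction_A S))})) / real (card ?Gr)"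
    by (rule measure_pmf_of_set[OF Gr0 finGr])
  also have "\<dots> < \<delta>"
  proof -
    \<comment> \<open>Two bodies, one dilated and one shrunken, control all real translates, so a
      union bound over two events of probability below \<delta>/2 suffices.\<close>
    have "?Gr \<inter> {S. \<epsilon> \<le> eta K (dilate t (construction_A S))} \<subseteq> bad cp \<union> bad cm"
    proof
      fix S assume S: "S \<in> ?Gr \<inter> {S. \<epsilon> \<le> eta K (dilate t (construction_A S))}"
      show "S \<in> bad cp \<union> bad cm"
      proof (rule ccontr)
        assume "S \<notin> bad cp \<union> bad cm"
        then have "eta K (dilate t (construction_A S)) < \<epsilon>" using S by (intro eta_small) simp_all
        with S show False by simp
      qed
    qed
    then have "card (?Gr \<inter> {S. \<epsilon> \<le> eta K (dilate t (construction_A S))}) \<le> card (bad cp \<union> bad cm)"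
      by (intro card_mono) simp_all
    also have "\<dots> \<le> card (bad cp) + card (bad cm)" by (rule card_Un_le)
    finally have "real (card (?Gr \<inter> {S. \<epsilon> \<le> eta K (dilate t (construction_A S))})) < \<delta> * real (card ?Gr)"
      using bad_p bad_m by linarith
    moreover have "0 < real (card ?Gr)" using Gr0 finGr by (simp add: card_gt_0_iff)
    ultimately show ?thesis by (simp only: pos_divide_less_eq)
  qed
  finally have prob: "measure_pmf.prob (construction_A_ensemble TYPE('p) r :: (real ^ 'n) set pmf)
      {L. \<epsilon> \<le> eta K (dilate t L)} < \<delta>" .
  have "\<forall>L \<in> set_pmf (construction_A_ensemble TYPE('p) r :: (real ^ 'n) set pmf). covol (dilate t L) = 1"
  proof
    fix L :: "(real ^ 'n) set" assume "L \<in> set_pmf (construction_A_ensemble TYPE('p) r)"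
    then have "L \<in> construction_A ` ?Gr" unfolding ens set_map_pmf set_pmf_of_set[OF Gr0 finGr] .
    then obtain S where S: "L = construction_A S" "S \<in> ?Gr" by (rule imageE)
    show "covol (dilate t L) = 1" unfolding S(1) by (rule covol1[OF S(2)])
  qed
  from this prob show ?thesis unfolding t_def by (rule conjI)
qed

end
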